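(* Let $p\ge 3$ be a prime, let $m\ge 1$ and $i\ge 1$ be integers, and for each $n\ge 1$ let $\pi_n$ and $E_n=\mathbb{Q}(\pi_n)$ be as defined in the context. Write the minimal polynomial of $\pi_{m+i}$ over $E_m$ as $$\mu_{\pi_{m+i},E_m}(X)=\sum_{j=0}^{p^i}a_{i,j}X^j = X^{p^i}+\Big(\sum_{j=1}^{p^i-1}a_{i,j}X^j\Big)-\pi_m\in \mathbb{Z}_{(p)}[\pi_m][X],$$ and use the same notation with $i$ replaced by $i+\beta$ (same $m$). Divisibilities and congruences in (i)--(ii$'$) are in the ring $\mathbb{Z}_{(p)}[\pi_m]$. Then: (i) $p^i$ divides $j\,a_{i,j}$ for all $j\in[0,p^i]$. (i$'$) If $j\in[0,p^i]$ and $j<p^i(p-2)/(p-1)$, then $p^i\pi_m$ divides $j\,a_{i,j}$. (ii) $a_{i,j}\equiv a_{i+\beta,\,p^\beta j} \pmod{p^{i+1}}$ for all $j\in[0,p^i]$ and all $\beta\ge 1$. (ii$'$) If $j\in[0,p^i]$ and $j<p^i(p-2)/(p-1)$, then $a_{i,j}\equiv a_{i+\beta,\,p^\beta j}\pmod{p^{i+1}\pi_m}$ for all $\beta\ge 1$. (iii) For all $\beta\in[0,i-1]$, the element $a_{i,\,p^i-(p^i-p^\beta)/(p-1)}\,/\,p^{i-\beta}$ is a unit of $\mathbb{Z}_{(p)}[\pi_m]$. (iv) For all $n\ge 2$, the minimal polynomial of $\pi_n$ over $\mathbb{Q}$ satisfies $\mu_{\pi_n,\mathbb{Q}}(X)\equiv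 X^{p^{n-1}}+pX^{(p-1)p^{n-2}}-p \pmod{p^2}$ (coefficientwise).
   Context: $[a,b]$ denotes the set of integers $c$ with $a\le c\le b$. For $n\ge1$ let $\zeta_{p^n}$ be a primitive $p^n$-th root of unity over $\mathbb{Q}$, chosen so that $\zeta_{p^{n+1}}^p=\zeta_{p^n}$ for all $n\ge 1$. Put $F_n=\mathbb{Q}(\zeta_{p^n})$ and let $E_n$ be the fixed field in $F_n$ of the unique subgroup $C_{p-1}$ of order $p-1$ of $\mathrm{Gal}(F_n|\mathbb{Q})\cong(\mathbb{Z}/p^n)^*$, so $[E_n:\mathbb{Q}]=p^{n-1}$. Put $$\pi_n=\mathrm{N}_{F_n|E_n}(\zeta_{p^n}-1)=\prod_{j=1}^{p-1}\big(\zeta_{p^n}^{\,j^{p^{n-1}}}-1\big).$$ Then $E_n=\mathbb{Q}(\pi_n)$, $\pi_1=p$, $E_1=\mathbb{Q}$, $E_{m+i}=E_m(\pi_{m+i})$ with $[E_{m+i}:E_m]=p^i$, and $\mathbb{Z}_{(p)}[\pi_n]$ is the integral closure of $\mathbb{Z}_{(p)}$ in $E_n$, a discrete valuation ring with maximal ideal generated by $\pi_n$. $\mathbb{Z}_{(p)}$ is the localization of $\mathbb{Z}$ at the prime ideal $(p)$. *)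

theory Defs
  imports "HOL-Algebra.Algebra" "HOL-Algebra.Algebraic_Closure_Type"
begin

text \<open>
  Everything takes place inside an ambient field of characteristic zero, given as a type
  \<open>'a\<close>. To use the HOL-Algebra notions, it is viewed as the ring structure
  \<^const>\<open>ring_of_type_algebra\<close>, whose operations are those of the type.
\<close>

definition subring_on :: "'a::field_char_0 set \<Rightarrow> 'a ring" where
  "subring_on A = ring_of_type_algebra\<lparr>carrier := A\<rparr>"

definition primitive_root_of_unity :: "nat \<Rightarrow> 'a::field_char_0 \<Rightarrow> bool" where
  "primitive_root_of_unity k z \<longleftrightarrow> z ^ k = 1 \<and> (\<forall>l. 0 < l \<and> l < k \<longrightarrow> z ^ l \<noteq> 1)"

text \<open>Only the values of the sequence at indices \<open>n \<ge> 1\<close> matter.\<close>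

definition compatible_roots :: "nat \<Rightarrow> (nat \<Rightarrow> 'a::field_char_0) \<Rightarrow> bool" where
  "compatible_roots p \<zeta> \<longleftrightarrow>
     (\<forall>n\<ge>1. primitive_root_of_unity (p ^ n) (\<zeta> n) \<and> \<zeta> (Suc n) ^ p = \<zeta> n)"

definition Galois_group ::
    "'a::field_char_0 set \<Rightarrow> 'a set \<Rightarrow> ('a \<Rightarrow> 'a) monoid" where
  "Galois_group L K = (BijGroup L)
     \<lparr>carrier := {\<sigma> \<in> Bij L. \<sigma> \<in> ring_iso (subring_on L) (subring_on L) \<and> (\<forall>x\<in>K. \<sigma> x = x)}\<rparr>"

definition cyclo_field :: "(nat \<Rightarrow> 'a::field_char_0) \<Rightarrow> nat \<Rightarrow> 'a set" where
  "cyclo_field \<zeta> n = generate_field ring_of_type_algebra (insert (\<zeta> n) \<rat>)"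

definition cyclo_subgroup :: "nat \<Rightarrow> (nat \<Rightarrow> 'a::field_char_0) \<Rightarrow> nat \<Rightarrow> ('a \<Rightarrow> 'a) set" where
  "cyclo_subgroup p \<zeta> n =
     (THE C. subgroup C (Galois_group (cyclo_field \<zeta> n) \<rat>) \<and> card C = p - 1)"

definition E_field :: "nat \<Rightarrow> (nat \<Rightarrow> 'a::field_char_0) \<Rightarrow> nat \<Rightarrow> 'a set" where
  "E_field p \<zeta> n = {x \<in> cyclo_field \<zeta> n. \<forall>\<sigma>\<in>cyclo_subgroup p \<zeta> n. \<sigma> x = x}"

text \<open>The norm of \<open>\<zeta> n - 1\<close> down to \<open>E_field p \<zeta> n\<close>: the powers
  \<open>j ^ (p ^ (n - 1))\<close> for \<open>1 \<le> j < p\<close> represent the elements of the subgroup of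
  order \<open>p - 1\<close> of the units modulo \<open>p ^ n\<close>.\<close>

definition pi_elem :: "nat \<Rightarrow> (nat \<Rightarrow> 'a::field_char_0) \<Rightarrow> nat \<Rightarrow> 'a" where
  "pi_elem p \<zeta> n = (\<Prod>j = 1..p - 1. \<zeta> n ^ (j ^ (p ^ (n - 1))) - 1)"

text \<open>\<^term>\<open>ring.Irr\<close> yields the list of coefficients with the leading coefficient first,
  whereas \<^const>\<open>Poly\<close> expects the constant coefficient first.\<close>

definition min_poly :: "'a::field_char_0 set \<Rightarrow> 'a \<Rightarrow> 'a poly" where
  "min_poly K x = Poly (rev (ring.Irr ring_of_type_algebra K x))"

text \<open>The coefficient of \<open>X ^ j\<close> in the minimal polynomial of \<open>pi_elem p \<zeta> (m + i)\<close>
  over \<open>E_field p \<zeta> m\<close>.\<close>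

definition a_coeff ::
    "nat \<Rightarrow> (nat \<Rightarrow> 'a::field_char_0) \<Rightarrow> nat \<Rightarrow> nat \<Rightarrow> nat \<Rightarrow> 'a" where
  "a_coeff p \<zeta> m i j = Polynomial.coeff (min_poly (E_field p \<zeta> m) (pi_elem p \<zeta> (m + i))) j"

definition Z_localized :: "nat \<Rightarrow> 'a::field_char_0 set" where
  "Z_localized p = {of_int a / of_int b |a b. \<not> int p dvd b}"

text \<open>\<^term>\<open>ring.simple_extension\<close> consists of the values at \<open>x\<close> of the polynomials over the
  given subring; no inverses are adjoined.\<close>

definition Z_pi_ring :: "nat \<Rightarrow> (nat \<Rightarrow> 'a::field_char_0) \<Rightarrow> nat \<Rightarrow> 'a ring" where
  "Z_pi_ring p \<zeta> m = subring_on
     (ring.simple_extension ring_of_type_algebra (Z_localized p) (pi_elem p \<zeta> m))"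

definition cong_in :: "'a::field_char_0 ring \<Rightarrow> 'a \<Rightarrow> 'a \<Rightarrow> 'a \<Rightarrow> bool" where
  "cong_in A d x y \<longleftrightarrow> x \<in> carrier A \<and> y \<in> carrier A \<and> d divides\<^bsub>A\<^esub> (x - y)"

end

theory Submission
  imports Defs "HOL-Number_Theory.Number_Theory"
begin

text \<open>
  The ambient field carries a valuation ring \<open>V\<close> with \<open>1 / p \<notin> V\<close>. On the tower,
  \<open>p\<close> is associated to \<open>(\<zeta>\<^sub>n - 1) ^ ((p - 1) * p ^ (n - 1))\<close>, so that sums of terms with pairwise
  distinct values can be estimated termwise. This yields the degrees of the fields, the structure
  of \<open>E\<^sub>m\<close> and the identity \<open>\<int>\<^sub>(\<^sub>p\<^sub>)[\<pi>\<^sub>m] = E\<^sub>m \<inter> V\<close>.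

  The minimal polynomial \<open>\<mu>\<close> of \<open>\<pi> = \<pi>\<^sub>m\<^sub>+\<^sub>i\<close> is the product of \<open>X - \<sigma> \<pi>\<close>, and
  \<open>\<pi> - \<sigma> \<pi>\<close> has the value of \<open>(\<sigma> \<zeta> / \<zeta> - 1) (\<zeta> - 1) ^ (p - 2)\<close>, which gives the value of
  \<open>\<mu>' \<pi>\<close>. The terms of \<open>\<pi> \<mu>' \<pi> = \<Sum>\<^sub>j j a\<^sub>i\<^sub>,\<^sub>j \<pi>\<^sup>j\<close> have distinct values; hence (i), (i') and the case
  \<open>\<beta> = 0\<close> of (iii), as exactly one term attains the value of the sum.

  For (ii) and (ii') let \<open>\<Pi> = \<pi>\<^sub>m\<^sub>+\<^sub>i\<^sub>+\<^sub>1\<close>. Then \<open>\<pi> = \<Pi>\<^sup>p (1 + \<theta>)\<close> with \<open>\<theta>\<close> close to \<open>p / (\<zeta> - 1) ^ (p - 1)\<close>,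
  and \<open>(1 + \<theta>)\<^sup>j - 1\<close> is a multiple of \<open>j \<theta>\<close>. Subtracting \<open>\<Sum>\<^sub>j a\<^sub>i\<^sub>,\<^sub>j \<pi>\<^sup>j = 0\<close> from the equation
  of \<open>\<Pi>\<close>, whose terms with exponent prime to \<open>p\<close> are small by (i), bounds
  \<open>\<Sum>\<^sub>j (a\<^sub>i\<^sub>+\<^sub>1\<^sub>,\<^sub>p\<^sub>j - a\<^sub>i\<^sub>,\<^sub>j) \<Pi>\<^sup>p\<^sup>j\<close>, again termwise. By these congruences (iv) reduces to the coefficient of
  \<open>X ^ (p - 1)\<close> for \<open>n = 2\<close>, which a more precise expansion of \<open>\<theta>\<close> determines.
\<close>

section \<open>Valuation rings\<close>

text \<open>The ambient field is an arbitrary type of characteristic zero, on which no valuation is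
  given. Zorn's lemma supplies one as a bare ring \<open>V\<close>, in general not discrete; values
  are therefore not numbers but two relations, \<open>D\<close> (at least k) and \<open>U\<close>
  (exactly k), measured against one fixed \<open>\<zeta> N - 1\<close>. Termwise estimates work
  because of ramification: nonzero rationals have values in multiples of \<open>phi N\<close>,
  nonzero elements of \<open>E m\<close> in multiples of \<open>vpi m\<close>, and the accompanying
  powers shift them by distinct residues. The same discreteness rounds bounds up. This is the origin
  of the threshold \<open>p ^ i * (p - 2) / (p - 1)\<close>: up to a positive factor and a multiple
  of \<open>vpi m\<close>, the bound for \<open>j * mu_coeff m i j\<close> is
  \<open>(p - 2) * p ^ i + 1 - j * (p - 1)\<close>, and where this is positive, rounding gains one
  more factor \<open>pi m\<close>. The congruences are shown for one step from i to i + 1 and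
  restated as divisibility in a ring that no longer mentions \<open>V\<close> or \<open>N\<close>,
  so that steps proved at different levels can be added.\<close>

definition is_subring :: "'a::field set \<Rightarrow> bool" where
  "is_subring B \<longleftrightarrow> 1 \<in> B \<and> (\<forall>a\<in>B. \<forall>b\<in>B. a - b \<in> B \<and> a * b \<in> B)"

lemma is_subringD:
  assumes "is_subring B"
  shows is_subring_1: "1 \<in> B" and is_subring_0: "0 \<in> B"
    and is_subring_diff: "a \<in> B \<Longrightarrow> b \<in> B \<Longrightarrow> a - b \<in> B"
    and is_subring_mult: "a \<in> B \<Longrightarrow> b \<in> B \<Longrightarrow> a * b \<in> B"
    and is_subring_uminus: "a \<in> B \<Longrightarrow> - a \<in> B"
    and is_subring_add: "a \<in> B \<Longrightarrow> b \<in> B \<Longrightarrow> a + b \<in> B"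
proof -
  show 1: "1 \<in> B" and d: "\<And>a b. a \<in> B \<Longrightarrow> b \<in> B \<Longrightarrow> a - b \<in> B"
    and "a \<in> B \<Longrightarrow> b \<in> B \<Longrightarrow> a * b \<in> B"
    using assms by (auto simp: is_subring_def)
  show 0: "0 \<in> B" using d[OF 1 1] by simp
  show u: "- a \<in> B" if "a \<in> B" for a using d[OF 0 that] by simp
  show "a + b \<in> B" if "a \<in> B" "b \<in> B" using d[OF that(1) u[OF that(2)]] by simp
qed

lemma is_subring_sum:
  assumes "is_subring B" "\<And>i. i \<in> I \<Longrightarrow> f i \<in> B"
  shows "sum f I \<in> B"
  using assms(2)
  by (induction I rule: infinite_finite_induct) (auto simp: is_subringD[OF assms(1)])

lemma is_subring_power: "is_subring B \<Longrightarrow> a \<in> B \<Longrightarrow> a ^ n \<in> B"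
  by (induction n) (auto simp: is_subringD)

text \<open>The set is B[y]. Finite sums with a total coefficient function are the form in which the
  maximality argument needs it, while closure under products is read off from polynomials.\<close>

lemma is_subring_adjoin:
  assumes B: "is_subring B"
  shows "is_subring {\<Sum>k\<le>n. b k * y ^ k |b n. \<forall>k. b k \<in> B}" (is "is_subring ?C")
proof -
  have eq: "?C = {poly f y |f. \<forall>k. Polynomial.coeff f k \<in> B}"
  proof (intro equalityI subsetI)
    fix z assume "z \<in> ?C"
    then obtain b n where z: "z = (\<Sum>k\<le>n. b k * y ^ k)" and b: "\<forall>k. b k \<in> B" by auto
    have "z = poly (\<Sum>k\<le>n. Polynomial.monom (b k) k) y"
      by (simp add: z poly_sum poly_monom)
    moreover have "Polynomial.coeff (\<Sum>k\<le>n. Polynomial.monom (b k) k) l \<in> B" for l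
      unfolding coeff_sum
      by (rule is_subring_sum[OF B]) (auto simp: b is_subring_0[OF B])
    ultimately show "z \<in> {poly f y |f. \<forall>k. Polynomial.coeff f k \<in> B}" by blast
  next
    fix z assume "z \<in> {poly f y |f. \<forall>k. Polynomial.coeff f k \<in> B}"
    then show "z \<in> ?C" by (auto simp: poly_altdef)
  qed
  show ?thesis unfolding eq is_subring_def
  proof (intro conjI ballI)
    show "1 \<in> {poly f y |f. \<forall>k. Polynomial.coeff f k \<in> B}"
      by (rule CollectI, rule exI[of _ 1]) (auto simp: is_subringD[OF B] coeff_1)
  next
    fix u w assume "u \<in> {poly f y |f. \<forall>k. Polynomial.coeff f k \<in> B}"
      "w \<in> {poly f y |f. \<forall>k. Polynomial.coeff f k \<in> B}"
    then obtain f g where f: "u = poly f y" "\<forall>k. Polynomial.coeff f k \<in> B"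
      and g: "w = poly g y" "\<forall>k. Polynomial.coeff g k \<in> B" by auto
    show "u - w \<in> {poly f y |f. \<forall>k. Polynomial.coeff f k \<in> B}"
      by (rule CollectI, rule exI[of _ "f - g"])
        (use f g in \<open>auto simp: is_subring_diff[OF B]\<close>)
    show "u * w \<in> {poly f y |f. \<forall>k. Polynomial.coeff f k \<in> B}"
      by (rule CollectI, rule exI[of _ "f * g"])
        (use f g in \<open>auto simp: coeff_mult intro!: is_subring_sum[OF B] is_subring_mult[OF B]\<close>)
  qed
qed

text \<open>An extension of the p-adic valuation to the ambient field, given by its ring alone:
  \<open>V_total\<close> makes it a valuation ring, and \<open>inv_p\<close> puts p into its maximal
  ideal.\<close>

locale valuation_subring =
  fixes V :: "'a::field_char_0 set" and p :: nat
  assumes V: "is_subring V"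
    and V_total: "y \<in> V \<or> inverse y \<in> V"
    and inv_p: "inverse (of_nat p) \<notin> V"
    and p: "Factorial_Ring.prime p"

text \<open>A subring that is maximal among those not containing \<open>1 / p\<close> is a valuation ring: every
  element of \<open>1 + p B\<close> is a unit, so from two equations expressing \<open>1\<close> as an element
  of \<open>p B[y]\<close> and of \<open>p B[1 / y]\<close>, the one of larger degree can be shortened.\<close>

lemma maximal_subring_valuation:
  fixes B :: "'a::field_char_0 set"
  assumes B: "is_subring B" and q: "inverse q \<notin> B" "q \<in> B" "q \<noteq> 0"
    and max: "\<And>C. is_subring C \<Longrightarrow> B \<subseteq> C \<Longrightarrow> inverse q \<notin> C \<Longrightarrow> C = B"
  shows "y \<in> B \<or> inverse y \<in> B"
proof (rule ccontr)
  assume no: "\<not> ?thesis"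
  note BI = is_subringD[OF B] is_subring_power[OF B] is_subring_sum[OF B]
  define adj where "adj z = {\<Sum>k\<le>n. b k * z ^ k |b n. \<forall>k. b k \<in> B}" for z
  have inadj: "B \<subseteq> adj z" "z \<in> adj z" for z
  proof -
    show "B \<subseteq> adj z"
    proof
      fix b assume b: "b \<in> B"
      show "b \<in> adj z" unfolding adj_def
        by (rule CollectI, rule exI[of _ "\<lambda>_. b"], rule exI[of _ 0]) (simp add: b)
    qed
    show "z \<in> adj z" unfolding adj_def
      by (rule CollectI, rule exI[of _ "\<lambda>k. of_bool (k = 1)"], rule exI[of _ 1])
        (auto simp: BI)
  qed
  have rep: "\<exists>b n. (\<forall>k. b k \<in> B) \<and> 1 = q * (\<Sum>k\<le>n. b k * z ^ k)" if "z \<notin> B" for z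
  proof -
    have "inverse q \<in> adj z"
      using max[of "adj z"] is_subring_adjoin[OF B, of z] inadj[of z] that
      unfolding adj_def[symmetric] by auto
    then obtain b n where "\<forall>k. b k \<in> B" "inverse q = (\<Sum>k\<le>n. b k * z ^ k)"
      by (auto simp: adj_def)
    moreover from this(2) have "1 = q * (\<Sum>k\<le>n. b k * z ^ k)" using q(3)
      by (metis right_inverse)
    ultimately show ?thesis by blast
  qed
  \<comment> \<open>With u = 1 - q b, an equation for 1 / q in B[1 / u] is cleared by u^n and puts
    u^n into q B. But u^n is also 1 minus an element of q B, so q would be invertible in B.\<close>
  have unit: "inverse (1 - q * b) \<in> B" if b: "b \<in> B" for b
  proof (rule ccontr)
    let ?u = "1 - q * b"
    assume "inverse ?u \<notin> B"
    from rep[OF this] obtain c n where c: "\<forall>k. c k \<in> B"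
      and 1: "1 = q * (\<Sum>k\<le>n. c k * inverse ?u ^ k)" by auto
    have u0: "?u \<noteq> 0" using q b by (metis BI(1) right_minus_eq inverse_unique)
    have "?u ^ n = q * (\<Sum>k\<le>n. c k * inverse ?u ^ k) * ?u ^ n" using 1 by simp
    also have "\<dots> = q * (\<Sum>k\<le>n. c k * ?u ^ (n - k))"
      unfolding mult.assoc sum_distrib_right
      by (intro arg_cong2[where f="(*)"] sum.cong refl)
        (use u0 in \<open>auto simp: power_diff field_simps\<close>)
    finally have un: "?u ^ n = q * (\<Sum>k\<le>n. c k * ?u ^ (n - k))" .
    have "\<exists>d\<in>B. ?u ^ l = 1 - q * d" for l
    proof (induction l)
      case 0 show ?case by (rule bexI[of _ 0]) (auto simp: BI)
    next
      case (Suc l)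
      then obtain d where d: "d \<in> B" "?u ^ l = 1 - q * d" by blast
      have "?u ^ Suc l = 1 - q * (b + d - q * b * d)"
        unfolding power_Suc d(2) by (simp add: algebra_simps)
      then show ?case by (rule bexI) (use b d q in \<open>auto intro!: BI\<close>)
    qed
    then obtain d where d: "d \<in> B" "?u ^ n = 1 - q * d" by blast
    let ?w = "d + (\<Sum>k\<le>n. c k * ?u ^ (n - k))"
    have "q * ?w = 1" using un d(2) by (simp add: algebra_simps)
    then have "inverse q = ?w" by (simp add: inverse_unique)
    moreover have "?w \<in> B" using b d q c by (auto intro!: BI)
    ultimately show False using q by simp
  qed
  have y0: "y \<noteq> 0" using no BI(2) by auto
  define R where "R z n \<longleftrightarrow> (\<exists>b. (\<forall>k. b k \<in> B) \<and> 1 = q * (\<Sum>k\<le>n. b k * z ^ k))" for z n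
  have R: "\<exists>n. R y n" "\<exists>n. R (inverse y) n"
    using rep[of y] rep[of "inverse y"] no unfolding R_def by blast+
  have R0: "\<not> R z 0" for z
  proof
    assume "R z 0"
    then obtain b where "b \<in> B" "1 = q * b" by (auto simp: R_def)
    then show False using q by (metis inverse_unique)
  qed
  \<comment> \<open>Since \<open>1 - q * c 0\<close> is a unit, the second equation expresses
    \<open>z ^ n\<close> through lower powers with coefficients in q B; substituting this removes
    the top term of the first.\<close>
  have shorten: "R z (n - 1)" if Rn: "R z n" "R (inverse z) m" and le: "m \<le> n" and z0: "z \<noteq> 0" for z n m
  proof -
    from Rn obtain b c where b: "\<forall>k. b k \<in> B" "1 = q * (\<Sum>k\<le>n. b k * z ^ k)"
      and c: "\<forall>k. c k \<in> B" "1 = q * (\<Sum>k\<le>m. c k * inverse z ^ k)" by (auto simp: R_def)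
    have n: "n > 0" and m: "m > 0" using Rn R0 by (metis neq0_conv)+
    let ?i = "inverse (1 - q * c 0)"
    have i0: "1 - q * c 0 \<noteq> 0" using q c by (metis BI(1) right_minus_eq inverse_unique)
    obtain m' where m': "m = Suc m'" using m by (cases m) auto
    obtain n' where n': "n = Suc n'" using n by (cases n) auto
    have "1 = q * c 0 + q * (\<Sum>k\<le>m'. c (Suc k) * inverse z ^ Suc k)"
      using c(2) unfolding m' sum.atMost_Suc_shift by (simp add: algebra_simps)
    then have "1 - q * c 0 = q * (\<Sum>k\<le>m'. c (Suc k) * inverse z ^ Suc k)" by (simp add: algebra_simps)
    then have "1 = ?i * (q * (\<Sum>k\<le>m'. c (Suc k) * inverse z ^ Suc k))"
      using i0 by (metis left_inverse)
    then have "z ^ n = ?i * (q * (\<Sum>k\<le>m'. c (Suc k) * inverse z ^ Suc k)) * z ^ n" by simp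
    also have "\<dots> = q * (\<Sum>k\<le>m'. ?i * c (Suc k) * z ^ (n' - k))"
      unfolding sum_distrib_left sum_distrib_right n'
    proof (intro sum.cong refl)
      fix k assume "k \<in> {..m'}"
      then have "k \<le> n'" using le n' m' by simp
      then have "z ^ n' = z ^ (n' - k) * z ^ k" by (simp flip: power_add)
      then have *: "inverse z ^ Suc k * z ^ Suc n' = z ^ (n' - k)" using z0 by (simp add: power_inverse field_simps)
      have "?i * (q * (c (Suc k) * inverse z ^ Suc k)) * z ^ Suc n' =
        q * (?i * c (Suc k) * (inverse z ^ Suc k * z ^ Suc n'))" by (simp only: mult_ac)
      then show "?i * (q * (c (Suc k) * inverse z ^ Suc k)) * z ^ Suc n' =
        q * (?i * c (Suc k) * z ^ (n' - k))" by (simp only: *)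
    qed
    also have "(\<Sum>k\<le>m'. ?i * c (Suc k) * z ^ (n' - k)) =
        (\<Sum>k\<in>(\<lambda>k. n' - k) ` {..m'}. ?i * c (Suc (n' - k)) * z ^ k)"
      using le n' m' by (subst sum.reindex) (auto simp: inj_on_def intro!: sum.cong)
    \<comment> \<open>Only the exponents from n' - m' on occur; \<open>of_bool\<close> pads the sum
      with zeros below them.\<close>
    also have "\<dots> = (\<Sum>k\<le>n'. of_bool (n' - k \<le> m') * (?i * c (Suc (n' - k)) * z ^ k))"
    proof (rule sum.mono_neutral_cong_left)
      show "\<forall>k\<in>{..n'} - (-) n' ` {..m'}. of_bool (n' - k \<le> m') * (?i * c (Suc (n' - k)) * z ^ k) = 0"
      proof
        fix k assume k: "k \<in> {..n'} - (-) n' ` {..m'}"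
        have "\<not> n' - k \<le> m'"
        proof
          assume "n' - k \<le> m'"
          then have "n' - (n' - k) \<in> (-) n' ` {..m'}" by blast
          then show False using k by simp
        qed
        then show "of_bool (n' - k \<le> m') * (?i * c (Suc (n' - k)) * z ^ k) = 0" by simp
      qed
    qed (use le n' m' in auto)
    finally have zn: "z ^ n = q * (\<Sum>k\<le>n'. of_bool (n' - k \<le> m') * (?i * c (Suc (n' - k)) * z ^ k))" .
    have "1 = q * ((\<Sum>k\<le>n'. b k * z ^ k) + b n * z ^ n)" using b(2) n' by simp
    also have "(\<Sum>k\<le>n'. b k * z ^ k) + b n * z ^ n =
        (\<Sum>k\<le>n'. (b k + q * b n * of_bool (n' - k \<le> m') * ?i * c (Suc (n' - k))) * z ^ k)"
      unfolding zn by (simp add: sum_distrib_left sum.distrib algebra_simps)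
    finally have eq: "1 = q * \<dots>" .
    have "b k + q * b n * of_bool (n' - k \<le> m') * ?i * c (Suc (n' - k)) \<in> B" for k
      using b(1) c(1) unit[of "c 0"] q(2) by (auto intro!: BI)
    then show ?thesis unfolding R_def using n' eq
      by (intro exI[of _ "\<lambda>k. b k + q * b n * of_bool (n' - k \<le> m') * ?i * c (Suc (n' - k))"]) simp
  qed
  define n m where "n = (LEAST n. R y n)" and "m = (LEAST n. R (inverse y) n)"
  have n: "R y n" "\<And>k. k < n \<Longrightarrow> \<not> R y k" and m: "R (inverse y) m" "\<And>k. k < m \<Longrightarrow> \<not> R (inverse y) k"
    using R unfolding n_def m_def by (auto intro: LeastI_ex dest: not_less_Least)
  have "n > 0" "m > 0" using n m R0 by (metis neq0_conv)+
  show False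
  proof (cases "m \<le> n")
    case True
    then show False using shorten[OF n(1) m(1)] n(2)[of "n - 1"] \<open>n > 0\<close> y0 by auto
  next
    case False
    then show False using shorten[of "inverse y" m n] n(1) m(1) m(2)[of "m - 1"] \<open>m > 0\<close> y0 by auto
  qed
qed

lemma is_subring_Ints: "is_subring (\<int> :: 'a::field_char_0 set)"
  by (auto simp: is_subring_def)

text \<open>Zorn's lemma on the subrings that avoid 1 / p, of which the integers are one.\<close>

lemma exists_valuation_subring:
  assumes "Factorial_Ring.prime p"
  shows "\<exists>V :: 'a::field_char_0 set. valuation_subring V p"
proof -
  define \<S> where "\<S> = {B :: 'a set. is_subring B \<and> inverse (of_nat p) \<notin> B}"
  have "\<exists>M\<in>\<S>. \<forall>E\<in>\<S>. M \<subseteq> E \<longrightarrow> E = M"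
  proof (rule subset_Zorn_nonempty)
    have "inverse (of_nat p) \<notin> (\<int> :: 'a set)"
    proof
      assume "inverse (of_nat p :: 'a) \<in> \<int>"
      then obtain k :: int where k: "inverse (of_nat p :: 'a) = of_int k" by (auto elim: Ints_cases)
      have "(of_nat p :: 'a) * of_int k = 1"
        using k assms by (metis of_nat_eq_0_iff not_prime_0 right_inverse)
      then have "of_int (int p * k) = (1 :: 'a)" by simp
      then have "int p * k = 1" by (simp only: of_int_eq_1_iff)
      then show False using assms prime_gt_1_nat
        by (metis int_dvd_int_iff dvd_triv_left nat_dvd_1_iff_1 not_prime_1 of_nat_1)
    qed
    then show "\<S> \<noteq> {}" using is_subring_Ints[where 'a='a] unfolding \<S>_def by blast
  next
    fix \<C> assume C: "\<C> \<noteq> {}" "subset.chain \<S> \<C>"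
    have sub: "is_subring B" "inverse (of_nat p) \<notin> B" if "B \<in> \<C>" for B
      using C that by (auto simp: subset.chain_def \<S>_def)
    have "is_subring (\<Union>\<C>)" unfolding is_subring_def
    proof (intro conjI ballI)
      show "1 \<in> \<Union>\<C>" using C sub by (auto simp: is_subring_def)
      fix a b assume "a \<in> \<Union>\<C>" "b \<in> \<Union>\<C>"
      then obtain A B where AB: "A \<in> \<C>" "B \<in> \<C>" "a \<in> A" "b \<in> B" by auto
      then have "A \<subseteq> B \<or> B \<subseteq> A" using C by (auto simp: subset.chain_def)
      then obtain E where "E \<in> \<C>" "a \<in> E" "b \<in> E" using AB by blast
      then show "a - b \<in> \<Union>\<C>" "a * b \<in> \<Union>\<C>" using sub(1)[of E] by (auto simp: is_subring_def)
    qed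
    then show "\<Union>\<C> \<in> \<S>" using sub(2) by (auto simp: \<S>_def)
  qed
  then obtain V where V: "is_subring V" "inverse (of_nat p :: 'a) \<notin> V"
    and max: "\<And>E. is_subring E \<Longrightarrow> V \<subseteq> E \<Longrightarrow> inverse (of_nat p) \<notin> E \<Longrightarrow> E = V"
    unfolding \<S>_def by blast
  have nat: "of_nat k \<in> V" for k by (induction k) (auto simp: is_subringD[OF V(1)])
  have "y \<in> V \<or> inverse y \<in> V" for y
    by (rule maximal_subring_valuation[OF V nat _ max])
      (use assms in auto)
  then show ?thesis using V assms by (intro exI[of _ V]) (auto simp: valuation_subring_def)
qed

section \<open>Arithmetic in a valuation ring above p\<close>

context valuation_subring
begin

lemmas V_intros = is_subring_1[OF V] is_subring_0[OF V] is_subring_diff[OF V] is_subring_mult[OF V]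
  is_subring_uminus[OF V] is_subring_add[OF V] is_subring_sum[OF V] is_subring_power[OF V]

lemma V_prod: "(\<And>i. i \<in> I \<Longrightarrow> f i \<in> V) \<Longrightarrow> prod f I \<in> V"
  by (induction I rule: infinite_finite_induct) (auto intro: V_intros)

lemma V_of_nat: "of_nat n \<in> V"
  by (induction n) (auto intro: V_intros)

lemma V_of_int: "of_int n \<in> V"
  by (cases n) (auto intro: V_intros V_of_nat simp del: of_nat_Suc)

lemma p_pos: "p > 0" using p prime_gt_0_nat by blast

lemma V_root_of_unity:
  assumes "z ^ n = 1" "n > 0"
  shows "z \<in> V"
proof (cases "inverse z \<in> V")
  case True
  have "z = inverse z ^ (n - 1)"
    using assms by (metis inverse_unique mult.commute power_minus_mult power_inverse inverse_inverse_eq)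
  then show ?thesis using True V_intros(8) by metis
qed (use V_total in blast)

text \<open>Take b c + p d = 1. If b / p were in \<open>V\<close>, so would be 1 / p = (b / p) c +
  d. Hence p / b is in \<open>V\<close>, and with it 1 / b = c + (p / b) d.\<close>

lemma V_inverse_of_int:
  assumes "\<not> int p dvd b"
  shows "inverse (of_int b) \<in> V"
proof -
  have "Factorial_Ring.prime (int p)" using p by simp
  then have "coprime b (int p)" using assms by (metis coprime_commute prime_imp_coprime)
  then obtain c d where cd: "b * c + int p * d = 1" 
    by (metis bezout_int coprime_iff_gcd_eq_1 mult.commute)
  have b0: "b \<noteq> 0" using assms by auto
  show ?thesis
  proof (rule ccontr)
    assume no: "inverse (of_int b) \<notin> V"
    let ?y = "of_int b / of_nat p :: 'a"
    have p0: "(of_nat p :: 'a) \<noteq> 0" using p_pos by simp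
    have 1: "(of_int b * of_int c + of_nat p * of_int d :: 'a) = 1"
      using cd by (metis of_int_1 of_int_add of_int_mult of_int_of_nat_eq)
    show False
    proof (cases "?y \<in> V")
      case True
      have "inverse (of_nat p) = ?y * of_int c + of_int d"
        using 1 p0 by (simp add: field_simps)
      then show False using True inv_p by (metis V_intros(4) V_intros(6) V_of_int)
    next
      case False
      then have "inverse ?y \<in> V" using V_total by blast
      moreover have "inverse (of_int b) = of_int c + inverse ?y * of_int d"
        using 1 p0 b0 by (simp add: field_simps)
      ultimately show False using no by (metis V_intros(4) V_intros(6) V_of_int)
    qed
  qed
qed

text \<open>In lowest terms a denominator divisible by p leaves a numerator that is a unit of
  \<open>V\<close>, which would give 1 / p. With \<open>Z_localized_subset\<close>, \<open>V\<close>
  meets the rationals exactly in the localization.\<close>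

lemma V_rat_localized:
  assumes "of_rat q \<in> V"
  shows "(of_rat q :: 'a) \<in> Z_localized p"
proof -
  obtain a b where ab: "quotient_of q = (a, b)" by (cases "quotient_of q")
  then have q: "q = of_int a / of_int b" "coprime a b" "b > 0"
    using quotient_of_div quotient_of_coprime quotient_of_denom_pos by auto
  have qq: "(of_rat q :: 'a) = of_int a / of_int b" by (simp add: q of_rat_divide)
  have "\<not> int p dvd b"
  proof
    assume b: "int p dvd b"
    have pp: "Factorial_Ring.prime (int p)" using p by simp
    have "\<not> int p dvd a"
    proof
      assume "int p dvd a"
      then have "is_unit (int p)" using b q(2) by (rule coprime_common_divisor[rotated 1])
      then show False using not_prime_unit pp by blast
    qed
    then have "inverse (of_int a) \<in> V" by (rule V_inverse_of_int)
    then have *: "of_rat q * inverse (of_int a) \<in> V" using assms V_intros by blast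
    obtain c where c: "b = int p * c" using b by blast
    then have bc: "(of_int b :: 'a) = of_nat p * of_int c" by simp
    have "(of_int b :: 'a) \<noteq> 0" using q(3) by simp
    have "a \<noteq> 0" using \<open>\<not> int p dvd a\<close> by auto
    then have "(inverse (of_nat p) :: 'a) = of_int c * (of_rat q * inverse (of_int a))"
      using \<open>(of_int b :: 'a) \<noteq> 0\<close> unfolding qq bc by (simp add: field_simps)
    then show False using * inv_p by (metis V_intros(4) V_of_int)
  qed
  then show ?thesis unfolding Z_localized_def qq by blast
qed

lemma Z_localized_subset: "Z_localized p \<subseteq> V"
  using V_inverse_of_int V_of_int by (auto simp: Z_localized_def divide_inverse intro!: V_intros)

text \<open>The inner binomial coefficients are divisible by p. The form keeps apart the two terms
  that compete for the value of the difference, \<open>y ^ p\<close> and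
  \<open>of_nat p * y\<close>.\<close>

lemma power_p_one_plus:
  assumes "y \<in> V"
  shows "\<exists>w\<in>V. (1 + y) ^ p = 1 + y ^ p + of_nat p * y * (1 + y * w)"
proof -
  have p2: "p \<ge> 2" using p prime_ge_2_nat by blast
  define c where "c k = (p choose k) div p" for k
  have c: "(p choose k) = p * c k" if "k \<in> {2..<p}" for k
  proof -
    have "p dvd (p choose k)" using that by (intro dvd_choose_prime) (auto simp: p)
    then show ?thesis by (simp add: c_def)
  qed
  define w where "w = (\<Sum>k\<in>{2..<p}. of_nat (c k) * y ^ (k - 2))"
  have set: "{..p} = insert 0 (insert 1 (insert p {2..<p}))" using p2 by auto
  have "(1 + y) ^ p = (\<Sum>k\<le>p. of_nat (p choose k) * y ^ k)"
    using binomial_ring[of y 1 p] by (simp add: add.commute)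
  also have "\<dots> = 1 + (of_nat p * y + (y ^ p + (\<Sum>k\<in>{2..<p}. of_nat (p choose k) * y ^ k)))"
    unfolding set using p2 by (simp add: sum.insert)
  also have "(\<Sum>k\<in>{2..<p}. of_nat (p choose k) * y ^ k) = of_nat p * y * (y * w)"
    unfolding w_def sum_distrib_left
  proof (intro sum.cong refl)
    fix k assume k: "k \<in> {2..<p}"
    then have "k = 2 + (k - 2)" by auto
    then have "y ^ k = y ^ 2 * y ^ (k - 2)" by (metis power_add)
    then have "y ^ k = y * y * y ^ (k - 2)" unfolding power2_eq_square .
    then show "of_nat (p choose k) * y ^ k = of_nat p * y * (y * (of_nat (c k) * y ^ (k - 2)))"
      using c[OF k] by (simp add: mult_ac)
  qed
  finally have "(1 + y) ^ p = 1 + y ^ p + of_nat p * y * (1 + y * w)" by (simp add: algebra_simps)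
  moreover have "w \<in> V" unfolding w_def by (intro V_intros V_of_nat assms)
  ultimately show ?thesis by blast
qed

text \<open>The hypothesis on \<open>\<theta> ^ (p - 1)\<close> makes the p-th power of any multiple
  of \<theta> a multiple of p times it, so each p-th power taken contributes just a factor p. If p
  does not divide j, then j is a unit of \<open>V\<close> and the geometric sum suffices.\<close>

lemma power_one_plus_small:
  assumes "\<theta> \<in> V" "\<theta> ^ (p - 1) / of_nat p \<in> V" "j > 0"
  shows "\<exists>c\<in>V. (1 + \<theta>) ^ j - 1 = of_nat j * \<theta> * c"
  using assms(3)
proof (induction j rule: less_induct)
  case (less j)
  have p1: "p > 1" using p prime_gt_1_nat by blast
  show ?case
  proof (cases "p dvd j")
    case True
    then obtain i where i: "j = p * i" by blast
    then have "i > 0" "i < j" using less.prems p1 by auto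
    then obtain c where c: "c \<in> V" "(1 + \<theta>) ^ i - 1 = of_nat i * \<theta> * c" using less.IH by blast
    define t where "t = of_nat i * \<theta> * c"
    have t: "t \<in> V" unfolding t_def by (intro V_intros V_of_nat assms c)
    obtain w where w: "w \<in> V" "(1 + t) ^ p = 1 + t ^ p + of_nat p * t * (1 + t * w)"
      using power_p_one_plus[OF t] by blast
    define s where "s = of_nat i ^ (p - 1) * c ^ (p - 1) * (\<theta> ^ (p - 1) / of_nat p)"
    have tp: "t ^ p = of_nat p * t * s"
    proof -
      have "t ^ p = t * t ^ (p - 1)" using p1 by (simp flip: power_Suc)
      then show ?thesis using p1 by (simp add: s_def t_def power_mult_distrib)
    qed
    have "(1 + \<theta>) ^ j = (1 + t) ^ p" using c by (simp add: i t_def power_mult mult.commute[of p] algebra_simps flip: c(2))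
    then have "(1 + \<theta>) ^ j - 1 = of_nat j * \<theta> * (c * (s + 1 + t * w))"
      unfolding w(2) tp by (simp add: i t_def algebra_simps)
    moreover have "c * (s + 1 + t * w) \<in> V"
      unfolding s_def by (intro V_intros V_of_nat c assms t w)
    ultimately show ?thesis by blast
  next
    case False
    have inv: "inverse (of_nat j) \<in> V"
      using V_inverse_of_int[of "int j"] False by simp
    have "(1 + \<theta>) ^ j - 1 = \<theta> * (\<Sum>k<j. (1 + \<theta>) ^ k)"
      using power_diff_1_eq[of "1 + \<theta>" j] by simp
    also have "\<dots> = of_nat j * \<theta> * (inverse (of_nat j) * (\<Sum>k<j. (1 + \<theta>) ^ k))"
      using less.prems by simp
    finally show ?thesis
      by (rule bexI[of _ "inverse (of_nat j) * (\<Sum>k<j. (1 + \<theta>) ^ k)"])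
        (intro V_intros inv assms)
  qed
qed

lemma prod_one_plus:
  assumes "finite J" "r \<in> V" "\<And>j. j \<in> J \<Longrightarrow> \<kappa> j \<in> V"
  shows "\<exists>c\<in>V. (\<Prod>j\<in>J. 1 + r * \<kappa> j) = 1 + r * (\<Sum>j\<in>J. \<kappa> j) + r\<^sup>2 * c"
  using assms(1,3)
proof (induction J)
  case empty
  then show ?case by (auto intro!: bexI[of _ 0] V_intros)
next
  case (insert i J)
  then obtain c where c: "c \<in> V" "(\<Prod>j\<in>J. 1 + r * \<kappa> j) = 1 + r * (\<Sum>j\<in>J. \<kappa> j) + r\<^sup>2 * c" by auto
  define S where "S = (\<Sum>j\<in>J. \<kappa> j)"
  have S: "S \<in> V" unfolding S_def using insert.prems by (auto intro!: V_intros)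
  have "(\<Prod>j\<in>insert i J. 1 + r * \<kappa> j) = (1 + r * \<kappa> i) * (1 + r * S + r\<^sup>2 * c)"
    using insert.hyps c(2) by (simp add: S_def)
  also have "\<dots> = 1 + r * (\<kappa> i + S) + r\<^sup>2 * (c + \<kappa> i * S + r * \<kappa> i * c)"
    by (simp add: algebra_simps power2_eq_square)
  finally have "(\<Prod>j\<in>insert i J. 1 + r * \<kappa> j) = 1 + r * (\<Sum>j\<in>insert i J. \<kappa> j) + r\<^sup>2 * (c + \<kappa> i * S + r * \<kappa> i * c)"
    using insert.hyps by (simp add: S_def)
  moreover have "c + \<kappa> i * S + r * \<kappa> i * c \<in> V" using insert.prems S c assms(2) by (auto intro!: V_intros)
  ultimately show ?case by blast
qed

end

section \<open>Values relative to a chosen nonunit\<close>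

locale uniformized_subring = valuation_subring V p for V :: "'a::field_char_0 set" and p +
  fixes x :: 'a
  assumes xV: "x \<in> V" and inv_x: "inverse x \<notin> V"
begin

text \<open>\<open>D k y\<close> and \<open>U k y\<close> say that the value of \<open>y\<close>, normalized at \<open>x\<close>, is at least \<open>k\<close> and
  equal to \<open>k\<close>. As \<open>V\<close> need not be discrete, not every element has a value in this sense.\<close>

definition D :: "int \<Rightarrow> 'a \<Rightarrow> bool" where "D k y \<longleftrightarrow> y * x powi (- k) \<in> V"

definition U :: "int \<Rightarrow> 'a \<Rightarrow> bool" where "U k y \<longleftrightarrow> y \<noteq> 0 \<and> D k y \<and> D (- k) (inverse y)"

lemma x0: "x \<noteq> 0" using inv_x V_intros(2) by auto

lemma V_x_powi: "x powi k \<in> V" if "k \<ge> 0"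
  using that xV by (auto simp: power_int_def intro: V_intros)

lemma x_powi_V_imp: assumes "x powi k \<in> V" shows "k \<ge> 0"
proof (rule ccontr)
  assume k: "\<not> k \<ge> 0"
  have "inverse x = x powi k * x powi (- k - 1)" using x0 by (simp flip: power_int_add add: power_int_minus)
  then show False using assms V_x_powi[of "- k - 1"] inv_x k V_intros(4) by auto
qed

lemma D_0 [simp]: "D k 0" by (simp add: D_def V_intros)

lemma D_0_iff: "D 0 y \<longleftrightarrow> y \<in> V" by (simp add: D_def)

lemma D_add: "D k y \<Longrightarrow> D k z \<Longrightarrow> D k (y + z)"
  by (auto simp: D_def ring_distribs intro: V_intros)

lemma D_uminus: "D k y \<Longrightarrow> D k (- y)"
  by (auto simp: D_def intro: V_intros)

lemma D_diff: "D k y \<Longrightarrow> D k z \<Longrightarrow> D k (y - z)"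
  by (auto simp: D_def ring_distribs intro: V_intros)

lemma D_sum: "(\<And>i. i \<in> I \<Longrightarrow> D k (f i)) \<Longrightarrow> D k (sum f I)"
  by (auto simp: D_def sum_distrib_right intro: V_intros)

lemma D_mult:
  assumes "D k y" "D l z"
  shows "D (k + l) (y * z)"
proof -
  have "x powi (- (k + l)) = x powi (- k) * x powi (- l)"
    using x0 by (simp flip: power_int_add)
  then have "y * z * x powi (- (k + l)) = (y * x powi (- k)) * (z * x powi (- l))" by simp
  then show ?thesis using assms V_intros(4) unfolding D_def by metis
qed

lemma D_mult_V: "D k y \<Longrightarrow> c \<in> V \<Longrightarrow> D k (y * c)"
  using D_mult[of k y 0 c] by (simp add: D_0_iff)

lemma D_mono:
  assumes "D k y" "l \<le> k"
  shows "D l y"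
proof -
  have "x powi (- l) = x powi (- k) * x powi (k - l)"
    using x0 by (simp flip: power_int_add)
  then have "y * x powi (- l) = (y * x powi (- k)) * x powi (k - l)" by simp
  then show ?thesis using assms V_x_powi[of "k - l"] V_intros(4) unfolding D_def by (metis diff_ge_0_iff_ge)
qed

lemma U_D: "U k y \<Longrightarrow> D k y" and U_nonzero: "U k y \<Longrightarrow> y \<noteq> 0"
  and U_inverse: "U k y \<Longrightarrow> U (- k) (inverse y)"
  by (auto simp: U_def)

lemma U_mult: "U k y \<Longrightarrow> U l z \<Longrightarrow> U (k + l) (y * z)"
  using D_mult[of k y l z] D_mult[of "- k" "inverse y" "- l" "inverse z"]
  by (auto simp: U_def)

lemma U_divide: "U k y \<Longrightarrow> U l z \<Longrightarrow> U (k - l) (y / z)"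
  using U_mult[of k y "- l" "inverse z"] U_inverse[of l z] by (simp add: divide_inverse)

lemma U_1: "U 0 1" by (simp add: U_def D_0_iff V_intros)

lemma U_uminus: "U k y \<Longrightarrow> U k (- y)"
  by (auto simp: U_def intro: D_uminus)

lemma U_power: "U k y \<Longrightarrow> U (int n * k) (y ^ n)"
  by (induction n) (auto simp: U_1 algebra_simps intro: U_mult)

lemma U_prod: "(\<And>i. i \<in> I \<Longrightarrow> U (k i) (f i)) \<Longrightarrow> U (sum k I) (prod f I)"
  by (induction I rule: infinite_finite_induct) (auto simp: U_1 intro: U_mult)

lemma U_x: "U 1 x"
  using x0 by (simp add: U_def D_def V_intros)

lemma U_D_le:
  assumes "U k y" "D l y"
  shows "l \<le> k"
proof -
  have "D (l - k) (y * inverse y)" using D_mult[of l y "- k" "inverse y"] assms by (simp add: U_def)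
  then have "D (l - k) 1" using assms by (simp add: U_def)
  then show ?thesis using x_powi_V_imp[of "k - l"] by (simp add: D_def)
qed

lemma U_unique: "U k y \<Longrightarrow> U l y \<Longrightarrow> k = l"
  using U_D_le U_D by (meson antisym)

lemma D_cancel:
  assumes "U k y" "D (k + l) (y * z)"
  shows "D l z"
proof -
  have "D (- k + (k + l)) (inverse y * (y * z))"
    by (rule D_mult) (use assms in \<open>auto simp: U_def\<close>)
  moreover have "inverse y * (y * z) = z" using assms by (simp add: U_def)
  moreover have "- k + (k + l) = l" by simp
  ultimately show ?thesis by (simp only:)
qed

lemma U_iff_unit: "U 0 y \<longleftrightarrow> y \<noteq> 0 \<and> y \<in> V \<and> inverse y \<in> V"
  by (simp add: U_def D_0_iff)

text \<open>With t = z / y = x s, everything comes down to 1 + t being a unit of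
  \<open>V\<close>.\<close>

lemma U_add:
  assumes "U k y" "D (k + 1) z"
  shows "U k (y + z)"
proof -
  define t where "t = z / y"
  have y0: "y \<noteq> 0" using assms by (simp add: U_def)
  have "D (k + 1 + (- k)) (z * inverse y)" using assms by (intro D_mult) (auto simp: U_def)
  then have t: "D 1 t" by (simp add: t_def divide_inverse)
  define s where "s = t / x"
  have s: "s \<in> V" "t = x * s" using t x0 by (auto simp: s_def D_def divide_inverse power_int_minus)
  have w0: "1 + t \<noteq> 0"
  proof
    assume "1 + t = 0"
    then have "x * (- s) = 1" using s(2) by (simp add: add_eq_0_iff)
    then have "inverse x = - s" by (rule inverse_unique)
    then show False using s inv_x V_intros(5) by auto
  qed
  \<comment> \<open>Otherwise its inverse (1 + t) / x = 1 / x + s would lie in \<open>V\<close>, and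
    hence 1 / x.\<close>
  have "x / (1 + t) \<in> V"
  proof (rule ccontr)
    assume "x / (1 + t) \<notin> V"
    then have "(1 + t) / x \<in> V" using V_total[of "x / (1 + t)"] by simp
    then have "(1 + t) / x - s \<in> V" using s V_intros(3) by blast
    moreover have "(1 + t) / x - s = inverse x" using x0 by (simp add: s field_simps)
    ultimately show False using inv_x by simp
  qed
  then have "1 - s * (x / (1 + t)) \<in> V" using s V_intros by blast
  moreover have "1 - s * (x / (1 + t)) = inverse (1 + t)" using w0 s by (simp add: field_simps)
  moreover have "1 + t \<in> V" using s xV V_intros by auto
  ultimately have "U 0 (1 + t)" using w0 by (simp add: U_iff_unit)
  then have "U (k + 0) (y * (1 + t))" using assms U_mult by blast
  then show ?thesis using y0 by (simp add: t_def algebra_simps)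
qed

text \<open>If some term falls below l, take one of least value. The other terms are larger by at
  least 1, by injectivity and integrality of k, and so is the whole sum; hence so would be the term
  itself.\<close>

lemma D_sum_distinct:
  assumes fin: "finite J" and exact: "\<And>j. j \<in> J \<Longrightarrow> f j = 0 \<or> U (k j) (f j)"
    and inj: "inj_on k {j\<in>J. f j \<noteq> 0}" and sum: "D l (sum f J)" and j: "j \<in> J"
  shows "D l (f j)"
proof (rule ccontr)
  assume no: "\<not> D l (f j)"
  define B where "B = {j\<in>J. f j \<noteq> 0 \<and> k j < l}"
  have "f j \<noteq> 0" using no by auto
  then have "U (k j) (f j)" using exact j by auto
  then have "k j < l" using no U_D D_mono by (meson not_le)
  then have B: "finite B" "B \<noteq> {}" using fin j \<open>f j \<noteq> 0\<close> by (auto simp: B_def)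
  then obtain i where i: "i \<in> B" "\<forall>b\<in>B. k i \<le> k b"
    by (meson arg_min_if_finite(1) arg_min_least)
  have "D (k i + 1) (f b)" if b: "b \<in> J - {i}" for b
  proof (cases "f b = 0")
    case False
    then have u: "U (k b) (f b)" using b exact by auto
    have "k b \<noteq> k i" using inj b i False by (auto simp: B_def inj_on_def)
    moreover have "k b \<ge> k i"
    proof (cases "k b < l")
      case True then show ?thesis using i b False by (auto simp: B_def)
    next
      case False then show ?thesis using i by (auto simp: B_def)
    qed
    ultimately show ?thesis using U_D[OF u] D_mono by force
  qed simp
  then have "D (k i + 1) (sum f (J - {i}))" by (rule D_sum)
  moreover have "D (k i + 1) (sum f J)" using sum i by (auto simp: B_def intro: D_mono)
  moreover have "f i = sum f J - sum f (J - {i})" using fin i by (simp add: B_def sum_diff1)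
  ultimately have "D (k i + 1) (f i)" by (simp add: D_diff)
  moreover have "U (k i) (f i)" using i exact by (auto simp: B_def)
  ultimately show False using U_D_le[of "k i" "f i" "k i + 1"] by simp
qed

text \<open>All terms have value at least l by \<open>D_sum_distinct\<close>. Without one of value
  exactly l they would all reach l + 1, and so would the sum.\<close>

lemma U_sum_distinct:
  assumes fin: "finite J" and exact: "\<And>j. j \<in> J \<Longrightarrow> f j = 0 \<or> U (k j) (f j)"
    and inj: "inj_on k {j\<in>J. f j \<noteq> 0}" and sum: "U l (sum f J)"
  shows "\<exists>j\<in>J. k j = l \<and> U l (f j)"
proof (rule ccontr)
  assume no: "\<not> ?thesis"
  have "D (l + 1) (f j)" if j: "j \<in> J" for j
  proof (cases "f j = 0")
    case False
    then have u: "U (k j) (f j)" using exact j by auto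
    have "D l (f j)" by (rule D_sum_distinct[OF fin exact inj U_D[OF sum] j])
    then have "l \<le> k j" using u U_D_le by blast
    moreover have "k j \<noteq> l" using no u j by auto
    ultimately show ?thesis using U_D[OF u] D_mono by force
  qed simp
  then have "D (l + 1) (sum f J)" by (rule D_sum)
  then show False using U_D_le[OF sum, of "l + 1"] by simp
qed

lemma sum_distinct_nonzero:
  assumes fin: "finite J" and exact: "\<And>j. j \<in> J \<Longrightarrow> f j = 0 \<or> U (k j) (f j)"
    and inj: "inj_on k {j\<in>J. f j \<noteq> 0}" and j: "j \<in> J" "f j \<noteq> 0"
  shows "\<exists>i\<in>J. U (k i) (sum f J)"
proof -
  define B where "B = {j\<in>J. f j \<noteq> 0}"
  have B: "finite B" "B \<noteq> {}" using fin j by (auto simp: B_def)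
  then obtain i where i: "i \<in> B" "\<forall>b\<in>B. k i \<le> k b"
    by (meson arg_min_if_finite(1) arg_min_least)
  have "D (k i + 1) (f b)" if b: "b \<in> J - {i}" for b
  proof (cases "f b = 0")
    case False
    then have u: "U (k b) (f b)" using b exact by auto
    have "k b \<noteq> k i" using inj b i False by (auto simp: B_def inj_on_def)
    moreover have "k b \<ge> k i" using i b False by (auto simp: B_def)
    ultimately show ?thesis using U_D[OF u] D_mono by force
  qed simp
  then have "D (k i + 1) (sum f (J - {i}))" by (rule D_sum)
  moreover have "U (k i) (f i)" using i exact by (auto simp: B_def)
  moreover have "sum f J = f i + sum f (J - {i})" using fin i by (simp add: B_def sum.remove)
  ultimately show ?thesis using U_add i by (auto simp: B_def)
qed

lemma D_prod_cong:
  assumes "\<And>j. j \<in> J \<Longrightarrow> f j \<in> V \<and> g j \<in> V \<and> D 1 (f j - g j)"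
  shows "D 1 (prod f J - prod g J)"
  using assms
proof (induction J rule: infinite_finite_induct)
  case (insert i J)
  have "prod f (insert i J) - prod g (insert i J) =
      (f i - g i) * prod f J + (prod f J - prod g J) * g i"
    using insert.hyps by (simp add: algebra_simps)
  moreover have "D 1 \<dots>"
    using insert by (intro D_add D_mult_V V_prod) auto
  ultimately show ?case by simp
qed auto

lemma D_inverse_cong:
  assumes "U 0 y" "U 0 z" "D 1 (y - z)"
  shows "D 1 (inverse y - inverse z)"
proof -
  have "inverse y - inverse z = (y - z) * (- (inverse y * inverse z))"
    using assms by (simp add: U_def field_simps)
  moreover have "inverse y * inverse z \<in> V" using assms by (auto simp: U_iff_unit intro: V_intros)
  ultimately show ?thesis using D_mult_V[OF assms(3) V_intros(5)] by simp
qed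

lemma U_of_int:
  assumes "\<not> int p dvd a"
  shows "U 0 (of_int a)"
  using assms V_inverse_of_int V_of_int by (auto simp: U_iff_unit)

lemma U_of_nat: "\<not> p dvd a \<Longrightarrow> U 0 (of_nat a)"
  using U_of_int[of "int a"] by simp

lemma U_of_rat:
  assumes "U e (of_nat p)" "q \<noteq> 0"
  shows "\<exists>z. U (z * e) (of_rat q)"
proof -
  have int: "\<exists>z. U (z * e) (of_int a)" if a: "a \<noteq> 0" for a
  proof -
    have "\<not> is_unit (int p)" using p not_prime_unit[of "int p"] by (metis prime_int_nat_transfer of_nat_0_le_iff nat_int)
    then obtain b where b: "a = int p ^ multiplicity (int p) a * b" "\<not> int p dvd b"
      using multiplicity_decompose'[OF a] by blast
    have "(of_int a :: 'a) = of_nat p ^ multiplicity (int p) a * of_int b"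
      by (subst b(1)) simp
    moreover have "U (int (multiplicity (int p) a) * e + 0) \<dots>"
      by (intro U_mult U_power assms U_of_int b)
    ultimately show ?thesis by (metis add.right_neutral)
  qed
  obtain a b where ab: "quotient_of q = (a, b)" by (cases "quotient_of q")
  then have q: "q = of_int a / of_int b" "b > 0"
    using quotient_of_div quotient_of_denom_pos by auto
  have "a \<noteq> 0" using q assms(2) by auto
  from int[OF this] int[of b] q(2) obtain y z where "U (y * e) (of_int a)" "U (z * e) (of_int b)" by auto
  from U_divide[OF this] have "U ((y - z) * e) (of_rat q)"
    by (simp add: q of_rat_divide left_diff_distrib)
  then show ?thesis by blast
qed

end

section \<open>Evaluation of rational polynomials\<close>

text \<open>Rational polynomials serve as names for the elements of a cyclotomic field: a
  conjugation evaluates the same polynomial at another root of unity.\<close>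

definition ev :: "rat poly \<Rightarrow> 'a::field_char_0 \<Rightarrow> 'a" where
  "ev f z = poly (map_poly of_rat f) z"

lemma ev_0 [simp]: "ev 0 z = 0"
  and ev_pCons [simp]: "ev (pCons a f) z = of_rat a + z * ev f z"
  by (simp_all add: ev_def map_poly_pCons)

lemma ev_1 [simp]: "ev 1 z = 1"
  by (simp add: one_pCons)

lemma ev_add [simp]: "ev (f + g) z = ev f z + ev g z"
  by (induction f g rule: poly_induct2) (simp_all add: of_rat_add algebra_simps)

lemma ev_uminus [simp]: "ev (- f) z = - ev f z"
  by (induction f) (simp_all add: of_rat_minus algebra_simps)

lemma ev_diff [simp]: "ev (f - g) z = ev f z - ev g z"
  using ev_add[of f "- g" z] by simp

lemma ev_smult [simp]: "ev (smult a f) z = of_rat a * ev f z"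
  by (induction f) (simp_all add: of_rat_mult algebra_simps)

lemma ev_mult [simp]: "ev (f * g) z = ev f z * ev g z"
  by (induction f) (simp_all add: algebra_simps)

lemma ev_power [simp]: "ev (f ^ n) z = ev f z ^ n"
  by (induction n) simp_all

lemma ev_sum [simp]: "ev (sum f I) z = (\<Sum>i\<in>I. ev (f i) z)"
  by (induction I rule: infinite_finite_induct) simp_all

lemma ev_prod [simp]: "ev (prod f I) z = (\<Prod>i\<in>I. ev (f i) z)"
  by (induction I rule: infinite_finite_induct) simp_all

lemma ev_monom [simp]: "ev (Polynomial.monom a n) z = of_rat a * z ^ n"
  by (induction n) (simp_all add: monom_Suc monom_0)

lemma ev_pcompose [simp]: "ev (pcompose f g) z = ev f (ev g z)"
  by (induction f) (simp_all add: pcompose_pCons)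

lemma ev_altdef:
  assumes "Polynomial.degree f < d"
  shows "ev f z = (\<Sum>k<d. of_rat (Polynomial.coeff f k) * z ^ k)"
proof -
  have "f = (\<Sum>k<d. Polynomial.monom (Polynomial.coeff f k) k)"
    using assms by (auto simp: poly_eq_iff coeff_sum coeff_eq_0)
  then have "ev f z = ev (\<Sum>k<d. Polynomial.monom (Polynomial.coeff f k) k) z" by simp
  then show ?thesis by simp
qed

text \<open>Steinitz exchange over the rationals, phrased with coefficient functions: as many
  independent elements as there are generators span everything.\<close>

lemma rat_basis:
  fixes b :: "'i \<Rightarrow> 'a::field_char_0" and c :: "nat \<Rightarrow> 'a"
  assumes fin: "finite I"
    and span: "\<And>i. i \<in> I \<Longrightarrow> \<exists>r. b i = (\<Sum>k<card I. of_rat (r k) * c k)"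
      "\<exists>r. y = (\<Sum>k<card I. of_rat (r k) * c k)"
    and indep: "\<And>r. (\<Sum>i\<in>I. of_rat (r i) * b i) = 0 \<Longrightarrow> \<forall>i\<in>I. r i = 0"
  shows "\<exists>r. y = (\<Sum>i\<in>I. of_rat (r i) * b i)"
proof -
  interpret Q: vector_space "\<lambda>(q::rat) (z::'a). of_rat q * z"
    by unfold_locales (auto simp: algebra_simps of_rat_add of_rat_mult)
  let ?C = "c ` {..<card I}"
  have C: "(\<Sum>k<card I. of_rat (r k) * c k) \<in> Q.span ?C" for r
    by (intro Q.span_sum Q.span_scale Q.span_base) auto
  have inj: "inj_on b I"
  \<comment> \<open>Two equal members would satisfy the relation with coefficients 1 and -1, against
    independence in its indexed form.\<close>
  proof (rule inj_onI, rule ccontr)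
    fix i j assume ij: "i \<in> I" "j \<in> I" "b i = b j" "i \<noteq> j"
    have "(\<Sum>k\<in>I. of_rat (of_bool (k = i) - of_bool (k = j)) * b k) =
        (\<Sum>k\<in>I. (if k = i then b k else 0) - (if k = j then b k else 0))"
      by (rule sum.cong) (auto simp: of_rat_minus)
    also have "\<dots> = b i - b j" using ij(1,2) fin by (simp add: sum_subtractf)
    also have "\<dots> = 0" using ij(3) by simp
    finally show False using indep[of "\<lambda>k. of_bool (k = i) - of_bool (k = j)"] ij by auto
  qed
  have ind: "Q.independent (b ` I)"
  proof (subst Q.independent_explicit_finite_subsets, intro allI impI ballI)
    fix S u v assume S: "S \<subseteq> b ` I" "finite S" "(\<Sum>v\<in>S. of_rat (u v) * v) = 0" "v \<in> S"
    have "(\<Sum>i\<in>I. of_rat (if b i \<in> S then u (b i) else 0) * b i) =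
        (\<Sum>v\<in>b ` I. of_rat (if v \<in> S then u v else 0) * v)"
      by (simp add: sum.reindex[OF inj])
    also have "\<dots> = (\<Sum>v\<in>S. of_rat (u v) * v)"
      using S fin by (intro sum.mono_neutral_cong_right) auto
    finally have "\<forall>i\<in>I. (if b i \<in> S then u (b i) else 0) = 0"
      using indep[of "\<lambda>i. if b i \<in> S then u (b i) else 0"] S(3) by simp
    then show "u v = 0" using S(1,4) by (metis (no_types, lifting) imageE subsetD)
  qed
  have "y \<in> Q.span (b ` I)"
  proof (rule ccontr)
    assume y: "y \<notin> Q.span (b ` I)"
    then have "Q.independent (insert y (b ` I))" using ind by (rule Q.independent_insertI)
    moreover have "insert y (b ` I) \<subseteq> Q.span ?C" using span C by (auto, metis+)
    ultimately have "card (insert y (b ` I)) \<le> card ?C"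
      using Q.independent_span_bound by blast
    moreover have "card ?C \<le> card I" using card_image_le[of "{..<card I}" c] by simp
    moreover have "y \<notin> b ` I" using y Q.span_base by blast
    ultimately show False using fin inj by (simp add: card_image)
  qed
  then obtain r where "y = (\<Sum>v\<in>b ` I. of_rat (r v) * v)"
    using Q.span_finite[of "b ` I"] fin by auto
  then show ?thesis using sum.reindex[OF inj, of "\<lambda>v. of_rat (r v) * v"]
    by (intro exI[of _ "\<lambda>i. r (b i)"]) simp
qed

section \<open>Roots of unity\<close>

lemma primitive_root_inj:
  assumes "primitive_root_of_unity M \<eta>" "a < M" "b < M" "\<eta> ^ a = \<eta> ^ b"
  shows "a = b"
proof -
  have eta: "\<eta> \<noteq> 0" using assms by (auto simp: primitive_root_of_unity_def power_0_left split: if_splits)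
  have *: "a = b" if "a \<le> b" "\<eta> ^ a = \<eta> ^ b" "b < M" for a b
  proof (rule ccontr)
    assume "a \<noteq> b"
    then have "\<eta> ^ (b - a) \<noteq> 1" using that assms(1) by (auto simp: primitive_root_of_unity_def)
    then show False using that eta by (simp add: power_diff)
  qed
  show ?thesis using *[of a b] *[of b a] assms by (cases "a \<le> b") auto
qed

text \<open>Both sides are monic of degree M and agree at the M distinct powers of \<eta>, while
  their difference has degree below M.\<close>

lemma prod_primitive_roots:
  assumes "primitive_root_of_unity M \<eta>" "M > 0"
  shows "(\<Prod>k<M. [:- (\<eta> ^ k), 1:]) = Polynomial.monom 1 M - 1"
proof -
  let ?P = "\<Prod>k<M. [:- (\<eta> ^ k), 1:]"
  let ?R = "Polynomial.monom 1 M - 1 - ?P"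
  have lead: "Polynomial.coeff ?P M = 1" "Polynomial.degree ?P = M"
  proof -
    show d: "Polynomial.degree ?P = M" by (subst Polynomial.degree_prod_eq_sum_degree) auto
    have "Polynomial.lead_coeff ?P = 1" by (subst Polynomial.lead_coeff_prod) simp
    then show "Polynomial.coeff ?P M = 1" using d by simp
  qed
  have "?R = 0"
  proof (rule ccontr)
    assume R: "?R \<noteq> 0"
    have "Polynomial.degree ?R \<le> M"
      using lead by (intro degree_diff_le) (auto intro: degree_monom_le)
    moreover have "Polynomial.coeff ?R M = 0" using lead assms(2) by (simp add: coeff_1)
    ultimately have deg: "Polynomial.degree ?R < M"
      using R by (metis le_neq_implies_less leading_coeff_0_iff)
    have "(\<lambda>k. \<eta> ^ k) ` {..<M} \<subseteq> {z. poly ?R z = 0}"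
    proof safe
      fix k assume k: "k < M"
      have "(\<eta> ^ k) ^ M = 1"
        using assms by (metis power_mult mult.commute power_one primitive_root_of_unity_def)
      then show "poly ?R (\<eta> ^ k) = 0" using k by (auto simp: poly_monom poly_prod)
    qed
    then have "card ((\<lambda>k. \<eta> ^ k) ` {..<M}) \<le> Polynomial.degree ?R"
      using card_mono[OF poly_roots_finite[OF R]] card_poly_roots_bound[OF R] by (meson le_trans)
    moreover have "inj_on (\<lambda>k. \<eta> ^ k) {..<M}"
      using primitive_root_inj[OF assms(1)] by (auto intro: inj_onI)
    ultimately show False using deg by (simp add: card_image)
  qed
  then show ?thesis by simp
qed

lemma prod_minus_primitive_roots:
  assumes "primitive_root_of_unity M \<eta>" "M > 0"
  shows "(\<Prod>k<M. y - \<eta> ^ k) = y ^ M - 1"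
proof -
  have "poly (\<Prod>k<M. [:- (\<eta> ^ k), 1:]) y = poly (Polynomial.monom 1 M - 1) y"
    by (simp only: prod_primitive_roots[OF assms])
  then show ?thesis by (simp add: poly_prod poly_monom)
qed

text \<open>The factorization of X^M - 1 at 1 / y, scaled by \<open>(- y) ^ M\<close>; oddness of M
  fixes the sign.\<close>

lemma prod_times_primitive_roots:
  assumes "primitive_root_of_unity M \<eta>" "odd M"
  shows "(\<Prod>k<M. y * \<eta> ^ k - 1) = y ^ M - 1"
proof (cases "y = 0")
  case False
  have M: "M > 0" using assms(2) odd_pos by blast
  have "(\<Prod>k<M. y * \<eta> ^ k - 1) = (\<Prod>k<M. (- y) * (inverse y - \<eta> ^ k))"
    using False by (intro prod.cong) (auto simp: algebra_simps)
  also have "\<dots> = (- y) ^ M * (inverse y ^ M - 1)"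
    by (simp only: prod.distrib prod_minus_primitive_roots[OF assms(1) M] prod_constant card_lessThan)
  also have "\<dots> = y ^ M - 1" using False assms(2) by (simp add: field_simps)
  finally show ?thesis .
qed (use assms odd_pos in \<open>auto simp: power_0_left\<close>)

text \<open>The value at 1 of (X^M - 1) / (X - 1), once from its factors and once from its
  coefficients.\<close>

lemma prod_one_minus_primitive_roots:
  assumes "primitive_root_of_unity M \<eta>" "M > 0"
  shows "(\<Prod>k\<in>{1..<M}. 1 - \<eta> ^ k) = of_nat M"
proof -
  let ?P = "\<Prod>k\<in>{1..<M}. [:- (\<eta> ^ k), 1:]" and ?S = "\<Sum>k<M. Polynomial.monom 1 k :: 'a poly"
  have S: "[:-1, 1:] * ?S = Polynomial.monom 1 M - 1"
  proof (rule iffD1[OF poly_eq_poly_eq_iff], rule ext)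
    fix z :: 'a
    have "poly ([:-1, 1:] * ?S) z = (z - 1) * (\<Sum>k<M. z ^ k)"
      unfolding poly_mult by (simp add: poly_sum poly_monom)
    then show "poly ([:-1, 1:] * ?S) z = poly (Polynomial.monom 1 M - 1) z"
      using power_diff_1_eq[of z M] by (simp add: poly_monom)
  qed
  have "{..<M} = insert 0 {1..<M}" using assms(2) by auto
  then have "(\<Prod>k<M. [:- (\<eta> ^ k), 1:]) = [:-1, 1:] * ?P" by simp
  then have "[:-1, 1:] * ?P = [:-1, 1:] * ?S"
    using prod_primitive_roots[OF assms] S by simp
  then have "?P = ?S" by (simp del: mult_pCons_left)
  then have "poly ?P 1 = poly ?S 1" by simp
  then show ?thesis by (simp add: poly_prod poly_sum poly_monom)
qed

locale cyclotomic_tower =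
  fixes p :: nat and \<zeta> :: "nat \<Rightarrow> 'a::field_char_0"
  assumes p_prime: "Factorial_Ring.prime p" and p3: "p \<ge> 3" and compat: "compatible_roots p \<zeta>"
begin

lemma p_odd: "odd p"
  using p_prime p3 prime_odd_nat by auto

lemma primitive_zeta: "n \<ge> 1 \<Longrightarrow> primitive_root_of_unity (p ^ n) (\<zeta> n)"
  using compat by (auto simp: compatible_roots_def)

lemma zeta_power_order: "n \<ge> 1 \<Longrightarrow> \<zeta> n ^ (p ^ n) = 1"
  using primitive_zeta by (auto simp: primitive_root_of_unity_def)

lemma zeta_nonzero: "n \<ge> 1 \<Longrightarrow> \<zeta> n \<noteq> 0"
  using zeta_power_order[of n] p3 by (auto simp: power_0_left split: if_splits)

lemma zeta_power_mod: "n \<ge> 1 \<Longrightarrow> \<zeta> n ^ (a mod p ^ n) = \<zeta> n ^ a"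
proof -
  assume n: "n \<ge> 1"
  have "\<zeta> n ^ a = \<zeta> n ^ (p ^ n * (a div p ^ n) + a mod p ^ n)" by simp
  also have "\<dots> = \<zeta> n ^ (a mod p ^ n)"
    unfolding power_add power_mult using zeta_power_order[OF n] by simp
  finally show ?thesis by simp
qed

lemma zeta_power_eq_iff: "n \<ge> 1 \<Longrightarrow> \<zeta> n ^ a = \<zeta> n ^ b \<longleftrightarrow> [a = b] (mod p ^ n)"
proof -
  assume n: "n \<ge> 1"
  have "\<zeta> n ^ a = \<zeta> n ^ b \<longleftrightarrow> \<zeta> n ^ (a mod p ^ n) = \<zeta> n ^ (b mod p ^ n)"
    by (simp only: zeta_power_mod[OF n])
  also have "\<dots> \<longleftrightarrow> a mod p ^ n = b mod p ^ n"
    using primitive_root_inj[OF primitive_zeta[OF n]] p3 by auto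
  finally show ?thesis by (simp add: cong_def)
qed

lemma zeta_power_eq_1_iff: "n \<ge> 1 \<Longrightarrow> \<zeta> n ^ a = 1 \<longleftrightarrow> p ^ n dvd a"
  using zeta_power_eq_iff[of n a 0] by (simp add: cong_0_iff)

lemma zeta_power_p_power: "m \<ge> 1 \<Longrightarrow> \<zeta> (m + i) ^ (p ^ i) = \<zeta> m"
proof (induction i)
  case (Suc i)
  have "\<zeta> (m + Suc i) ^ (p ^ Suc i) = (\<zeta> (Suc (m + i)) ^ p) ^ (p ^ i)"
    by (simp add: power_mult)
  also have "\<dots> = \<zeta> (m + i) ^ (p ^ i)" using compat Suc.prems by (simp add: compatible_roots_def)
  finally show ?case using Suc by simp
qed simp

lemma primitive_zeta_power:
  assumes "m + i \<ge> 1" "n = m + i"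
  shows "primitive_root_of_unity (p ^ i) (\<zeta> n ^ (p ^ m))"
proof -
  have p: "p > 0" using p3 by simp
  have "(\<zeta> n ^ (p ^ m)) ^ l = 1 \<longleftrightarrow> p ^ i dvd l" for l
    using zeta_power_eq_1_iff[of n "p ^ m * l"] assms p by (simp add: power_mult power_add)
  then show ?thesis by (auto simp: primitive_root_of_unity_def dest: dvd_imp_le)
qed

text \<open>For n at least 1 this is the totient of p^n, the degree of the n-th cyclotomic
  field.\<close>

definition phi :: "nat \<Rightarrow> nat" where "phi n = (p - 1) * p ^ (n - 1)"

lemma phi_pos: "phi n > 0" using p3 by (simp add: phi_def)

text \<open>For n at least 1 this is the cyclotomic polynomial of order p^n, the quotient of X^(p^n)
  - 1 by X^(p^(n - 1)) - 1. Its irreducibility is obtained later from values.\<close>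

definition Phi :: "nat \<Rightarrow> rat poly" where
  "Phi n = (\<Sum>k<p. Polynomial.monom 1 (k * p ^ (n - 1)))"

lemma degree_Phi: "Polynomial.degree (Phi n) = phi n"
proof -
  obtain q where q: "p = Suc q" using p3 by (cases p) auto
  have "Phi n = (\<Sum>k<q. Polynomial.monom 1 (k * p ^ (n - 1))) + Polynomial.monom 1 (q * p ^ (n - 1))"
    unfolding Phi_def using sum.lessThan_Suc[of "\<lambda>k. Polynomial.monom 1 (k * p ^ (n - 1))" q]
    by (simp only: q)
  also have "Polynomial.degree \<dots> = Polynomial.degree (Polynomial.monom (1 :: rat) (q * p ^ (n - 1)))"
  proof (rule degree_add_eq_right)
    have "Polynomial.degree (\<Sum>k<q. Polynomial.monom (1 :: rat) (k * p ^ (n - 1))) < q * p ^ (n - 1)"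
      using q p3 by (intro degree_sum_less) (auto simp: degree_monom_eq)
    then show "Polynomial.degree (\<Sum>k<q. Polynomial.monom (1 :: rat) (k * p ^ (n - 1))) <
        Polynomial.degree (Polynomial.monom (1 :: rat) (q * p ^ (n - 1)))"
      by (simp add: degree_monom_eq)
  qed
  finally have "Polynomial.degree (Phi n) = q * p ^ (n - 1)" by (simp add: degree_monom_eq)
  then show ?thesis using q by (metis diff_Suc_1 phi_def)
qed

lemma ev_Phi:
  assumes n: "n \<ge> 1" and s: "\<not> p dvd s"
  shows "ev (Phi n) (\<zeta> n ^ s) = 0"
proof -
  let ?w = "\<zeta> n ^ (s * p ^ (n - 1))"
  have pn: "p ^ n = p ^ (n - 1) * p" using n by (cases n) auto
  have "?w ^ p = \<zeta> n ^ (s * p ^ n)" unfolding pn by (simp only: power_mult[symmetric] mult.assoc)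
  also have "\<dots> = 1" by (subst zeta_power_eq_1_iff[OF n]) simp
  finally have 1: "?w ^ p = 1" .
  have "?w \<noteq> 1"
  proof
    assume "?w = 1"
    then have "p * p ^ (n - 1) dvd s * p ^ (n - 1)"
      using zeta_power_eq_1_iff[OF n] pn by (simp only: mult.commute)
    then show False using s p3 by simp
  qed
  moreover have "(?w - 1) * (\<Sum>k<p. ?w ^ k) = 0"
    using 1 power_diff_1_eq[of ?w p] by simp
  ultimately have "(\<Sum>k<p. ?w ^ k) = 0" by simp
  then show ?thesis by (simp add: Phi_def flip: power_mult add: mult_ac)
qed

text \<open>The ring Q[\<open>\<zeta> n\<close>]. A dimension count makes it a field
  (\<open>cyc_inverse\<close>), after which it is identified with
  \<open>cyclo_field\<close>.\<close>

definition cyc :: "nat \<Rightarrow> 'a set" where "cyc n = range (\<lambda>f. ev f (\<zeta> n))"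

lemma cyc_ev: "ev f (\<zeta> n) \<in> cyc n"
  by (simp add: cyc_def)

lemma cyc_closed:
  shows cyc_0: "0 \<in> cyc n" and cyc_1: "1 \<in> cyc n" and cyc_rat: "of_rat q \<in> cyc n"
    and cyc_zeta: "\<zeta> n \<in> cyc n"
    and cyc_add: "y \<in> cyc n \<Longrightarrow> z \<in> cyc n \<Longrightarrow> y + z \<in> cyc n"
    and cyc_diff: "y \<in> cyc n \<Longrightarrow> z \<in> cyc n \<Longrightarrow> y - z \<in> cyc n"
    and cyc_uminus: "y \<in> cyc n \<Longrightarrow> - y \<in> cyc n"
    and cyc_mult: "y \<in> cyc n \<Longrightarrow> z \<in> cyc n \<Longrightarrow> y * z \<in> cyc n"
    and cyc_power: "y \<in> cyc n \<Longrightarrow> y ^ k \<in> cyc n"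
proof -
  show "0 \<in> cyc n" using cyc_ev[of 0] by simp
  show "1 \<in> cyc n" using cyc_ev[of 1] by simp
  show "of_rat q \<in> cyc n" using cyc_ev[of "[:q:]"] by simp
  show "\<zeta> n \<in> cyc n" using cyc_ev[of "[:0, 1:]"] by simp
  show "y + z \<in> cyc n" if "y \<in> cyc n" "z \<in> cyc n"
    using that cyc_ev by (auto simp: cyc_def simp flip: ev_add)
  show "y - z \<in> cyc n" if "y \<in> cyc n" "z \<in> cyc n"
    using that cyc_ev by (auto simp: cyc_def simp flip: ev_diff)
  show "- y \<in> cyc n" if "y \<in> cyc n"
    using that cyc_ev by (auto simp: cyc_def simp flip: ev_uminus)
  show "y * z \<in> cyc n" if "y \<in> cyc n" "z \<in> cyc n"
    using that cyc_ev by (auto simp: cyc_def simp flip: ev_mult)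
  show "y ^ k \<in> cyc n" if "y \<in> cyc n"
    using that cyc_ev by (auto simp: cyc_def simp flip: ev_power)
qed

lemma cyc_sum: "(\<And>i. i \<in> I \<Longrightarrow> f i \<in> cyc n) \<Longrightarrow> sum f I \<in> cyc n"
  by (induction I rule: infinite_finite_induct) (auto intro: cyc_closed)

lemma cyc_prod: "(\<And>i. i \<in> I \<Longrightarrow> f i \<in> cyc n) \<Longrightarrow> prod f I \<in> cyc n"
  by (induction I rule: infinite_finite_induct) (auto intro: cyc_closed)

lemma ev_mod_Phi: "n \<ge> 1 \<Longrightarrow> ev (f mod Phi n) (\<zeta> n) = ev f (\<zeta> n)"
proof -
  assume n: "n \<ge> 1"
  have "\<not> p dvd 1" using p3 by simp
  then have "ev (Phi n) (\<zeta> n) = 0" using ev_Phi[OF n, of 1] by simp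
  then have "ev (f div Phi n * Phi n + f mod Phi n) (\<zeta> n) = ev (f mod Phi n) (\<zeta> n)"
    unfolding ev_add ev_mult by simp
  then show ?thesis by (simp only: div_mult_mod_eq)
qed

lemma degree_mod_Phi: "Polynomial.degree (f mod Phi n) < phi n"
proof (cases "f mod Phi n = 0")
  case False
  moreover have "Phi n \<noteq> 0" using degree_Phi[of n] phi_pos[of n] by auto
  ultimately show ?thesis using degree_mod_less'[of "Phi n" f] degree_Phi[of n] by simp
qed (simp add: phi_pos)

lemma cyc_span:
  assumes "n \<ge> 1" "y \<in> cyc n"
  shows "\<exists>r. y = (\<Sum>k<phi n. of_rat (r k) * \<zeta> n ^ k)"
proof -
  obtain f where "y = ev f (\<zeta> n)" using assms by (auto simp: cyc_def)
  then have "y = ev (f mod Phi n) (\<zeta> n)" using ev_mod_Phi assms by simp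
  then show ?thesis using ev_altdef[OF degree_mod_Phi] by blast
qed

end

section \<open>Values in the cyclotomic tower\<close>

context valuation_subring
begin

text \<open>Units are introduced before any reference element x is fixed, because the next lemmas
  compare the elements \<open>\<zeta> n - 1\<close> of different levels.\<close>

definition unit :: "'a \<Rightarrow> bool" where "unit y \<longleftrightarrow> y \<noteq> 0 \<and> y \<in> V \<and> inverse y \<in> V"

lemma unit_1: "unit 1" by (simp add: unit_def V_intros)

lemma unit_mult: "unit y \<Longrightarrow> unit z \<Longrightarrow> unit (y * z)"
  by (auto simp: unit_def intro: V_intros)

lemma unit_inverse: "unit y \<Longrightarrow> unit (inverse y)"
  by (auto simp: unit_def)

lemma unit_uminus: "unit y \<Longrightarrow> unit (- y)"
  by (auto simp: unit_def intro: V_intros)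

lemma unit_power: "unit y \<Longrightarrow> unit (y ^ n)"
  by (induction n) (auto intro: unit_1 unit_mult)

lemma unit_prod: "(\<And>i. i \<in> I \<Longrightarrow> unit (f i)) \<Longrightarrow> unit (prod f I)"
  by (induction I rule: infinite_finite_induct) (auto intro: unit_1 unit_mult)

end

locale cyclotomic_valuation = cyclotomic_tower p \<zeta> + valuation_subring V p
  for p and \<zeta> :: "nat \<Rightarrow> 'a::field_char_0" and V :: "'a set"
begin

lemma zeta_V: "n \<ge> 1 \<Longrightarrow> \<zeta> n \<in> V"
  using V_root_of_unity[OF zeta_power_order, of n] p3 by simp

lemma zeta_power_neq_1: "n \<ge> 1 \<Longrightarrow> \<not> p dvd s \<Longrightarrow> \<zeta> n ^ s \<noteq> 1"
  using zeta_power_eq_1_iff[of n s] dvd_trans[of p "p ^ n" s] by (metis dvd_power less_le_trans zero_less_one)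

lemma zeta_diff_V:
  assumes "n \<ge> 1"
  shows "(\<zeta> n ^ (s * t) - 1) / (\<zeta> n ^ s - 1) \<in> V"
proof (cases "\<zeta> n ^ s = 1")
  case False
  have "(\<zeta> n ^ (s * t) - 1) / (\<zeta> n ^ s - 1) = (\<Sum>k<t. (\<zeta> n ^ s) ^ k)"
    using power_diff_1_eq[of "\<zeta> n ^ s" t] False by (simp add: power_mult)
  then show ?thesis using zeta_V[OF assms] by (auto intro!: V_intros)
qed (simp add: V_intros)

text \<open>As s is invertible modulo p^n, \<open>\<zeta> n\<close> is also a power of
  \<open>\<zeta> n ^ s\<close>; hence the quotient and its inverse are both geometric sums.\<close>

lemma unit_zeta_diff:
  assumes n: "n \<ge> 1" and s: "\<not> p dvd s"
  shows "unit ((\<zeta> n ^ s - 1) / (\<zeta> n - 1))"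
proof -
  have "coprime p s" using s p_prime by (rule prime_imp_coprime[rotated])
  then have "coprime (p ^ n) s" by simp
  then have "coprime s (p ^ n)" by (rule coprime_commute[THEN iffD1])
  from cong_solve_coprime_nat[OF this] obtain t where "[s * t = Suc 0] (mod p ^ n)" by (elim exE)
  then have t: "\<zeta> n ^ (s * t) = \<zeta> n" using zeta_power_eq_iff[OF n, of "s * t" 1] by simp
  have "\<zeta> n ^ s \<noteq> 1" "\<zeta> n ^ 1 \<noteq> 1"
    using zeta_power_neq_1[OF n] s p3 by auto
  then show ?thesis
    using zeta_diff_V[OF n, of s t] zeta_diff_V[OF n, of 1 s] unfolding unit_def by (simp add: t)
qed

text \<open>The product of the elements \<open>1 - \<zeta> 1 ^ k\<close> is p, and each is a unit
  times \<open>\<zeta> 1 - 1\<close>.\<close>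

lemma unit_p_over:
  shows "unit (of_nat p / (\<zeta> 1 - 1) ^ (p - 1))"
proof -
  have "primitive_root_of_unity p (\<zeta> 1)" using primitive_zeta[of 1] by simp
  from prod_one_minus_primitive_roots[OF this]
  have "of_nat p = (\<Prod>k\<in>{1..<p}. 1 - \<zeta> 1 ^ k)" using p3 by simp
  then have "of_nat p / (\<zeta> 1 - 1) ^ (p - 1) = (\<Prod>k\<in>{1..<p}. - ((\<zeta> 1 ^ k - 1) / (\<zeta> 1 - 1)))"
    by (simp add: prod_dividef minus_divide_left)
  moreover have "unit \<dots>"
    by (intro unit_prod unit_uminus unit_zeta_diff) (auto dest: dvd_imp_le)
  ultimately show ?thesis by simp
qed

text \<open>A relative norm: \<open>\<zeta> n - 1\<close> is the product of
  \<open>\<zeta> (Suc n) * \<eta> - 1\<close> over the p-th roots of unity \<eta>. Each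
  \<open>\<zeta> (Suc n) * \<eta>\<close> is a power of \<open>\<zeta> (Suc n)\<close> with exponent
  prime to p, so every factor is associated to \<open>\<zeta> (Suc n) - 1\<close>.\<close>

lemma unit_zeta_step:
  assumes n: "n \<ge> 1"
  shows "unit ((\<zeta> n - 1) / (\<zeta> (Suc n) - 1) ^ p)"
proof -
  have prim: "primitive_root_of_unity (p ^ 1) (\<zeta> (Suc n) ^ (p ^ n))"
    by (rule primitive_zeta_power) auto
  have "(\<Prod>k<p. \<zeta> (Suc n) * (\<zeta> (Suc n) ^ (p ^ n)) ^ k - 1) = \<zeta> (Suc n) ^ p - 1"
    using prod_times_primitive_roots[OF prim] p_odd by simp
  also have "\<zeta> (Suc n) ^ p = \<zeta> n" using compat n by (auto simp: compatible_roots_def)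
  finally have "(\<zeta> n - 1) / (\<zeta> (Suc n) - 1) ^ p =
      (\<Prod>k<p. (\<zeta> (Suc n) ^ (1 + p ^ n * k) - 1) / (\<zeta> (Suc n) - 1))"
    by (simp add: prod_dividef power_mult)
  moreover have "unit \<dots>"
  proof (intro unit_prod unit_zeta_diff)
    fix k
    have "p dvd p ^ n * k" using n by simp
    then show "\<not> p dvd 1 + p ^ n * k" using p3
      using dvd_add_left_iff[of p "p ^ n * k" 1] by simp
  qed simp
  ultimately show ?thesis by simp
qed

lemma unit_zeta_level:
  assumes "n \<ge> 1"
  shows "unit ((\<zeta> n - 1) / (\<zeta> (n + k) - 1) ^ (p ^ k))"
proof (induction k)
  case 0
  then show ?case using zeta_power_neq_1[of n 1] assms p3 by (simp add: unit_1)
next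
  case (Suc k)
  have "unit ((\<zeta> n - 1) / (\<zeta> (n + k) - 1) ^ (p ^ k) *
      ((\<zeta> (n + k) - 1) / (\<zeta> (Suc (n + k)) - 1) ^ p) ^ (p ^ k))"
    using assms by (intro unit_mult Suc unit_power unit_zeta_step) auto
  moreover have "\<zeta> (n + k) - 1 \<noteq> 0"
    using zeta_power_neq_1[of "n + k" 1] assms p3 by simp
  ultimately show ?case
    by (simp add: power_divide mult_ac flip: power_mult)
qed

lemma unit_p_level:
  assumes "n \<ge> 1"
  shows "unit (of_nat p / (\<zeta> n - 1) ^ phi n)"
proof -
  have "unit (of_nat p / (\<zeta> 1 - 1) ^ (p - 1) * ((\<zeta> 1 - 1) / (\<zeta> (1 + (n - 1)) - 1) ^ (p ^ (n - 1))) ^ (p - 1))"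
    by (intro unit_mult unit_power unit_p_over unit_zeta_level) simp
  moreover have "\<zeta> 1 - 1 \<noteq> 0"
    using zeta_power_neq_1[of 1 1] p3 by simp
  ultimately show ?thesis using assms
    by (simp add: power_divide phi_def mult_ac flip: power_mult)
qed

lemma inverse_zeta_diff_notin_V:
  assumes n: "n \<ge> 1"
  shows "inverse (\<zeta> n - 1) \<notin> V"
proof
  assume *: "inverse (\<zeta> n - 1) \<in> V"
  have "\<zeta> n - 1 \<noteq> 0" using zeta_power_neq_1[of n 1] n p3 by simp
  then have u: "unit (\<zeta> n - 1)" using * zeta_V[OF n] by (auto simp: unit_def intro: V_intros)
  have "unit (of_nat p / (\<zeta> n - 1) ^ phi n * (\<zeta> n - 1) ^ phi n)"
    by (intro unit_mult unit_power u unit_p_level n)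
  then have "unit (of_nat p)" using \<open>\<zeta> n - 1 \<noteq> 0\<close> by simp
  then show False using inv_p by (simp add: unit_def)
qed

end

text \<open>Values are taken at the top level N, where those of the lower levels stay integers:
  \<open>\<zeta> n - 1\<close> has value \<open>p ^ (N - n)\<close>. A fact about \<open>E m\<close>
  may be proved at any convenient N from m on.\<close>

locale cyclotomic_level = cyclotomic_valuation p \<zeta> V
  for p and \<zeta> :: "nat \<Rightarrow> 'a::field_char_0" and V :: "'a set" + fixes N :: nat
  assumes N: "N \<ge> 1"

sublocale cyclotomic_level \<subseteq> uniformized_subring V p "\<zeta> N - 1"
  by unfold_locales
    (use inverse_zeta_diff_notin_V[OF N] zeta_V[OF N] in \<open>auto intro: V_intros\<close>)

context cyclotomic_level
begin

lemma U_0_iff: "U 0 y \<longleftrightarrow> unit y" by (simp add: U_iff_unit unit_def)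

lemma U_p: "U (int (phi N)) (of_nat p)"
proof -
  have "U (0 + int (phi N) * 1) (of_nat p / (\<zeta> N - 1) ^ phi N * (\<zeta> N - 1) ^ phi N)"
    by (intro U_mult U_power U_x) (use unit_p_level[OF N] in \<open>simp add: U_0_iff\<close>)
  then show ?thesis using x0 by simp
qed

lemma U_zeta_diff_power:
  assumes "n \<ge> 1" "n \<le> N" "\<not> p dvd s"
  shows "U (int (p ^ (N - n))) (\<zeta> n ^ s - 1)"
proof -
  have "U (0 + (0 + int (p ^ (N - n)) * 1))
      ((\<zeta> n ^ s - 1) / (\<zeta> n - 1) * ((\<zeta> n - 1) / (\<zeta> (n + (N - n)) - 1) ^ (p ^ (N - n))
        * (\<zeta> N - 1) ^ (p ^ (N - n))))"
    by (intro U_mult U_power U_x; unfold U_0_iff) (intro unit_zeta_diff unit_zeta_level assms)+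
  moreover have "\<zeta> n - 1 \<noteq> 0"
    using zeta_power_neq_1[of n 1] assms p3 by simp
  ultimately show ?thesis using assms x0 by simp
qed

lemma U_zeta_diff: "n \<ge> 1 \<Longrightarrow> n \<le> N \<Longrightarrow> U (int (p ^ (N - n))) (\<zeta> n - 1)"
  using U_zeta_diff_power[of n 1] p3 by simp

lemma U_rat:
  assumes "q \<noteq> 0"
  shows "\<exists>z. U (z * int (phi N)) (of_rat q)"
  using U_of_rat[OF U_p assms] .

text \<open>Rational coefficients change a value only by multiples of \<open>phi N\<close>. If the
  values of the b i are distinct modulo \<open>phi N\<close>, the nonzero terms thus have distinct
  values, whatever the coefficients.\<close>

lemma rat_combination:
  assumes fin: "finite I" and b: "\<And>i. i \<in> I \<Longrightarrow> U (e i) (b i)"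
    and inj: "inj_on (\<lambda>i. e i mod int (phi N)) I"
  shows rat_combination_D: "D l (\<Sum>i\<in>I. of_rat (r i) * b i) \<Longrightarrow> i \<in> I \<Longrightarrow> D l (of_rat (r i) * b i)"
    and rat_combination_U: "(\<Sum>i\<in>I. of_rat (r i) * b i) \<noteq> 0 \<Longrightarrow>
      \<exists>i\<in>I. \<exists>z. U (z * int (phi N) + e i) (\<Sum>i\<in>I. of_rat (r i) * b i)"
    and rat_combination_0: "(\<Sum>i\<in>I. of_rat (r i) * b i) = 0 \<Longrightarrow> \<forall>i\<in>I. r i = 0"
proof -
  have "\<forall>i. \<exists>z. r i \<noteq> 0 \<longrightarrow> U (z * int (phi N)) (of_rat (r i))" using U_rat by blast
  then obtain z where z: "\<And>i. r i \<noteq> 0 \<Longrightarrow> U (z i * int (phi N)) (of_rat (r i))" by metis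
  let ?k = "\<lambda>i. z i * int (phi N) + e i" and ?f = "\<lambda>i. of_rat (r i) * b i"
  have ex: "?f i = 0 \<or> U (?k i) (?f i)" if "i \<in> I" for i
    using U_mult[OF z b[OF that]] by (cases "r i = 0") auto
  have inj': "inj_on ?k {i\<in>I. ?f i \<noteq> 0}"
  proof (rule inj_onI)
    fix i j assume ij: "i \<in> {i\<in>I. ?f i \<noteq> 0}" "j \<in> {i\<in>I. ?f i \<noteq> 0}" "?k i = ?k j"
    have "?k i mod int (phi N) = ?k j mod int (phi N)" using ij(3) by (simp only:)
    then have "e i mod int (phi N) = e j mod int (phi N)" by simp
    then show "i = j" using inj ij by (auto simp: inj_on_def)
  qed
  show "D l (sum ?f I) \<Longrightarrow> i \<in> I \<Longrightarrow> D l (?f i)"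
    by (rule D_sum_distinct[OF fin ex inj'])
  have nz: "\<exists>i\<in>I. U (?k i) (sum ?f I)" if "j \<in> I" "r j \<noteq> 0" for j
    by (rule sum_distinct_nonzero[OF fin ex inj' that(1)]) (use that b[of j] U_nonzero in auto)
  show "\<exists>i\<in>I. \<exists>z. U (z * int (phi N) + e i) (sum ?f I)" if s0: "sum ?f I \<noteq> 0"
  proof -
    have "\<exists>j\<in>I. r j \<noteq> 0"
    proof (rule ccontr)
      assume "\<not> ?thesis"
      then have "sum ?f I = 0" by (intro sum.neutral) auto
      then show False using s0 by simp
    qed
    then show ?thesis using nz by blast
  qed
  show "\<forall>i\<in>I. r i = 0" if "sum ?f I = 0"
    using nz U_nonzero that by (metis (no_types, lifting))
qed

text \<open>Irreducibility of \<open>Phi N\<close> in disguise: rewritten in powers of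
  \<open>\<zeta> N - 1\<close>, the relation involves only the values 0, ...,
  \<open>phi N - 1\<close>, distinct modulo \<open>phi N\<close>.\<close>

lemma ev_zero_imp_zero:
  assumes "ev f (\<zeta> N) = 0" "Polynomial.degree f < phi N"
  shows "f = 0"
proof -
  define g where "g = pcompose f [:1, 1:]"
  have deg: "Polynomial.degree g = Polynomial.degree f" by (simp add: g_def degree_pcompose)
  have "ev g (\<zeta> N - 1) = 0" using assms by (simp add: g_def)
  then have s: "(\<Sum>k<phi N. of_rat (Polynomial.coeff g k) * (\<zeta> N - 1) ^ k) = 0"
    using ev_altdef[of g "phi N" "\<zeta> N - 1"] deg assms(2) by simp
  have "\<forall>k\<in>{..<phi N}. Polynomial.coeff g k = 0"
    by (rule rat_combination_0[OF _ _ _ s, of int])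
      (use U_power[OF U_x] in \<open>auto simp: inj_on_def\<close>)
  moreover have "Polynomial.coeff g k = 0" if "\<not> k < phi N" for k
    using that deg assms by (intro coeff_eq_0) auto
  ultimately have "g = 0" by (metis lessThan_iff poly_eqI Polynomial.coeff_0)
  then show ?thesis by (simp add: g_def pcompose_eq_0_iff)
qed

end

section \<open>Irreducibility, power bases and inverses in the cyclotomic fields\<close>

context cyclotomic_tower
begin

text \<open>Facts whose statement does not mention a valuation obtain a \<open>V\<close> locally
  from here.\<close>

lemma exists_level:
  assumes "n \<ge> 1"
  shows "\<exists>V. cyclotomic_level p \<zeta> V n"
proof -
  obtain V :: "'a set" where "valuation_subring V p" using exists_valuation_subring[OF p_prime] by blast
  then show ?thesis using cyclotomic_tower_axioms assms
    by (auto simp: cyclotomic_level_def cyclotomic_level_axioms_def cyclotomic_valuation_def)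
qed

lemma Phi_dvd:
  assumes n: "n \<ge> 1" and f: "ev f (\<zeta> n) = 0"
  shows "Phi n dvd f"
proof -
  obtain V where "cyclotomic_level p \<zeta> V n" using exists_level[OF n] by blast
  then interpret cyclotomic_level p \<zeta> V n .
  have "f mod Phi n = 0"
    by (rule ev_zero_imp_zero) (use ev_mod_Phi[OF n] degree_mod_Phi f in auto)
  then show ?thesis by (simp add: dvd_eq_mod_eq_0)
qed

lemma ev_conj:
  assumes n: "n \<ge> 1" and f: "ev f (\<zeta> n) = 0" and s: "\<not> p dvd s"
  shows "ev f (\<zeta> n ^ s) = 0"
  using Phi_dvd[OF n f] ev_Phi[OF n s] by (auto elim!: dvdE)

lemma zeta_basis:
  assumes n: "n \<ge> 1" and r: "(\<Sum>k<phi n. of_rat (r k) * \<zeta> n ^ k) = 0"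
  shows "\<forall>k<phi n. r k = 0"
proof -
  obtain V where "cyclotomic_level p \<zeta> V n" using exists_level[OF n] by blast
  then interpret cyclotomic_level p \<zeta> V n .
  define f where "f = (\<Sum>k<phi n. Polynomial.monom (r k) k)"
  have "Polynomial.degree f < phi n" unfolding f_def
    by (intro degree_sum_less) (auto simp: phi_pos intro: le_less_trans[OF degree_monom_le])
  moreover have "ev f (\<zeta> n) = 0" using r by (simp add: f_def)
  ultimately have "f = 0" by (rule ev_zero_imp_zero[rotated])
  moreover have "Polynomial.coeff f k = r k" if "k < phi n" for k
    using that by (simp add: f_def coeff_sum)
  ultimately show ?thesis by auto
qed

text \<open>Multiplication by y keeps the power basis independent, so its image is again a basis and
  1 is a multiple of y.\<close>

lemma cyc_inverse:
  assumes n: "n \<ge> 1" and y: "y \<in> cyc n"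
  shows "inverse y \<in> cyc n"
proof (cases "y = 0")
  case False
  have "\<exists>r. 1 = (\<Sum>k\<in>{..<phi n}. of_rat (r k) * (y * \<zeta> n ^ k))"
  proof (rule rat_basis[where c = "\<lambda>k. \<zeta> n ^ k"])
    show "\<exists>r. y * \<zeta> n ^ i = (\<Sum>k<card {..<phi n}. of_rat (r k) * \<zeta> n ^ k)" for i
      using cyc_span[OF n, of "y * \<zeta> n ^ i"] y by (auto intro!: cyc_closed)
    show "\<exists>r. 1 = (\<Sum>k<card {..<phi n}. of_rat (r k) * \<zeta> n ^ k)"
      using cyc_span[OF n cyc_1] by simp
    fix r assume "(\<Sum>k\<in>{..<phi n}. of_rat (r k) * (y * \<zeta> n ^ k)) = 0"
    then have "y * (\<Sum>k<phi n. of_rat (r k) * \<zeta> n ^ k) = 0"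
      by (simp add: sum_distrib_left mult_ac)
    then show "\<forall>i\<in>{..<phi n}. r i = 0" using zeta_basis[OF n] False by auto
  qed simp
  then obtain r where "1 = (\<Sum>k<phi n. of_rat (r k) * (y * \<zeta> n ^ k))" by auto
  then have "y * (\<Sum>k<phi n. of_rat (r k) * \<zeta> n ^ k) = 1"
    by (simp add: sum_distrib_left mult_ac)
  then have "inverse y = (\<Sum>k<phi n. of_rat (r k) * \<zeta> n ^ k)" by (rule inverse_unique)
  then show ?thesis by (auto intro!: cyc_closed cyc_sum)
qed (simp add: cyc_0)

end

section \<open>Translation between HOL-Algebra structures and the type; lifting of
  congruences\<close>

lemma ring_of_type_algebra_simps [simp]:
  "carrier (ring_of_type_algebra :: 'a::ring_1 ring) = UNIV"
  "x \<otimes>\<^bsub>ring_of_type_algebra\<^esub> (y::'a) = x * y"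
  "x \<oplus>\<^bsub>ring_of_type_algebra\<^esub> (y::'a) = x + y"
  "\<one>\<^bsub>ring_of_type_algebra\<^esub> = (1::'a)"
  "\<zero>\<^bsub>ring_of_type_algebra\<^esub> = (0::'a)"
  by (simp_all add: ring_of_type_algebra_def)

lemma subring_on_simps [simp]:
  "carrier (subring_on A) = A"
  "x \<otimes>\<^bsub>subring_on A\<^esub> y = x * y"
  "x \<oplus>\<^bsub>subring_on A\<^esub> y = x + y"
  "\<one>\<^bsub>subring_on A\<^esub> = 1"
  "\<zero>\<^bsub>subring_on A\<^esub> = 0"
  by (simp_all add: subring_on_def)

lemmas type_field = field_from_type_algebra
lemmas type_ring = ring_from_type_algebra
lemmas type_cring = cring_from_type_algebra

lemma a_inv_type [simp]: "\<ominus>\<^bsub>ring_of_type_algebra\<^esub> (y :: 'a::field_char_0) = - y"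
  by (rule abelian_group.minus_equality[OF ring.is_abelian_group[OF type_ring]]) simp_all

lemma m_inv_type: "y \<noteq> 0 \<Longrightarrow> inv\<^bsub>ring_of_type_algebra\<^esub> (y :: 'a::field_char_0) = inverse y"
  by (rule comm_monoid.comm_inv_char[OF cring.axioms(2)[OF type_cring]]) simp_all

lemma Rats_of_rat: "y \<in> \<rat> \<longleftrightarrow> (\<exists>q. y = of_rat q)"
  by (auto elim: Rats_cases)

lemma subfieldI_type:
  fixes K :: "'a::field_char_0 set"
  assumes "is_subring K" "\<And>y. y \<in> K \<Longrightarrow> inverse y \<in> K"
  shows "subfield K ring_of_type_algebra"
proof (rule field.subfieldI'[OF type_field])
  show "subring K ring_of_type_algebra"
    by (rule ring.subringI[OF type_ring]) (auto simp: is_subringD[OF assms(1)])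
  show "inv\<^bsub>ring_of_type_algebra\<^esub> k \<in> K" if "k \<in> K - {\<zero>\<^bsub>ring_of_type_algebra\<^esub>}" for k
    using that assms(2) by (simp add: m_inv_type)
qed

text \<open>In a^p - b^p = (a - b) S the cofactor S is congruent to p b^(p - 1) modulo p, which
  supplies the extra factor p.\<close>

lemma cong_power_p_lift:
  fixes a b p k :: nat
  assumes "[a = b] (mod p ^ k)" "k \<ge> 1"
  shows "[a ^ p = b ^ p] (mod p ^ Suc k)"
proof -
  have "int a ^ p - int b ^ p = (int a - int b) * (\<Sum>i<p. int b ^ (p - Suc i) * int a ^ i)"
    by (rule power_diff_sumr2)
  moreover have "int (p ^ k) dvd int a - int b"
    using cong_int_iff[THEN iffD2, OF assms(1)] unfolding cong_iff_dvd_diff .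
  moreover have "int p dvd (\<Sum>i<p. int b ^ (p - Suc i) * int a ^ i)"
  proof -
    have ab: "[int a = int b] (mod int p)"
    proof (rule cong_int_iff[THEN iffD2], rule cong_dvd_modulus_nat[OF assms(1)])
      show "p dvd p ^ k" using assms(2) by (simp add: dvd_power)
    qed
    have "[(\<Sum>i<p. int b ^ (p - Suc i) * int a ^ i) = (\<Sum>i<p. int b ^ (p - Suc i) * int b ^ i)] (mod int p)"
      by (intro cong_sum cong_mult cong_refl cong_pow ab)
    also have "(\<Sum>i<p. int b ^ (p - Suc i) * int b ^ i) = int p * int b ^ (p - 1)"
      by (simp flip: power_add)
    finally show ?thesis by (simp add: cong_dvd_iff)
  qed
  ultimately have "int (p ^ k) * int p dvd int a ^ p - int b ^ p"
    by (simp only: mult_dvd_mono)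
  then have "int (p ^ Suc k) dvd int (a ^ p) - int (b ^ p)" by (simp add: mult.commute)
  then have "[int (a ^ p) = int (b ^ p)] (mod int (p ^ Suc k))" by (simp only: cong_iff_dvd_diff)
  then show ?thesis by (simp only: cong_int_iff)
qed

lemma cong_power_p_power_lift:
  fixes a b p k :: nat
  assumes "[a = b] (mod p)"
  shows "[a ^ (p ^ k) = b ^ (p ^ k)] (mod p ^ Suc k)"
proof (induction k)
  case (Suc k)
  have "[(a ^ (p ^ k)) ^ p = (b ^ (p ^ k)) ^ p] (mod p ^ Suc (Suc k))"
    by (rule cong_power_p_lift[OF Suc]) simp
  then show ?case by (simp add: mult.commute flip: power_mult)
qed (use assms in simp)

context cyclotomic_tower
begin

section \<open>The Galois group\<close>

text \<open>By \<open>ev_conj\<close>, the value does not depend on the choice of \<open>f\<close>.\<close>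

definition sig :: "nat \<Rightarrow> nat \<Rightarrow> 'a \<Rightarrow> 'a" where
  "sig n s y = ev (SOME f. ev f (\<zeta> n) = y) (\<zeta> n ^ s)"

lemma sig_ev:
  assumes "n \<ge> 1" "\<not> p dvd s"
  shows "sig n s (ev f (\<zeta> n)) = ev f (\<zeta> n ^ s)"
proof -
  let ?g = "SOME g. ev g (\<zeta> n) = ev f (\<zeta> n)"
  have "ev ?g (\<zeta> n) = ev f (\<zeta> n)" by (rule someI[of _ f]) simp
  then have "ev (?g - f) (\<zeta> n) = 0" by simp
  from ev_conj[OF assms(1) this assms(2)] show ?thesis by (simp add: sig_def)
qed

lemma cycE: assumes "y \<in> cyc n" obtains f where "y = ev f (\<zeta> n)"
  using assms by (auto simp: cyc_def)

lemma sig_hom: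
  assumes n: "n \<ge> 1" and s: "\<not> p dvd s"
  shows sig_add: "y \<in> cyc n \<Longrightarrow> z \<in> cyc n \<Longrightarrow> sig n s (y + z) = sig n s y + sig n s z"
    and sig_diff: "y \<in> cyc n \<Longrightarrow> z \<in> cyc n \<Longrightarrow> sig n s (y - z) = sig n s y - sig n s z"
    and sig_mult: "y \<in> cyc n \<Longrightarrow> z \<in> cyc n \<Longrightarrow> sig n s (y * z) = sig n s y * sig n s z"
    and sig_power: "y \<in> cyc n \<Longrightarrow> sig n s (y ^ k) = sig n s y ^ k"
    and sig_of_rat: "sig n s (of_rat q) = of_rat q"
    and sig_0: "sig n s 0 = 0"
    and sig_1: "sig n s 1 = 1"
    and sig_zeta: "sig n s (\<zeta> n) = \<zeta> n ^ s"
    and sig_cyc: "y \<in> cyc n \<Longrightarrow> sig n s y \<in> cyc n"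
    and sig_sum: "(\<And>i. i \<in> I \<Longrightarrow> g i \<in> cyc n) \<Longrightarrow> sig n s (sum g I) = (\<Sum>i\<in>I. sig n s (g i))"
    and sig_prod: "(\<And>i. i \<in> I \<Longrightarrow> g i \<in> cyc n) \<Longrightarrow> sig n s (prod g I) = (\<Prod>i\<in>I. sig n s (g i))"
proof -
  note e = sig_ev[OF n s]
  show a: "sig n s (y + z) = sig n s y + sig n s z" if yz: "y \<in> cyc n" "z \<in> cyc n" for y z
  proof -
    obtain f g where fg: "y = ev f (\<zeta> n)" "z = ev g (\<zeta> n)" using yz by (auto simp: cyc_def)
    have "y + z = ev (f + g) (\<zeta> n)" by (simp add: fg)
    then have "sig n s (y + z) = ev (f + g) (\<zeta> n ^ s)" by (simp only: e)
    then show ?thesis unfolding fg e by simp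
  qed
  show "sig n s (y - z) = sig n s y - sig n s z" if yz: "y \<in> cyc n" "z \<in> cyc n"
  proof -
    obtain f g where fg: "y = ev f (\<zeta> n)" "z = ev g (\<zeta> n)" using yz by (auto simp: cyc_def)
    have "y - z = ev (f - g) (\<zeta> n)" by (simp add: fg)
    then have "sig n s (y - z) = ev (f - g) (\<zeta> n ^ s)" by (simp only: e)
    then show ?thesis unfolding fg e by simp
  qed
  show m: "sig n s (y * z) = sig n s y * sig n s z" if yz: "y \<in> cyc n" "z \<in> cyc n" for y z
  proof -
    obtain f g where fg: "y = ev f (\<zeta> n)" "z = ev g (\<zeta> n)" using yz by (auto simp: cyc_def)
    have "y * z = ev (f * g) (\<zeta> n)" by (simp add: fg)
    then have "sig n s (y * z) = ev (f * g) (\<zeta> n ^ s)" by (simp only: e)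
    then show ?thesis unfolding fg e by simp
  qed
  show "sig n s (y ^ k) = sig n s y ^ k" if yz: "y \<in> cyc n"
  proof -
    obtain f where f: "y = ev f (\<zeta> n)" using yz by (auto simp: cyc_def)
    have "y ^ k = ev (f ^ k) (\<zeta> n)" by (simp add: f)
    then have "sig n s (y ^ k) = ev (f ^ k) (\<zeta> n ^ s)" by (simp only: e)
    then show ?thesis unfolding f e by simp
  qed
  show "sig n s (of_rat q) = of_rat q" using e[of "[:q:]"] by simp
  show z0: "sig n s 0 = 0" using e[of 0] by simp
  show o1: "sig n s 1 = 1" using e[of 1] by simp
  show "sig n s (\<zeta> n) = \<zeta> n ^ s" using e[of "[:0, 1:]"] by simp
  show "sig n s y \<in> cyc n" if y: "y \<in> cyc n"
  proof -
    obtain f where "y = ev f (\<zeta> n)" using y by (auto simp: cyc_def)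
    then have "sig n s y = ev (pcompose f (Polynomial.monom 1 s)) (\<zeta> n)" by (simp add: e)
    then show ?thesis using cyc_ev by metis
  qed
  show "(\<And>i. i \<in> I \<Longrightarrow> g i \<in> cyc n) \<Longrightarrow> sig n s (sum g I) = (\<Sum>i\<in>I. sig n s (g i))"
    by (induction I rule: infinite_finite_induct) (auto simp: z0 a cyc_sum)
  show "(\<And>i. i \<in> I \<Longrightarrow> g i \<in> cyc n) \<Longrightarrow> sig n s (prod g I) = (\<Prod>i\<in>I. sig n s (g i))"
    by (induction I rule: infinite_finite_induct) (auto simp: o1 m cyc_prod)
qed

lemma sig_sig:
  assumes n: "n \<ge> 1" and s: "\<not> p dvd s" and t: "\<not> p dvd t" and y: "y \<in> cyc n"
  shows "sig n s (sig n t y) = sig n (s * t) y"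
proof -
  obtain f where f: "y = ev f (\<zeta> n)" using y by (auto simp: cyc_def)
  have "sig n t y = ev (pcompose f (Polynomial.monom 1 t)) (\<zeta> n)" by (simp add: f sig_ev[OF n t])
  then have "sig n s (sig n t y) = ev (pcompose f (Polynomial.monom 1 t)) (\<zeta> n ^ s)"
    by (simp only: sig_ev[OF n s])
  moreover have "\<not> p dvd s * t" using s t p_prime by (simp add: prime_dvd_mult_iff)
  ultimately show ?thesis by (simp add: f sig_ev[OF n] power_mult)
qed

lemma sig_cong: "n \<ge> 1 \<Longrightarrow> [s = t] (mod p ^ n) \<Longrightarrow> sig n s y = sig n t y"
  using zeta_power_eq_iff[of n s t] by (simp add: sig_def)

lemma sig_one: "n \<ge> 1 \<Longrightarrow> y \<in> cyc n \<Longrightarrow> sig n 1 y = y"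
  using sig_ev[of n 1] p3 by (auto elim!: cycE)

lemma cong_p: "n \<ge> 1 \<Longrightarrow> [s = t] (mod p ^ n) \<Longrightarrow> [s = t] (mod p)"
  by (rule cong_dvd_modulus_nat) (auto intro: dvd_power)

lemma exists_inverse_mod:
  assumes n: "n \<ge> 1" and s: "\<not> p dvd s"
  obtains t where "\<not> p dvd t" "[s * t = 1] (mod p ^ n)" "[t * s = 1] (mod p ^ n)"
proof -
  have "coprime p s" using s p_prime by (rule prime_imp_coprime[rotated])
  then have "coprime (p ^ n) s" by simp
  then have "coprime s (p ^ n)" by (rule coprime_commute[THEN iffD1])
  from cong_solve_coprime_nat[OF this] obtain t where t: "[s * t = 1] (mod p ^ n)" by (elim exE) simp
  then have "[s * t = 1] (mod p)" by (rule cong_p[OF n])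
  then have "\<not> p dvd t" using p3 cong_dvd_iff[of "s * t" 1 p] by auto
  then show ?thesis using that t by (simp add: mult.commute)
qed

lemma cyclo_field_eq:
  assumes n: "n \<ge> 1"
  shows "cyclo_field \<zeta> n = cyc n"
proof (intro equalityI subsetI)
  fix y assume "y \<in> cyclo_field \<zeta> n"
  then show "y \<in> cyc n" unfolding cyclo_field_def
  proof (induction rule: generate_field.induct)
    case (incl h)
    then show ?case by (auto simp: Rats_of_rat intro: cyc_closed)
  next
    case (m_inv h)
    then show ?case using cyc_inverse[OF n] by (simp add: m_inv_type)
  qed (auto intro: cyc_closed)
next
  fix y assume "y \<in> cyc n"
  then obtain f where "y = ev f (\<zeta> n)" by (auto simp: cyc_def)
  have rat: "of_rat q \<in> cyclo_field \<zeta> n" for q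
    unfolding cyclo_field_def by (rule generate_field.incl) simp
  have z: "\<zeta> n \<in> cyclo_field \<zeta> n" unfolding cyclo_field_def by (rule generate_field.incl) simp
  have "ev f (\<zeta> n) \<in> cyclo_field \<zeta> n"
  proof (induction f)
    case 0
    show ?case using rat[of 0] by simp
  next
    case (pCons a f)
    then show ?case
      using generate_field.eng_add[OF rat[of a, unfolded cyclo_field_def]
        generate_field.eng_mult[OF z[unfolded cyclo_field_def]]]
      by (simp add: cyclo_field_def)
  qed
  then show "y \<in> cyclo_field \<zeta> n" using \<open>y = _\<close> by simp
qed

text \<open>\<open>Bij\<close> consists of functions that are \<open>undefined\<close> outside their
  set; the restriction turns \<open>sig n s\<close> into such a function.\<close>

definition aut :: "nat \<Rightarrow> nat \<Rightarrow> 'a \<Rightarrow> 'a" where "aut n s = restrict (sig n s) (cyc n)"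

lemma aut_Bij:
  assumes n: "n \<ge> 1" and s: "\<not> p dvd s"
  shows "aut n s \<in> Bij (cyc n)"
proof -
  obtain t where t: "\<not> p dvd t" "[s * t = 1] (mod p ^ n)" "[t * s = 1] (mod p ^ n)"
    using exists_inverse_mod[OF n s] .
  have "bij_betw (aut n s) (cyc n) (cyc n)"
  proof (rule bij_betw_byWitness[where f' = "aut n t"])
    show "\<forall>a\<in>cyc n. aut n t (aut n s a) = a"
      using sig_cong[OF n t(3)] by (auto simp: aut_def sig_cyc[OF n] s t sig_sig[OF n] sig_one[OF n, simplified])
    show "\<forall>a\<in>cyc n. aut n s (aut n t a) = a"
      using sig_cong[OF n t(2)] by (auto simp: aut_def sig_cyc[OF n] s t sig_sig[OF n] sig_one[OF n, simplified])
  qed (auto simp: aut_def sig_cyc[OF n] s t)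
  then show ?thesis by (simp add: Bij_def aut_def)
qed

lemma aut_compose:
  assumes n: "n \<ge> 1" and s: "\<not> p dvd s" and t: "\<not> p dvd t"
  shows "compose (cyc n) (aut n s) (aut n t) = aut n (s * t)"
  by (rule ext) (simp add: compose_def aut_def sig_cyc[OF n t] sig_sig[OF n s t])

lemma aut_eq_iff:
  assumes n: "n \<ge> 1" and s: "\<not> p dvd s" and t: "\<not> p dvd t"
  shows "aut n s = aut n t \<longleftrightarrow> [s = t] (mod p ^ n)"
proof
  assume "aut n s = aut n t"
  then have "aut n s (\<zeta> n) = aut n t (\<zeta> n)" by simp
  then show "[s = t] (mod p ^ n)"
    by (simp add: aut_def cyc_zeta sig_zeta[OF n] s t zeta_power_eq_iff[OF n])
next
  assume "[s = t] (mod p ^ n)"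
  then show "aut n s = aut n t" using sig_cong[OF n] by (auto simp: aut_def)
qed

abbreviation Gal :: "nat \<Rightarrow> ('a \<Rightarrow> 'a) monoid" where "Gal n \<equiv> Galois_group (cyc n) \<rat>"

lemma Gal_hom_ev:
  assumes "\<sigma> \<in> carrier (Gal n)"
  shows "\<sigma> (ev f (\<zeta> n)) = ev f (\<sigma> (\<zeta> n))"
proof -
  have \<sigma>: "\<sigma> \<in> ring_hom (subring_on (cyc n)) (subring_on (cyc n))" "\<forall>y\<in>\<rat>. \<sigma> y = y"
    using assms by (auto simp: Galois_group_def ring_iso_def)
  show ?thesis
  proof (induction f)
    case 0
    show ?case using \<sigma>(2) Rats_0 by auto
  next
    case (pCons a f)
    have "\<sigma> (of_rat a + \<zeta> n * ev f (\<zeta> n)) = \<sigma> (of_rat a) + \<sigma> (\<zeta> n * ev f (\<zeta> n))"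
      using ring_hom_add[OF \<sigma>(1), of "of_rat a" "\<zeta> n * ev f (\<zeta> n)"] by (simp add: cyc_closed cyc_ev)
    also have "\<sigma> (\<zeta> n * ev f (\<zeta> n)) = \<sigma> (\<zeta> n) * \<sigma> (ev f (\<zeta> n))"
      using ring_hom_mult[OF \<sigma>(1), of "\<zeta> n" "ev f (\<zeta> n)"] by (simp add: cyc_closed cyc_ev)
    finally show ?case using pCons \<sigma>(2) by simp
  qed
qed

text \<open>A root w satisfies w^(p^n) = 1, so it is a power of \<open>\<zeta> n\<close>; for an
  exponent divisible by p the value of \<open>Phi n\<close> would be p instead of 0.\<close>

lemma root_Phi:
  assumes n: "n \<ge> 1" and w: "ev (Phi n) w = 0"
  shows "\<exists>s. \<not> p dvd s \<and> w = \<zeta> n ^ s"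
proof -
  let ?v = "w ^ (p ^ (n - 1))"
  have s0: "(\<Sum>k<p. ?v ^ k) = 0"
    using w by (simp add: Phi_def mult.commute flip: power_mult)
  have "?v ^ p - 1 = 0" using power_diff_1_eq[of ?v p] s0 by simp
  moreover have "?v ^ p = w ^ (p ^ n)" using n by (cases n) (simp_all add: mult.commute flip: power_mult)
  ultimately have "(\<Prod>k<p ^ n. w - \<zeta> n ^ k) = 0"
    using prod_minus_primitive_roots[OF primitive_zeta[OF n], of w] p3 by simp
  then obtain s where s: "w = \<zeta> n ^ s" by auto
  have "\<not> p dvd s"
  proof
    assume "p dvd s"
    then have "p ^ n dvd s * p ^ (n - 1)" using n by (cases n) auto
    then have "?v = 1" using zeta_power_eq_1_iff[OF n] by (simp add: s flip: power_mult)
    then show False using s0 p3 by simp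
  qed
  then show ?thesis using s by blast
qed

lemma carrier_Gal:
  assumes n: "n \<ge> 1"
  shows "carrier (Gal n) = aut n ` {s. \<not> p dvd s}"
proof (intro equalityI subsetI)
  fix \<sigma> assume \<sigma>: "\<sigma> \<in> carrier (Gal n)"
  have "\<not> p dvd 1" using p3 by simp
  then have "ev (Phi n) (\<zeta> n) = 0" using ev_Phi[OF n, of 1] by simp
  then have "ev (Phi n) (\<sigma> (\<zeta> n)) = \<sigma> (ev 0 (\<zeta> n))" using Gal_hom_ev[OF \<sigma>, of "Phi n"] by simp
  also have "\<dots> = 0" unfolding Gal_hom_ev[OF \<sigma>] by simp
  finally obtain s where s: "\<not> p dvd s" "\<sigma> (\<zeta> n) = \<zeta> n ^ s" using root_Phi[OF n] by blast
  have "\<sigma> = aut n s"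
  proof
    fix y show "\<sigma> y = aut n s y"
    proof (cases "y \<in> cyc n")
      case True
      then obtain f where "y = ev f (\<zeta> n)" by (auto simp: cyc_def)
      then show ?thesis using True Gal_hom_ev[OF \<sigma>] s by (simp add: aut_def sig_ev[OF n])
    next
      case False
      have "\<sigma> \<in> extensional (cyc n)" using \<sigma> by (auto simp: Galois_group_def Bij_def)
      then show ?thesis using False by (simp add: aut_def extensional_def)
    qed
  qed
  then show "\<sigma> \<in> aut n ` {s. \<not> p dvd s}" using s by blast
next
  fix \<sigma> assume "\<sigma> \<in> aut n ` {s. \<not> p dvd s}"
  then obtain s where s: "\<not> p dvd s" and \<sigma>: "\<sigma> = aut n s" by auto
  have bij: "\<sigma> \<in> Bij (cyc n)" using aut_Bij[OF n s] \<sigma> by simp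
  have "\<sigma> \<in> ring_hom (subring_on (cyc n)) (subring_on (cyc n))"
    by (rule ring_hom_memI)
      (auto simp: \<sigma> aut_def cyc_closed sig_cyc[OF n s] sig_add[OF n s] sig_mult[OF n s] sig_1[OF n s])
  moreover have "\<sigma> y = y" if "y \<in> \<rat>" for y
    using that by (auto simp: Rats_of_rat \<sigma> aut_def cyc_closed sig_of_rat[OF n s])
  ultimately show "\<sigma> \<in> carrier (Gal n)"
    using bij by (auto simp: Galois_group_def ring_iso_def Bij_def)
qed

lemma not_dvd_1: "\<not> p dvd 1" using p3 by auto

lemma not_dvd_mult: "\<not> p dvd s \<Longrightarrow> \<not> p dvd t \<Longrightarrow> \<not> p dvd s * t"
  using p_prime by (simp add: prime_dvd_mult_iff)

lemma not_dvd_power: "\<not> p dvd s \<Longrightarrow> \<not> p dvd s ^ k"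
  using p_prime prime_dvd_power by blast

lemma Gal_mult:
  assumes n: "n \<ge> 1" and s: "\<not> p dvd s" and t: "\<not> p dvd t"
  shows "aut n s \<otimes>\<^bsub>Gal n\<^esub> aut n t = aut n (s * t)"
  using aut_Bij[OF n s] aut_Bij[OF n t] aut_compose[OF n s t]
  by (simp add: Galois_group_def BijGroup_def)

lemma Gal_one:
  assumes n: "n \<ge> 1"
  shows "\<one>\<^bsub>Gal n\<^esub> = aut n 1"
  using sig_one[OF n] by (auto simp: Galois_group_def BijGroup_def aut_def restrict_def)

lemma group_Gal:
  assumes n: "n \<ge> 1"
  shows "group (Gal n)"
proof (rule groupI)
  show "\<one>\<^bsub>Gal n\<^esub> \<in> carrier (Gal n)"
    using not_dvd_1 by (auto simp: carrier_Gal[OF n] Gal_one[OF n])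
next
  fix \<sigma> \<tau> assume "\<sigma> \<in> carrier (Gal n)" "\<tau> \<in> carrier (Gal n)"
  then obtain s t where st: "\<not> p dvd s" "\<sigma> = aut n s" "\<not> p dvd t" "\<tau> = aut n t"
    by (auto simp: carrier_Gal[OF n])
  then show "\<sigma> \<otimes>\<^bsub>Gal n\<^esub> \<tau> \<in> carrier (Gal n)"
    using not_dvd_mult[of s t] by (auto simp: carrier_Gal[OF n] Gal_mult[OF n])
  fix \<rho> assume "\<rho> \<in> carrier (Gal n)"
  then obtain r where "\<not> p dvd r" "\<rho> = aut n r" by (auto simp: carrier_Gal[OF n])
  with st show "\<sigma> \<otimes>\<^bsub>Gal n\<^esub> \<tau> \<otimes>\<^bsub>Gal n\<^esub> \<rho> = \<sigma> \<otimes>\<^bsub>Gal n\<^esub> (\<tau> \<otimes>\<^bsub>Gal n\<^esub> \<rho>)"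
    using not_dvd_mult[of s t] not_dvd_mult[of t r] by (simp add: Gal_mult[OF n] mult.assoc)
next
  fix \<sigma> assume "\<sigma> \<in> carrier (Gal n)"
  then obtain s where s: "\<not> p dvd s" "\<sigma> = aut n s" by (auto simp: carrier_Gal[OF n])
  then show "\<one>\<^bsub>Gal n\<^esub> \<otimes>\<^bsub>Gal n\<^esub> \<sigma> = \<sigma>"
    using Gal_mult[OF n not_dvd_1 s(1)] by (simp add: Gal_one[OF n])
  obtain t where t: "\<not> p dvd t" "[t * s = 1] (mod p ^ n)"
    using exists_inverse_mod[OF n s(1)] by blast
  have "aut n (t * s) = aut n 1"
    using aut_eq_iff[OF n] t s not_dvd_mult not_dvd_1 by blast
  then show "\<exists>\<tau>\<in>carrier (Gal n). \<tau> \<otimes>\<^bsub>Gal n\<^esub> \<sigma> = \<one>\<^bsub>Gal n\<^esub>"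
    using t s by (auto simp: carrier_Gal[OF n] Gal_one[OF n] Gal_mult[OF n])
qed

lemma Gal_pow:
  assumes n: "n \<ge> 1" and s: "\<not> p dvd s"
  shows "aut n s [^]\<^bsub>Gal n\<^esub> k = aut n (s ^ k)"
proof (induction k)
  case 0
  then show ?case by (simp add: Gal_one[OF n])
next
  case (Suc k)
  then show ?case using Gal_mult[OF n not_dvd_power[OF s] s, of k] by (simp add: mult.commute)
qed

text \<open>\<open>T n j\<close> represents the unique \<open>(p - 1)\<close>-th root of unity modulo \<open>p ^ n\<close> congruent to \<open>j\<close>
  modulo \<open>p\<close>.\<close>

definition teich :: "nat \<Rightarrow> nat \<Rightarrow> bool" where
  "teich n s \<longleftrightarrow> [s ^ (p - 1) = 1] (mod p ^ n)"

definition T :: "nat \<Rightarrow> nat \<Rightarrow> nat" where "T n j = j ^ (p ^ (n - 1))"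

lemma teich_not_dvd: "n \<ge> 1 \<Longrightarrow> teich n s \<Longrightarrow> \<not> p dvd s"
proof
  assume n: "n \<ge> 1" and t: "teich n s" and d: "p dvd s"
  have "[s ^ (p - 1) = 1] (mod p)" using cong_p[OF n] t by (simp add: teich_def)
  moreover have "p dvd s ^ (p - 1)" using d p3 by (simp add: dvd_power_le[of p s "p - 1", simplified] dvd_trans[OF d dvd_power])
  ultimately show False using not_dvd_1 cong_dvd_iff by blast
qed

lemma T_cong_p: "[T n j = j] (mod p)"
proof -
  have "[j ^ (p ^ k) = j] (mod p)" for k
  proof (induction k)
    case (Suc k)
    have "[(j ^ (p ^ k)) ^ p = j ^ (p ^ k)] (mod p)"
    proof (cases "p dvd j ^ (p ^ k)")
      case True
      moreover have "p dvd (j ^ (p ^ k)) ^ p" using True p3 by (meson dvd_power_same dvd_trans dvd_power zero_less_numeral less_le_trans)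
      ultimately show ?thesis by (simp add: cong_def)
    next
      case False
      then have "[(j ^ (p ^ k)) ^ (p - 1) = 1] (mod p)"
        using fermat_theorem[OF p_prime] by blast
      from cong_scalar_left[OF this, of "j ^ (p ^ k)"] show ?thesis
        using p3 by (simp flip: power_Suc)
    qed
    then show ?case using Suc cong_trans by (fastforce simp: mult.commute simp flip: power_mult)
  qed simp
  then show ?thesis by (simp add: T_def)
qed

lemma T_teich:
  assumes "n \<ge> 1" "\<not> p dvd j"
  shows "teich n (T n j)"
proof -
  have "coprime p j" using assms(2) p_prime by (rule prime_imp_coprime[rotated])
  then have "coprime (p ^ n) j" by simp
  then have "coprime j (p ^ n)" by (rule coprime_commute[THEN iffD1])
  then have "[j ^ totient (p ^ n) = 1] (mod p ^ n)" by (rule euler_theorem)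
  moreover have "totient (p ^ n) = p ^ (n - 1) * (p - 1)"
    using assms p_prime by (simp add: totient_prime_power)
  ultimately show ?thesis by (simp add: teich_def T_def flip: power_mult)
qed

text \<open>As p - 1 divides p^(n - 1) - 1, raising to the power p^(n - 1) fixes s modulo p^n. The
  same power lifts the congruence of s and j from modulus p to p^n.\<close>

lemma teich_eq_T:
  assumes n: "n \<ge> 1" and s: "teich n s" and j: "[s = j] (mod p)"
  shows "[s = T n j] (mod p ^ n)"
proof -
  have "[1 + (p - 1) = 1] (mod (p - 1))" by (simp only: cong_def mod_add_self2)
  then have "[p = 1] (mod (p - 1))" using p3 by simp
  from cong_pow[OF this, of "n - 1"] have "[p ^ (n - 1) = 1] (mod (p - 1))" by simp
  then have "p - 1 dvd p ^ (n - 1) - 1" by (rule cong_to_1_nat)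
  then obtain d where "p ^ (n - 1) - 1 = (p - 1) * d" by (elim dvdE)
  moreover have "p ^ (n - 1) > 0" using p3 by simp
  ultimately have d: "p ^ (n - 1) = Suc ((p - 1) * d)" by linarith
  have "[(s ^ (p - 1)) ^ d = 1 ^ d] (mod p ^ n)" using s cong_pow unfolding teich_def by blast
  from cong_scalar_left[OF this, of s] have "[T n s = s] (mod p ^ n)"
    unfolding T_def d by (simp add: power_mult)
  moreover have "[T n s = T n j] (mod p ^ n)"
    using cong_power_p_power_lift[OF j, of "n - 1"] n by (simp add: T_def)
  ultimately show ?thesis using cong_sym cong_trans by blast
qed

lemma T_eq_iff:
  assumes n: "n \<ge> 1" and "j \<in> {1..p - 1}" "k \<in> {1..p - 1}" "[T n j = T n k] (mod p ^ n)"
  shows "j = k"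
proof -
  have "[j = k] (mod p)" using cong_p[OF n assms(4)] T_cong_p cong_sym cong_trans by meson
  then show ?thesis using assms(2,3) by (auto simp: cong_def)
qed

lemma not_dvd_small: "j \<in> {1..p - 1} \<Longrightarrow> \<not> p dvd j"
  using p3 by (auto dest: dvd_imp_le)

lemma teich_auts:
  assumes n: "n \<ge> 1"
  shows "aut n ` {s. teich n s} = (\<lambda>j. aut n (T n j)) ` {1..p - 1}"
proof (intro equalityI subsetI)
  fix \<sigma> assume "\<sigma> \<in> aut n ` {s. teich n s}"
  then obtain s where s: "teich n s" "\<sigma> = aut n s" by auto
  have nd: "\<not> p dvd s" by (rule teich_not_dvd[OF n s(1)])
  have j: "s mod p \<in> {1..p - 1}" using nd p3 by (auto simp: dvd_eq_mod_eq_0 Suc_le_eq less_Suc_eq_le[symmetric])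
  have "[s = T n (s mod p)] (mod p ^ n)" by (rule teich_eq_T[OF n s(1)]) (simp add: cong_def)
  then have "\<sigma> = aut n (T n (s mod p))"
    using s(2) sig_cong[OF n] by (auto simp: aut_def)
  then show "\<sigma> \<in> (\<lambda>j. aut n (T n j)) ` {1..p - 1}" using j by blast
qed (use T_teich[OF n] not_dvd_small in auto)

text \<open>The Teichmuller automorphisms are exactly the elements whose (p - 1)-st power is
  trivial, and there are p - 1 of them. A subgroup of order p - 1 lies among them and so fills them
  out, which is the uniqueness behind \<open>THE\<close>.\<close>

lemma cyclo_subgroup_eq:
  assumes n: "n \<ge> 1"
  shows "cyclo_subgroup p \<zeta> n = (\<lambda>j. aut n (T n j)) ` {1..p - 1}"
proof -
  interpret G: group "Gal n" by (rule group_Gal[OF n])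
  let ?C = "aut n ` {s. teich n s}"
  have sub: "?C \<subseteq> carrier (Gal n)" using teich_not_dvd[OF n] by (auto simp: carrier_Gal[OF n])
  have inj: "inj_on (\<lambda>j. aut n (T n j)) {1..p - 1}"
    using T_eq_iff[OF n] aut_eq_iff[OF n] teich_not_dvd[OF n T_teich[OF n not_dvd_small]]
    by (auto intro!: inj_onI)
  then have card: "card ?C = p - 1" unfolding teich_auts[OF n] by (simp add: card_image)
  have C: "?C = {\<sigma> \<in> carrier (Gal n). \<sigma> [^]\<^bsub>Gal n\<^esub> (p - 1) = \<one>\<^bsub>Gal n\<^esub>}" (is "_ = ?D")
  proof (intro equalityI subsetI)
    fix \<sigma> assume "\<sigma> \<in> ?C"
    then show "\<sigma> \<in> ?D"
      using sub teich_not_dvd[OF n] not_dvd_power not_dvd_1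
      by (auto simp: Gal_pow[OF n] Gal_one[OF n] aut_eq_iff[OF n] teich_def)
  next
    fix \<sigma> assume "\<sigma> \<in> ?D"
    then obtain s where s: "\<not> p dvd s" "\<sigma> = aut n s" "\<sigma> [^]\<^bsub>Gal n\<^esub> (p - 1) = \<one>\<^bsub>Gal n\<^esub>"
      by (auto simp: carrier_Gal[OF n])
    then have "teich n s"
      using not_dvd_power[OF s(1)] not_dvd_1
      by (simp add: Gal_pow[OF n] Gal_one[OF n] aut_eq_iff[OF n] teich_def)
    then show "\<sigma> \<in> ?C" using s by blast
  qed
  have comm: "comm_group (Gal n)"
    by (rule G.group_comm_groupI)
      (auto simp: carrier_Gal[OF n] Gal_mult[OF n] mult.commute)
  have subgroup: "subgroup ?C (Gal n)"
  proof (rule G.subgroupI[OF sub])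
    show "?C \<noteq> {}" using card p3 by force
    show "inv\<^bsub>Gal n\<^esub> \<sigma> \<in> ?C" if "\<sigma> \<in> ?C" for \<sigma>
      using that unfolding C by (auto simp: G.nat_pow_inv)
    show "\<sigma> \<otimes>\<^bsub>Gal n\<^esub> \<tau> \<in> ?C" if "\<sigma> \<in> ?C" "\<tau> \<in> ?C" for \<sigma> \<tau>
      using that unfolding C by (auto simp: comm_monoid.nat_pow_distrib[OF comm_group.axioms(1)[OF comm]])
  qed
  have "cyclo_subgroup p \<zeta> n = ?C"
    unfolding cyclo_subgroup_def cyclo_field_eq[OF n]
  proof (rule the_equality)
    show "subgroup ?C (Gal n) \<and> card ?C = p - 1" using subgroup card by blast
    fix H assume H: "subgroup H (Gal n) \<and> card H = p - 1"
    then interpret H: group "(Gal n)\<lparr>carrier := H\<rparr>" using G.subgroup_imp_group by blast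
    have "H \<subseteq> ?C"
    proof
      fix \<sigma> assume \<sigma>: "\<sigma> \<in> H"
      have "\<sigma> [^]\<^bsub>(Gal n)\<lparr>carrier := H\<rparr>\<^esub> (p - 1) = \<one>\<^bsub>Gal n\<^esub>"
        using H.pow_order_eq_1[of \<sigma>] \<sigma> H unfolding Coset.order_def by simp
      then have "\<sigma> [^]\<^bsub>Gal n\<^esub> (p - 1) = \<one>\<^bsub>Gal n\<^esub>"
        by (simp add: G.nat_pow_consistent[symmetric])
      then show "\<sigma> \<in> ?C" unfolding C using \<sigma> H subgroup.subset by blast
    qed
    moreover have "finite ?C" unfolding teich_auts[OF n] by simp
    ultimately show "H = ?C" using H card by (metis card_subset_eq)
  qed
  then show ?thesis using teich_auts[OF n] by simp
qed

section \<open>The fixed fields\<close>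

abbreviation E :: "nat \<Rightarrow> 'a set" where "E n \<equiv> E_field p \<zeta> n"

lemma E_eq:
  assumes n: "n \<ge> 1"
  shows "E n = {y \<in> cyc n. \<forall>s. teich n s \<longrightarrow> sig n s y = y}"
proof -
  have "E n = {y \<in> cyc n. \<forall>\<sigma>\<in>aut n ` {s. teich n s}. \<sigma> y = y}"
    unfolding E_field_def cyclo_field_eq[OF n] cyclo_subgroup_eq[OF n] teich_auts[OF n] ..
  then show ?thesis by (auto simp: aut_def)
qed

lemma E_cyc: "n \<ge> 1 \<Longrightarrow> y \<in> E n \<Longrightarrow> y \<in> cyc n"
  by (simp add: E_eq)

lemma is_subring_E:
  assumes n: "n \<ge> 1"
  shows "is_subring (E n)"
  using teich_not_dvd[OF n]
  by (auto simp: is_subring_def E_eq[OF n] cyc_closed sig_1[OF n] sig_diff[OF n] sig_mult[OF n])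

lemma E_rat: "n \<ge> 1 \<Longrightarrow> of_rat q \<in> E n"
  using teich_not_dvd by (auto simp: E_eq cyc_closed sig_of_rat)

lemma E_inverse:
  assumes n: "n \<ge> 1" and y: "y \<in> E n"
  shows "inverse y \<in> E n"
proof (cases "y = 0")
  case False
  have "sig n s (inverse y) = inverse y" if s: "teich n s" for s
  proof -
    have nd: "\<not> p dvd s" by (rule teich_not_dvd[OF n s])
    have "sig n s (y * inverse y) = sig n s y * sig n s (inverse y)"
      using y by (intro sig_mult[OF n nd] cyc_inverse[OF n]) (auto simp: E_eq[OF n])
    moreover have "sig n s y = y" using y s by (auto simp: E_eq[OF n])
    ultimately have "y * sig n s (inverse y) = 1" using False sig_1[OF n nd] by simp
    then show ?thesis by (metis inverse_unique)
  qed
  then show ?thesis using y cyc_inverse[OF n] by (auto simp: E_eq[OF n])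
qed (use y in simp)

lemma subfield_E: "n \<ge> 1 \<Longrightarrow> subfield (E n) ring_of_type_algebra"
  by (intro subfieldI_type is_subring_E E_inverse)

end

section \<open>Minimal polynomials\<close>

lemma nat_pow_type: "(x :: 'a::field_char_0) [^]\<^bsub>ring_of_type_algebra\<^esub> (n :: nat) = x ^ n"
proof -
  interpret R: ring "ring_of_type_algebra :: 'a ring" by (rule type_ring)
  show ?thesis by (induction n) (simp_all add: mult.commute)
qed

lemma eval_type: "ring.eval ring_of_type_algebra q (x :: 'a::field_char_0) = poly (Poly (rev q)) x"
proof -
  interpret R: ring "ring_of_type_algebra :: 'a ring" by (rule type_ring)
  show ?thesis
  proof (induction q)
    case (Cons a q)
    have "Poly (rev q @ [a]) = Poly (rev q) + Polynomial.monom a (length q)"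
      by (simp add: poly_eq_iff nth_default_append) (auto simp: nth_default_def less_Suc_eq)
    then show ?case using Cons by (simp add: nat_pow_type poly_monom)
  qed simp
qed

text \<open>\<open>Irr\<close> divides Q, so its degree is at most that of Q, and equal by
  minimality. The difference of the two monic polynomials vanishes at x and has smaller degree, so
  it is 0.\<close>

lemma min_poly_eqI:
  fixes K :: "'a::field_char_0 set"
  assumes K: "subfield K ring_of_type_algebra"
    and Q: "\<And>k. Polynomial.coeff Q k \<in> K" "Polynomial.lead_coeff Q = 1" "poly Q x = 0"
    and min: "\<And>f. (\<And>k. Polynomial.coeff f k \<in> K) \<Longrightarrow> poly f x = 0 \<Longrightarrow> f \<noteq> 0 \<Longrightarrow>
      Polynomial.degree Q \<le> Polynomial.degree f"
  shows "min_poly K x = Q"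
proof -
  let ?R = "ring_of_type_algebra :: 'a ring"
  interpret F: Ring.field ?R by (rule type_field)
  have sub: "subring K ?R" using K by (rule subfieldE(1))
  have K0: "0 \<in> K" "\<And>a b. a \<in> K \<Longrightarrow> b \<in> K \<Longrightarrow> a - b \<in> K"
  proof -
    show "0 \<in> K" using subringE(2)[OF sub] by simp
    show "a - b \<in> K" if "a \<in> K" "b \<in> K" for a b
      using subringE(7)[OF sub that(1) subringE(5)[OF sub that(2)]] by simp
  qed
  define q where "q = rev (coeffs Q)"
  have Q0: "Q \<noteq> 0" using Q(2) by auto
  have q: "q \<in> carrier (univ_poly ?R K)" "q \<noteq> []" "ring.eval ?R q x = 0"
  proof -
    show "q \<noteq> []" using Q0 by (simp add: q_def)
    have "set q \<subseteq> K" using Q(1) K0(1) by (auto simp: q_def coeffs_def)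
    moreover have "hd q \<noteq> 0" using Q0 by (simp add: q_def hd_rev last_coeffs_eq_coeff_degree)
    ultimately show "q \<in> carrier (univ_poly ?R K)"
      by (simp add: univ_poly_carrier[symmetric] polynomial_def)
    show "ring.eval ?R q x = 0" using Q(3) by (simp add: eval_type q_def)
  qed
  have alg: "(F.algebraic over K) x" unfolding over_def
    using F.algebraicI[OF q(1,2)] q(3) unfolding over_def by simp
  define g where "g = F.Irr K x"
  have xc: "x \<in> carrier ?R" by simp
  have g: "g \<in> carrier (univ_poly ?R K)" "hd g = 1" "poly (Poly (rev g)) x = 0"
    using F.IrrE[OF K xc alg] by (simp_all add: g_def eval_type)
  have "g pdivides\<^bsub>?R\<^esub> q"
    unfolding g_def by (rule F.Irr_minimal[OF K xc alg q(1)]) (use q in simp)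
  then have "length g - 1 \<le> length q - 1"
    by (rule F.pdivides_imp_degree_le[OF sub g(1) q(1,2)])
  moreover have "length q - 1 = Polynomial.degree Q" using Q0 by (simp add: q_def length_coeffs)
  ultimately have len: "length g - 1 \<le> Polynomial.degree Q" by simp
  let ?G = "Poly (rev g)"
  have g0: "g \<noteq> []"
  proof
    assume "g = []"
    then have "\<not> pirreducible\<^bsub>?R\<^esub> K g"
      using F.IrrE(2)[OF K xc alg] by (auto simp: g_def ring_irreducible_def univ_poly_zero)
    then show False using F.IrrE(2)[OF K xc alg] by (simp add: g_def)
  qed
  have Gc: "Polynomial.coeff ?G k = (if k < length g then rev g ! k else 0)" for k
    by (simp add: nth_default_def)
  have "set g \<subseteq> K" using g(1) by (auto simp: univ_poly_carrier[symmetric] polynomial_def)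
  then have GK: "Polynomial.coeff ?G k \<in> K" for k
    unfolding Gc using K0(1) by (auto simp: rev_nth intro: subsetD)
  have G1: "Polynomial.coeff ?G (length g - 1) = 1"
    unfolding Gc using g0 g(2) by (simp add: rev_nth hd_conv_nth)
  have G0: "?G \<noteq> 0" using G1 by (metis Polynomial.coeff_0 zero_neq_one)
  have "Polynomial.degree ?G \<le> length g - 1"
    using g0 by (intro degree_le) (auto simp: Gc simp del: coeff_Poly_eq)
  moreover have "Polynomial.degree Q \<le> Polynomial.degree ?G"
    by (rule min[OF GK g(3) G0])
  ultimately have deg: "Polynomial.degree ?G = Polynomial.degree Q" "length g - 1 = Polynomial.degree Q"
    using len by auto
  have "?G - Q = 0"
  proof (rule ccontr)
    assume ne: "?G - Q \<noteq> 0"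
    have "Polynomial.degree Q \<le> Polynomial.degree (?G - Q)"
      by (rule min) (use GK Q g(3) ne K0 in auto)
    moreover have "Polynomial.degree (?G - Q) \<le> Polynomial.degree Q"
      using deg by (intro degree_diff_le) auto
    moreover have "Polynomial.coeff (?G - Q) (Polynomial.degree Q) = 0"
      using G1 deg Q(2) by (simp del: coeff_Poly_eq)
    ultimately show False using ne by (metis leading_coeff_0_iff antisym)
  qed
  then show ?thesis by (simp add: min_poly_def g_def)
qed

context cyclotomic_tower
begin

section \<open>Norms\<close>

text \<open>For \<open>a\<close> prime to \<open>p\<close> these are the conjugates of \<open>pi_elem p \<zeta> n\<close>, and for \<open>a\<close> a power
  of \<open>p\<close> the elements \<open>pi_elem p \<zeta> m\<close> of the lower levels.\<close>

definition NN :: "nat \<Rightarrow> nat \<Rightarrow> 'a" where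
  "NN n a = (\<Prod>j\<in>{1..p - 1}. \<zeta> n ^ (a * T n j) - 1)"

abbreviation pi :: "nat \<Rightarrow> 'a" where "pi n \<equiv> pi_elem p \<zeta> n"

lemma pi_eq_NN: "pi n = NN n 1"
  by (simp add: pi_elem_def NN_def T_def)

lemma NN_cyc: "NN n a \<in> cyc n"
  unfolding NN_def by (intro cyc_prod cyc_closed)

lemma sig_NN:
  assumes n: "n \<ge> 1" and s: "\<not> p dvd s"
  shows "sig n s (NN n a) = NN n (s * a)"
proof -
  have "sig n s (NN n a) = (\<Prod>j\<in>{1..p - 1}. sig n s (\<zeta> n ^ (a * T n j) - 1))"
    unfolding NN_def by (intro sig_prod[OF n s] cyc_closed)
  also have "\<dots> = NN n (s * a)" unfolding NN_def
  proof (rule prod.cong)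
    fix j
    have "sig n s (\<zeta> n ^ (a * T n j) - 1) = sig n s (\<zeta> n ^ (a * T n j)) - sig n s 1"
      by (intro sig_diff[OF n s] cyc_closed)
    also have "\<dots> = (\<zeta> n ^ s) ^ (a * T n j) - 1"
      using sig_power[OF n s cyc_zeta] by (simp add: sig_1[OF n s] sig_zeta[OF n s])
    finally show "sig n s (\<zeta> n ^ (a * T n j) - 1) = \<zeta> n ^ (s * a * T n j) - 1"
      by (simp add: mult.assoc flip: power_mult)
  qed simp
  finally show ?thesis .
qed

text \<open>Multiplication by t permutes the nonzero residues modulo p, hence the Teichmuller
  exponents modulo p^n and the factors of the product.\<close>

lemma NN_teich:
  assumes n: "n \<ge> 1" and t: "teich n t"
  shows "NN n (t * a) = NN n a"
proof -
  let ?J = "{1..p - 1}" and ?\<pi> = "\<lambda>j. (t * j) mod p"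
  have nd: "\<not> p dvd t" by (rule teich_not_dvd[OF n t])
  have into: "?\<pi> j \<in> ?J" if "j \<in> ?J" for j
  proof -
    have "\<not> p dvd t * j" using not_dvd_mult[OF nd not_dvd_small[OF that]] .
    then have "t * j mod p \<noteq> 0" by (simp add: dvd_eq_mod_eq_0)
    moreover have "t * j mod p < p" using p3 by simp
    ultimately show ?thesis by simp
  qed
  have inj: "inj_on ?\<pi> ?J"
  proof (rule inj_onI)
    fix j k assume jk: "j \<in> ?J" "k \<in> ?J" "?\<pi> j = ?\<pi> k"
    have "coprime p t" using nd p_prime by (rule prime_imp_coprime[rotated])
    then have "coprime t p" by (rule coprime_commute[THEN iffD1])
    moreover have "[t * j = t * k] (mod p)" using jk(3) by (simp add: cong_def)
    ultimately have "[j = k] (mod p)" using cong_mult_lcancel_nat by blast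
    then show "j = k" using jk by (auto simp: cong_def)
  qed
  have "?\<pi> ` ?J = ?J" by (rule endo_inj_surj[OF _ _ inj]) (use into in auto)
  then have bij: "bij_betw ?\<pi> ?J ?J" using inj by (simp only: bij_betw_def)
  have T: "[t * T n j = T n (?\<pi> j)] (mod p ^ n)" if "j \<in> ?J" for j
  proof (rule teich_eq_T[OF n])
    have "[t ^ (p - 1) * T n j ^ (p - 1) = 1 * 1] (mod p ^ n)"
      using t T_teich[OF n not_dvd_small[OF that]] unfolding teich_def by (rule cong_mult)
    then show "teich n (t * T n j)" by (simp add: teich_def power_mult_distrib)
    show "[t * T n j = ?\<pi> j] (mod p)"
      using cong_scalar_left[OF T_cong_p[of n j], of t] by (simp add: cong_def)
  qed
  have "NN n (t * a) = (\<Prod>j\<in>?J. \<zeta> n ^ (a * T n (?\<pi> j)) - 1)"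
    unfolding NN_def
  proof (rule prod.cong)
    fix j assume j: "j \<in> ?J"
    have "[t * a * T n j = a * T n (?\<pi> j)] (mod p ^ n)"
      using cong_scalar_left[OF T[OF j], of a] by (simp add: mult_ac)
    then show "\<zeta> n ^ (t * a * T n j) - 1 = \<zeta> n ^ (a * T n (?\<pi> j)) - 1"
      using zeta_power_eq_iff[OF n] by simp
  qed simp
  also have "\<dots> = NN n a"
    unfolding NN_def by (rule prod.reindex_bij_betw[OF bij])
  finally show ?thesis .
qed

lemma NN_E: "n \<ge> 1 \<Longrightarrow> NN n a \<in> E n"
  using teich_not_dvd NN_teich sig_NN by (auto simp: E_eq NN_cyc)

text \<open>The exponents \<open>T (m + i) j\<close> are Teichmuller modulo p^m too, hence congruent
  to \<open>T m j\<close>, and \<open>\<zeta> m\<close> is the p^i-th power of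
  \<open>\<zeta> (m + i)\<close>.\<close>

lemma pi_lower:
  assumes m: "m \<ge> 1"
  shows "pi m = NN (m + i) (p ^ i)"
  unfolding pi_eq_NN NN_def
proof (rule prod.cong)
  fix j assume j: "j \<in> {1..p - 1}"
  have n: "m + i \<ge> 1" using m by simp
  have "teich (m + i) (T (m + i) j)" by (rule T_teich[OF n not_dvd_small[OF j]])
  then have "teich m (T (m + i) j)" unfolding teich_def
    by (rule cong_dvd_modulus_nat) (simp add: le_imp_power_dvd)
  then have "[T (m + i) j = T m j] (mod p ^ m)" by (rule teich_eq_T[OF m _ T_cong_p])
  then have "\<zeta> m ^ T (m + i) j = \<zeta> m ^ T m j" using zeta_power_eq_iff[OF m] by simp
  then show "\<zeta> m ^ (1 * T m j) - 1 = \<zeta> (m + i) ^ (p ^ i * T (m + i) j) - 1"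
    by (simp add: power_mult zeta_power_p_power[OF m])
qed simp

lemma pi_1: "pi 1 = of_nat p"
proof -
  have "primitive_root_of_unity p (\<zeta> 1)" using primitive_zeta[of 1] by simp
  from prod_one_minus_primitive_roots[OF this]
  have "of_nat p = (\<Prod>k\<in>{1..<p}. 1 - \<zeta> 1 ^ k)" using p3 by simp
  also have "{1..<p} = {1..p - 1}" using p3 by auto
  also have "(\<Prod>k\<in>{1..p - 1}. 1 - \<zeta> 1 ^ k) = (\<Prod>k\<in>{1..p - 1}. (- 1) * (\<zeta> 1 ^ k - 1))"
    by simp
  also have "\<dots> = (- 1) ^ (p - 1) * pi 1"
    unfolding prod.distrib by (simp add: pi_elem_def)
  finally show ?thesis using p_odd by simp
qed

lemma pi_E: "1 \<le> m \<Longrightarrow> m \<le> n \<Longrightarrow> pi m \<in> E n"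
  using pi_lower[of m "n - m"] NN_E[of n] by simp

lemma cyc_mono:
  assumes "1 \<le> m" "y \<in> cyc m"
  shows "y \<in> cyc (m + i)"
proof -
  obtain f where "y = ev f (\<zeta> m)" using assms by (auto simp: cyc_def)
  then have "y = ev (pcompose f (Polynomial.monom 1 (p ^ i))) (\<zeta> (m + i))"
    using zeta_power_p_power[OF assms(1)] by simp
  then show ?thesis using cyc_ev by metis
qed

lemma zeta_power_commute: "m \<ge> 1 \<Longrightarrow> (\<zeta> (m + i) ^ s) ^ (p ^ i) = \<zeta> m ^ s"
  by (metis mult.commute power_mult zeta_power_p_power)

lemma sig_fixes_cyc:
  assumes m: "1 \<le> m" and y: "y \<in> cyc m" and s: "\<not> p dvd s" "[s = 1] (mod p ^ m)"
  shows "sig (m + i) s y = y"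
proof -
  have n: "m + i \<ge> 1" using m by simp
  obtain f where f: "y = ev f (\<zeta> m)" using y by (auto simp: cyc_def)
  define g where "g = pcompose f (Polynomial.monom 1 (p ^ i))"
  have g: "y = ev g (\<zeta> (m + i))" using zeta_power_p_power[OF m] by (simp add: f g_def)
  then have "sig (m + i) s y = ev g (\<zeta> (m + i) ^ s)" using sig_ev[OF n s(1)] by simp
  also have "\<dots> = ev f (\<zeta> m ^ s)"
    using zeta_power_commute[OF m] by (simp add: g_def)
  also have "\<zeta> m ^ s = \<zeta> m ^ 1" using zeta_power_eq_iff[OF m] s(2) by blast
  finally show ?thesis by (simp add: f)
qed

text \<open>The Teichmuller conjugations fix the coefficients, so the polynomial of the relation, of
  degree below p - 1, vanishes at the p - 1 distinct elements
  \<open>\<zeta> n ^ T n j - 1\<close>.\<close>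

lemma E_independent:
  assumes n: "n \<ge> 1" and c: "\<And>l. l < p - 1 \<Longrightarrow> c l \<in> E n"
    and 0: "(\<Sum>l<p - 1. c l * (\<zeta> n - 1) ^ l) = 0"
  shows "\<forall>l<p - 1. c l = 0"
proof -
  define f where "f = (\<Sum>l<p - 1. Polynomial.monom (c l) l)"
  have coeff: "Polynomial.coeff f l = c l" if "l < p - 1" for l
    using that by (simp add: f_def coeff_sum)
  have deg: "Polynomial.degree f < p - 1" unfolding f_def using p3
    by (intro degree_sum_less) (auto intro: le_less_trans[OF degree_monom_le])
  have roots: "poly f (\<zeta> n ^ T n j - 1) = 0" if j: "j \<in> {1..p - 1}" for j
  proof -
    let ?s = "T n j"
    have t: "teich n ?s" by (rule T_teich[OF n not_dvd_small[OF j]])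
    have nd: "\<not> p dvd ?s" by (rule teich_not_dvd[OF n t])
    have cc: "c l \<in> cyc n" "sig n ?s (c l) = c l" if "l < p - 1" for l
      using c[OF that] t by (auto simp: E_eq[OF n])
    have "sig n ?s (\<Sum>l<p - 1. c l * (\<zeta> n - 1) ^ l) = (\<Sum>l<p - 1. sig n ?s (c l * (\<zeta> n - 1) ^ l))"
      by (intro sig_sum[OF n nd] cyc_closed cc) simp
    also have "\<dots> = (\<Sum>l<p - 1. c l * (\<zeta> n ^ ?s - 1) ^ l)"
    proof (rule sum.cong)
      fix l assume "l \<in> {..<p - 1}"
      then have l: "l < p - 1" by simp
      have "sig n ?s (\<zeta> n - 1) = \<zeta> n ^ ?s - 1"
        using sig_diff[OF n nd cyc_zeta cyc_1] by (simp add: sig_zeta[OF n nd] sig_1[OF n nd])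
      moreover have "sig n ?s (c l * (\<zeta> n - 1) ^ l) = sig n ?s (c l) * sig n ?s (\<zeta> n - 1) ^ l"
        using sig_mult[OF n nd cc(1)[OF l], of "(\<zeta> n - 1) ^ l"]
          sig_power[OF n nd, of "\<zeta> n - 1" l] by (simp add: cyc_closed)
      ultimately show "sig n ?s (c l * (\<zeta> n - 1) ^ l) = c l * (\<zeta> n ^ ?s - 1) ^ l"
        using cc(2)[OF l] by simp
    qed simp
    finally show ?thesis using 0 by (simp add: sig_0[OF n nd] f_def poly_sum poly_monom)
  qed
  have "f = 0"
  proof (rule ccontr)
    assume f: "f \<noteq> 0"
    have "inj_on (\<lambda>j. \<zeta> n ^ T n j - 1) {1..p - 1}"
      using T_eq_iff[OF n] by (auto intro!: inj_onI simp: zeta_power_eq_iff[OF n])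
    then have "card ((\<lambda>j. \<zeta> n ^ T n j - 1) ` {1..p - 1}) = p - 1" by (simp add: card_image)
    moreover have "card ((\<lambda>j. \<zeta> n ^ T n j - 1) ` {1..p - 1}) \<le> card {z. poly f z = 0}"
      using roots by (intro card_mono poly_roots_finite[OF f]) auto
    ultimately show False using card_poly_roots_bound[OF f] deg by linarith
  qed
  then show ?thesis using coeff by auto
qed

end

section \<open>Values of norms and bases of the fixed fields\<close>

context cyclotomic_level
begin

lemma U_NN:
  assumes n: "n \<ge> 1" "n \<le> N" and a: "\<not> p dvd a"
  shows "U (int ((p - 1) * p ^ (N - n))) (NN n a)"
proof -
  have "U (\<Sum>j\<in>{1..p - 1}. int (p ^ (N - n))) (NN n a)" unfolding NN_def
    using n a not_dvd_mult[OF a] teich_not_dvd[OF n(1) T_teich[OF n(1) not_dvd_small]]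
    by (intro U_prod U_zeta_diff_power) auto
  then show ?thesis by simp
qed

lemma U_pi: "n \<ge> 1 \<Longrightarrow> n \<le> N \<Longrightarrow> U (int ((p - 1) * p ^ (N - n))) (pi n)"
  unfolding pi_eq_NN by (rule U_NN) (use not_dvd_1 in auto)

text \<open>The products \<open>(\<zeta> N - 1) ^ l * (pi N ^ j * pi m ^ k)\<close> have the values
  l + (p - 1) (j + p^i k), which take each of 0, ..., \<open>phi N - 1\<close> once; so they form a
  rational basis of the cyclotomic field. Grouped by l this is an expansion over \<open>E N\<close>,
  in which an element of \<open>E N\<close> has only l = 0.\<close>

lemma E_span_level:
  assumes m: "m \<ge> 1" and N: "N = m + i" and y: "y \<in> E N"
  shows "\<exists>r. y = (\<Sum>(j, k)\<in>{..<p ^ i} \<times> {..<p ^ (m - 1)}. of_rat (r j k) * (pi N ^ j * pi m ^ k))"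
proof -
  have N1: "N \<ge> 1" using m N by simp
  define J where "J = {..<p ^ i} \<times> {..<p ^ (m - 1)}"
  define I where "I = {..<p - 1} \<times> J"
  define b where "b = (\<lambda>(l, j, k). (\<zeta> N - 1) ^ l * (pi N ^ j * pi m ^ k))"
  define e where "e = (\<lambda>(l, j, k). l + (p - 1) * (j + p ^ i * k))"
  have "N - 1 = i + (m - 1)" using m N by simp
  then have phi: "phi N = (p - 1) * (p ^ i * p ^ (m - 1))"
    by (simp only: phi_def power_add)
  have finI: "finite I" by (simp add: I_def J_def)
  have cardI: "card I = phi N" by (simp add: I_def J_def card_cartesian_product phi)
  have Ub: "U (int (e z)) (b z)" for z
  proof -
    obtain l j k where z: "z = (l, j, k)" by (cases z)
    have "U (int l * 1 + (int j * int ((p - 1) * p ^ (N - N)) + int k * int ((p - 1) * p ^ (N - m)))) (b z)"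
      unfolding z b_def prod.case using m N N1 by (intro U_mult U_power U_x U_pi) auto
    moreover define q where "q = p - 1"
    ultimately show ?thesis using N unfolding z e_def prod.case q_def[symmetric] by (simp add: algebra_simps)
  qed
  have e_less: "e z < phi N" if "z \<in> I" for z
  proof -
    obtain l j k where z: "z = (l, j, k)" by (cases z)
    have ljk: "l < p - 1" "j < p ^ i" "k < p ^ (m - 1)" using that by (auto simp: I_def J_def z)
    have "j + p ^ i * k < p ^ i * Suc k" using ljk by simp
    also have "\<dots> \<le> p ^ i * p ^ (m - 1)" using ljk by (intro mult_le_mono) auto
    finally have "Suc (j + p ^ i * k) \<le> p ^ i * p ^ (m - 1)" by simp
    then have "(p - 1) * Suc (j + p ^ i * k) \<le> phi N" unfolding phi by (rule mult_le_mono2)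
    then show ?thesis using ljk by (simp add: z e_def)
  qed
  have e_inj: "inj_on e I"
  proof (rule inj_onI)
    fix z z' assume zz: "z \<in> I" "z' \<in> I" "e z = e z'"
    obtain l j k where z: "z = (l, j, k)" by (cases z)
    obtain l' j' k' where z': "z' = (l', j', k')" by (cases z')
    have r: "l < p - 1" "j < p ^ i" "l' < p - 1" "j' < p ^ i"
      using zz by (auto simp: I_def J_def z z')
    have eq: "l + (p - 1) * (j + p ^ i * k) = l' + (p - 1) * (j' + p ^ i * k')"
      using zz by (simp add: e_def z z')
    from arg_cong[OF eq, of "\<lambda>u. u mod (p - 1)"] arg_cong[OF eq, of "\<lambda>u. u div (p - 1)"]
    have l: "l = l'" and eq2: "j + p ^ i * k = j' + p ^ i * k'" using r by simp_all
    from arg_cong[OF eq2, of "\<lambda>u. u mod p ^ i"] arg_cong[OF eq2, of "\<lambda>u. u div p ^ i"]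
    have j: "j = j'" using r by simp_all
    then have "p ^ i * k = p ^ i * k'" using eq2 by simp
    then have "k = k'" using p3 by simp
    then show "z = z'" using l j by (simp add: z z')
  qed
  have inj: "inj_on (\<lambda>z. int (e z) mod int (phi N)) I"
    using e_less e_inj by (auto simp: inj_on_def simp flip: of_nat_mod)
  have cyc: "b z \<in> cyc N" for z
    unfolding b_def using pi_E[of m N] pi_E[of N N] m N E_cyc[of N] N1
    by (auto split: prod.split intro!: cyc_closed)
  have "\<exists>r. y = (\<Sum>z\<in>I. of_rat (r z) * b z)"
  proof (rule rat_basis[where c = "\<lambda>k. \<zeta> N ^ k"])
    show "\<exists>r. b z = (\<Sum>k<card I. of_rat (r k) * \<zeta> N ^ k)" for z
      unfolding cardI by (rule cyc_span[OF N1 cyc])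
    show "\<exists>r. y = (\<Sum>k<card I. of_rat (r k) * \<zeta> N ^ k)"
      unfolding cardI by (rule cyc_span[OF N1 E_cyc[OF N1 y]])
    show "(\<Sum>z\<in>I. of_rat (r z) * b z) = 0 \<Longrightarrow> \<forall>z\<in>I. r z = 0" for r
      by (rule rat_combination_0[OF finI Ub inj])
  qed (rule finI)
  then obtain r where r: "y = (\<Sum>z\<in>I. of_rat (r z) * b z)" by blast
  define d where "d l = (\<Sum>(j, k)\<in>J. of_rat (r (l, j, k)) * (pi N ^ j * pi m ^ k))" for l
  have dE: "d l \<in> E N" for l
    unfolding d_def using pi_E[of m N] pi_E[of N N] m N N1 E_rat[OF N1]
    by (auto intro!: is_subring_sum is_subring_mult is_subring_power is_subring_E)
  have yd: "y = (\<Sum>l<p - 1. d l * (\<zeta> N - 1) ^ l)"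
    unfolding r I_def d_def b_def
    by (simp add: sum.cartesian_product' sum_distrib_right sum_distrib_left mult_ac case_prod_unfold)
  have p1: "0 < p - 1" using p3 by simp
  \<comment> \<open>Moving y into the coefficient at 0 turns the expansion into a relation over
    \<open>E N\<close>, so that \<open>E_independent\<close> yields y = d 0.\<close>
  define c where "c l = (if l = 0 then d 0 - y else d l)" for l
  have "\<forall>l<p - 1. c l = 0"
  proof (rule E_independent[OF N1])
    show "c l \<in> E N" for l using dE y is_subring_diff[OF is_subring_E[OF N1]] by (simp add: c_def)
    have "(\<Sum>l<p - 1. c l * (\<zeta> N - 1) ^ l) =
        (\<Sum>l<p - 1. d l * (\<zeta> N - 1) ^ l - (if l = 0 then y else 0))"
      by (intro sum.cong) (auto simp: c_def)
    also have "\<dots> = y - y" using p1 by (simp add: sum_subtractf) (simp add: yd)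
    finally show "(\<Sum>l<p - 1. c l * (\<zeta> N - 1) ^ l) = 0" by simp
  qed
  then have "c 0 = 0" using p1 by blast
  then have "y = d 0" by (simp add: c_def)
  then show ?thesis unfolding d_def J_def by (intro exI[of _ "\<lambda>j k. r (0, j, k)"])
qed

end

lemma poly_pderiv_times:
  "x * poly (pderiv f) x = (\<Sum>j\<le>Polynomial.degree f. of_nat j * Polynomial.coeff f j * (x :: 'a::field_char_0) ^ j)"
proof -
  have sum: "pderiv (sum g A) = (\<Sum>a\<in>A. pderiv (g a))" for g :: "nat \<Rightarrow> 'a poly" and A
    using Polynomial.higher_pderiv_sum[of 1 g A] by simp
  have "pderiv f = pderiv (\<Sum>j\<le>Polynomial.degree f. Polynomial.monom (Polynomial.coeff f j) j)"
    by (simp only: poly_as_sum_of_monoms)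
  also have "\<dots> = (\<Sum>j\<le>Polynomial.degree f. Polynomial.monom (of_nat j * Polynomial.coeff f j) (j - 1))"
    by (simp only: sum pderiv_monom)
  finally have "x * poly (pderiv f) x = x * (\<Sum>j\<le>Polynomial.degree f. of_nat j * Polynomial.coeff f j * x ^ (j - 1))"
    by (simp add: poly_sum poly_monom)
  also have "\<dots> = (\<Sum>j\<le>Polynomial.degree f. of_nat j * Polynomial.coeff f j * x ^ j)"
    unfolding sum_distrib_left
  proof (rule sum.cong)
    fix j show "x * (of_nat j * Polynomial.coeff f j * x ^ (j - 1)) = of_nat j * Polynomial.coeff f j * x ^ j"
      by (cases j) (simp_all add: mult_ac)
  qed simp
  finally show ?thesis .
qed

lemma simple_extension_sum:
  fixes x :: "'a::field_char_0"
  assumes "\<And>k. k < d \<Longrightarrow> c k \<in> K"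
  shows "(\<Sum>k<d. c k * x ^ k) \<in> ring.simple_extension ring_of_type_algebra K x"
  using assms
proof (induction d arbitrary: c)
  case 0
  show ?case using ring.simple_extension.zero[OF type_ring[where 'a='a]] by simp
next
  case (Suc d)
  have "(\<Sum>k<d. c (Suc k) * x ^ k) \<in> ring.simple_extension ring_of_type_algebra K x"
    using Suc by simp
  from ring.simple_extension.lin[OF type_ring this, of "c 0"] Suc.prems
  show ?case by (simp add: sum.lessThan_Suc_shift sum_distrib_left sum_distrib_right mult_ac add.commute del: sum.lessThan_Suc)
qed

section \<open>Values of differences of conjugates\<close>

context cyclotomic_level
begin

lemma D_zeta_diff:
  assumes n: "n \<ge> 1" "n \<le> N"
  shows "D (int (p ^ (N - n))) (\<zeta> n ^ b - 1)"
proof (cases "\<zeta> n = 1")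
  case False
  have "\<zeta> n ^ b - 1 = (\<zeta> n - 1) * ((\<zeta> n ^ (1 * b) - 1) / (\<zeta> n ^ 1 - 1))" using False by simp
  then show ?thesis using D_mult_V[OF U_D[OF U_zeta_diff[OF n]] zeta_diff_V[OF n(1)]] by metis
qed simp

lemma D_1_zeta_diff: "n \<ge> 1 \<Longrightarrow> n \<le> N \<Longrightarrow> D 1 (\<zeta> n ^ b - 1)"
  using D_zeta_diff D_mono p3 by (metis One_nat_def Suc_leI less_le_trans of_nat_1 of_nat_mono zero_less_numeral zero_less_power)

text \<open>If b = p^f d with d prime to p, then \<open>\<zeta> n ^ b\<close> is
  \<open>\<zeta> (n - f) ^ d\<close>, whose value is known.\<close>

lemma U_zeta_diff_ex:
  assumes n: "n \<ge> 1" "n \<le> N" and b: "\<zeta> n ^ b \<noteq> 1"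
  shows "\<exists>e. U e (\<zeta> n ^ b - 1)"
proof -
  have pb: "\<not> p ^ n dvd b" using b zeta_power_eq_1_iff[OF n(1)] by simp
  then have b0: "b \<noteq> 0" by (metis dvd_0_right)
  have "\<not> is_unit p" using p3 by simp
  then obtain d where d: "b = p ^ multiplicity p b * d" "\<not> p dvd d"
    using multiplicity_decompose'[OF b0] by blast
  let ?f = "multiplicity p b"
  have f: "?f < n"
  proof (rule ccontr)
    assume "\<not> ?f < n"
    then have "p ^ n dvd p ^ ?f" by (simp add: le_imp_power_dvd)
    then show False using pb d(1) by (metis dvd_mult2)
  qed
  have "\<zeta> n ^ b = \<zeta> (n - ?f) ^ d"
    using zeta_power_p_power[of "n - ?f" ?f] f by (subst d(1)) (simp add: power_mult)
  moreover have "U (int (p ^ (N - (n - ?f)))) (\<zeta> (n - ?f) ^ d - 1)"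
    using d f n by (intro U_zeta_diff_power) auto
  ultimately show ?thesis by (metis (no_types))
qed

lemma zeta_sum_cong:
  assumes n: "n \<ge> 1" "n \<le> N"
  shows "D 1 ((\<Sum>k<M. (\<zeta> n ^ b) ^ k) - of_nat M)"
proof -
  have "(\<Sum>k<M. (\<zeta> n ^ b) ^ k) - of_nat M = (\<Sum>k<M. \<zeta> n ^ (b * k) - 1)"
    by (simp add: sum_subtractf power_mult)
  also have "D 1 \<dots>" by (intro D_sum D_1_zeta_diff n)
  finally show ?thesis .
qed

lemma D_1_p: "D 1 (of_nat p)"
proof -
  have "1 \<le> int (phi N)" using phi_pos[of N] by linarith
  then show ?thesis using U_D[OF U_p] D_mono by blast
qed

lemma U_cong: "U k y \<Longrightarrow> D (k + 1) (z - y) \<Longrightarrow> U k z"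
  using U_add[of k y "z - y"] by simp

text \<open>The quotient of the \<open>j\<close>-th factors of the two norms is \<open>1 + r \<kappa>\<close> with
  \<open>\<kappa>\<close> congruent to \<open>1\<close>, so that the quotient of the norms is
  \<open>1 + r (p - 1)\<close> up to higher order.\<close>

lemma U_NN_diff:
  assumes n: "n \<ge> 1" "n \<le> N" and a: "\<not> p dvd a"
    and e: "U e (\<zeta> n ^ (p * c) - 1)"
  shows "U (e + int ((p - 2) * p ^ (N - n))) (NN n (a + p * c) - NN n a)"
proof -
  let ?q = "int (p ^ (N - n))" and ?J = "{1..p - 1}"
  let ?y = "\<zeta> n ^ (p * c) - 1" and ?x = "\<zeta> n ^ a - 1"
  define r where "r = ?y / ?x"
  have q1: "?q \<ge> 1" using p3 by simp
  have Ux: "U ?q ?x" by (rule U_zeta_diff_power[OF n a])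
  have x0: "?x \<noteq> 0" "?y \<noteq> 0" using U_nonzero Ux e by blast+
  have Ur: "U (e - ?q) r" unfolding r_def by (rule U_divide[OF e Ux])
  have n2: "n \<ge> 2"
  proof (rule ccontr)
    assume "\<not> n \<ge> 2"
    then have "n = 1" using n by simp
    then show False using x0 zeta_power_eq_1_iff[of 1 "p * c"] by simp
  qed
  \<comment> \<open>\<open>\<zeta> n ^ (p * c)\<close> belongs to level n - 1, so the value of
    \<open>?y\<close> is at least p times that of \<open>?x\<close>; this makes r small.\<close>
  have e_ge: "?q * int p \<le> e"
  proof (rule U_D_le[OF e])
    have "\<zeta> n ^ (p * c) = \<zeta> (n - 1) ^ c"
      using zeta_power_p_power[of "n - 1" 1] n2 by (simp add: power_mult)
    moreover have "p ^ (N - (n - 1)) = p ^ (N - n) * p"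
      using n n2 by (simp flip: power_Suc2 add: Suc_diff_le)
    ultimately show "D (?q * int p) ?y" using D_zeta_diff[of "n - 1" c] n n2 by simp
  qed
  have "?q * 2 \<le> ?q * int p" using p3 by (intro mult_left_mono) auto
  then have r1: "1 \<le> e - ?q" using e_ge q1 by linarith
  then have rV: "r \<in> V" using D_mono[OF U_D[OF Ur], of 0] by (simp add: D_0_iff)
  \<comment> \<open>Both geometric sums are congruent to \<open>T n j\<close>, because powers of
    \<open>\<zeta> n\<close> are congruent to 1. Hence \<open>G j / H j\<close>, and with it
    \<open>\<kappa> j\<close>, is congruent to 1.\<close>
  define G where "G j = (\<Sum>k<T n j. (\<zeta> n ^ (p * c)) ^ k)" for j
  define H where "H j = (\<Sum>k<T n j. (\<zeta> n ^ a) ^ k)" for j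
  define \<kappa> where "\<kappa> j = \<zeta> n ^ (a * T n j) * (G j / H j)" for j
  have zV: "\<zeta> n ^ b \<in> V" for b using zeta_V[OF n(1)] V_intros(8) by blast
  have fact: "\<zeta> n ^ ((a + p * c) * T n j) - 1 = (\<zeta> n ^ (a * T n j) - 1) * (1 + r * \<kappa> j)"
    and \<kappa>: "\<kappa> j \<in> V" "D 1 (\<kappa> j - 1)" if j: "j \<in> ?J" for j
  proof -
    have nd: "\<not> p dvd T n j" using teich_not_dvd[OF n(1) T_teich[OF n(1) not_dvd_small[OF j]]] .
    have gh: "\<zeta> n ^ (p * c * T n j) - 1 = ?y * G j" "\<zeta> n ^ (a * T n j) - 1 = ?x * H j"
      using power_diff_1_eq[of "\<zeta> n ^ (p * c)" "T n j"] power_diff_1_eq[of "\<zeta> n ^ a" "T n j"]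
      by (simp_all add: G_def H_def flip: power_mult)
    have UH: "U 0 (H j)"
      by (rule U_cong[OF U_of_nat[OF nd]]) (use zeta_sum_cong[OF n] in \<open>simp add: H_def\<close>)
    have H0: "H j \<noteq> 0" using U_nonzero[OF UH] .
    have iH: "inverse (H j) \<in> V" using UH by (simp add: U_iff_unit)
    have gV: "G j \<in> V" unfolding G_def by (intro V_intros zV)
    show "\<kappa> j \<in> V" unfolding \<kappa>_def divide_inverse by (intro V_intros(4) zV gV iH)
    have "D 1 ((G j - of_nat (T n j)) - (H j - of_nat (T n j)))"
      unfolding G_def H_def by (intro D_diff zeta_sum_cong n)
    then have "D 1 ((G j - H j) * inverse (H j))" using D_mult_V iH by simp
    then have "D 1 ((G j - H j) * inverse (H j) * \<zeta> n ^ (a * T n j))" using D_mult_V zV by blast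
    then have "D 1 ((G j - H j) * inverse (H j) * \<zeta> n ^ (a * T n j) + (\<zeta> n ^ (a * T n j) - 1))"
      by (intro D_add D_1_zeta_diff n)
    moreover have "(G j - H j) * inverse (H j) * \<zeta> n ^ (a * T n j) + (\<zeta> n ^ (a * T n j) - 1) = \<kappa> j - 1"
      using H0 by (simp add: \<kappa>_def field_simps)
    ultimately show "D 1 (\<kappa> j - 1)" by simp
    have "(\<zeta> n ^ (a * T n j) - 1) * (r * \<kappa> j) = \<zeta> n ^ (a * T n j) * (?y * G j)"
      using H0 x0 unfolding gh(2) by (simp add: r_def \<kappa>_def field_simps)
    also have "\<dots> = \<zeta> n ^ (a * T n j) * (\<zeta> n ^ (p * c * T n j) - 1)" by (simp only: gh(1))
    also have "\<dots> = \<zeta> n ^ ((a + p * c) * T n j) - \<zeta> n ^ (a * T n j)"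
      by (simp add: algebra_simps power_add)
    finally show "\<zeta> n ^ ((a + p * c) * T n j) - 1 = (\<zeta> n ^ (a * T n j) - 1) * (1 + r * \<kappa> j)"
      by (simp add: ring_distribs)
  qed
  obtain s where s: "s \<in> V" "(\<Prod>j\<in>?J. 1 + r * \<kappa> j) = 1 + r * (\<Sum>j\<in>?J. \<kappa> j) + r\<^sup>2 * s"
    using prod_one_plus[of ?J r \<kappa>] rV \<kappa>(1) by blast
  have "NN n (a + p * c) = NN n a * (\<Prod>j\<in>?J. 1 + r * \<kappa> j)"
    unfolding NN_def prod.distrib[symmetric] by (intro prod.cong refl fact)
  then have diff: "NN n (a + p * c) - NN n a = NN n a * (r * ((\<Sum>j\<in>?J. \<kappa> j) + r * s))"
    unfolding s(2) by (simp add: algebra_simps power2_eq_square)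
  have "\<not> p dvd p - 1" using not_dvd_small[of "p - 1"] p3 by auto
  then have "U 0 (of_nat (p - 1))" by (rule U_of_nat)
  moreover have "D 1 ((\<Sum>j\<in>?J. \<kappa> j) + r * s - of_nat (p - 1))"
  proof -
    have "D 1 ((\<Sum>j\<in>?J. \<kappa> j - 1) + r * s)"
      by (intro D_add D_sum \<kappa> D_mult_V s D_mono[OF U_D[OF Ur]] r1)
    then show ?thesis by (simp add: sum_subtractf algebra_simps)
  qed
  ultimately have "U 0 ((\<Sum>j\<in>?J. \<kappa> j) + r * s)"
    using U_cong[of 0 "of_nat (p - 1)" "(\<Sum>j\<in>?J. \<kappa> j) + r * s"] by simp
  then have "U (int ((p - 1) * p ^ (N - n)) + (e - ?q + 0)) (NN n (a + p * c) - NN n a)"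
    unfolding diff by (intro U_mult U_NN[OF n a] Ur)
  \<comment> \<open>One of the p - 1 equal contributions to the value of the norm cancels against
    the denominator of r; this leaves p - 2.\<close>
  moreover have "(p - 1) * p ^ (N - n) = (p - 2) * p ^ (N - n) + p ^ (N - n)"
  proof -
    have "p - 1 = Suc (p - 2)" using p3 by simp
    then show ?thesis by simp
  qed
  ultimately show ?thesis by (simp add: algebra_simps)
qed

end

section \<open>Conjugates over E m and the minimal polynomial\<close>

context cyclotomic_tower
begin

text \<open>For k below p^i these exponents represent the Galois group of the (m + i)-th over the
  m-th cyclotomic field, which restricts isomorphically to that of \<open>E (m + i)\<close> over
  \<open>E m\<close>.\<close>

definition conj_exp :: "nat \<Rightarrow> nat \<Rightarrow> nat" where "conj_exp m k = 1 + p ^ m * k"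

lemma not_dvd_conj_exp: "m \<ge> 1 \<Longrightarrow> \<not> p dvd conj_exp m k"
proof -
  assume "m \<ge> 1"
  then have "p dvd p ^ m * k" by simp
  then show ?thesis using dvd_add_left_iff[of p "p ^ m * k" 1] not_dvd_1 by (simp add: conj_exp_def)
qed

text \<open>By \<open>U_NN_diff\<close> the difference of two of these conjugates has a value, so it
  is nonzero.\<close>

lemma NN_conj_inj:
  assumes m: "m \<ge> 1"
  shows "inj_on (\<lambda>k. NN (m + i) (conj_exp m k)) {..<p ^ i}"
proof -
  obtain V where "cyclotomic_level p \<zeta> V (m + i)" using exists_level[of "m + i"] m by auto
  then interpret cyclotomic_level p \<zeta> V "m + i" .
  have *: "NN (m + i) (conj_exp m k) \<noteq> NN (m + i) (conj_exp m l)" if kl: "k < l" "l < p ^ i" for k l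
  proof -
    let ?c = "p ^ (m - 1) * (l - k)"
    have pc: "p * ?c = p ^ m * (l - k)" using m by (cases m) simp_all
    have "\<not> p ^ i dvd l - k" using kl by (auto dest: dvd_imp_le)
    then have "\<zeta> (m + i) ^ (p * ?c) \<noteq> 1"
      using zeta_power_eq_1_iff[of "m + i" "p * ?c"] m p3 unfolding pc by (simp add: power_add)
    then obtain e where "U e (\<zeta> (m + i) ^ (p * ?c) - 1)" using U_zeta_diff_ex[of "m + i" "p * ?c"] m by auto
    then have "U (e + int ((p - 2) * p ^ (m + i - (m + i))))
        (NN (m + i) (conj_exp m k + p * ?c) - NN (m + i) (conj_exp m k))"
      using m not_dvd_conj_exp by (intro U_NN_diff) auto
    moreover have "p ^ m * k + p ^ m * (l - k) = p ^ m * l"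
      using kl by (simp flip: distrib_left)
    then have "conj_exp m k + p * ?c = conj_exp m l" unfolding pc by (simp add: conj_exp_def)
    ultimately show ?thesis using U_nonzero by force
  qed
  show ?thesis by (rule inj_onI, rule ccontr) (use * in \<open>metis lessThan_iff nat_neq_iff\<close>)
qed

definition mu :: "nat \<Rightarrow> nat \<Rightarrow> 'a poly" where
  "mu m i = (\<Prod>k<p ^ i. [:- NN (m + i) (conj_exp m k), 1:])"

abbreviation mu_coeff :: "nat \<Rightarrow> nat \<Rightarrow> nat \<Rightarrow> 'a" where
  "mu_coeff m i \<equiv> Polynomial.coeff (mu m i)"

lemma degree_mu: "Polynomial.degree (mu m i) = p ^ i"
  unfolding mu_def by (subst Polynomial.degree_prod_eq_sum_degree) auto

lemma lead_coeff_mu: "Polynomial.lead_coeff (mu m i) = 1"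
  unfolding mu_def by (subst Polynomial.lead_coeff_prod) simp

lemma coeff_mu_degree: "mu_coeff m i (p ^ i) = 1"
  using lead_coeff_mu[of m i] by (simp add: degree_mu)

lemma root_mu: "poly (mu m i) (pi (m + i)) = 0"
proof -
  have "0 \<in> {..<p ^ i}" using p3 by simp
  moreover have "poly [:- NN (m + i) (conj_exp m 0), 1:] (pi (m + i)) = 0"
    by (simp add: pi_eq_NN conj_exp_def)
  ultimately show ?thesis unfolding mu_def poly_prod by (metis finite_lessThan prod_zero)
qed

lemma conjugate_root:
  assumes m: "m \<ge> 1" and f: "\<And>k. Polynomial.coeff f k \<in> E m" "poly f (pi (m + i)) = 0"
    and s: "\<not> p dvd s" "[s = 1] (mod p ^ m)"
  shows "poly f (NN (m + i) s) = 0"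
proof -
  let ?n = "m + i"
  have n: "?n \<ge> 1" using m by simp
  have c: "Polynomial.coeff f k \<in> cyc ?n" "sig ?n s (Polynomial.coeff f k) = Polynomial.coeff f k" for k
    using f(1) E_cyc[OF m] cyc_mono[OF m] sig_fixes_cyc[OF m _ s] by auto
  have pc: "pi ?n \<in> cyc ?n" unfolding pi_eq_NN by (rule NN_cyc)
  have "sig ?n s (poly f (pi ?n)) =
      (\<Sum>k\<le>Polynomial.degree f. sig ?n s (Polynomial.coeff f k * pi ?n ^ k))"
    unfolding poly_altdef by (intro sig_sum[OF n s(1)] cyc_closed c pc)
  also have "\<dots> = (\<Sum>k\<le>Polynomial.degree f. Polynomial.coeff f k * NN ?n s ^ k)"
    using sig_NN[OF n s(1), of 1]
    by (intro sum.cong)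
      (simp_all add: sig_mult[OF n s(1)] c cyc_closed pc sig_power[OF n s(1)] pi_eq_NN[of ?n, symmetric] del: One_nat_def)
  finally show ?thesis using f(2) by (simp add: sig_0[OF n s(1)] poly_altdef)
qed

lemma conj_exp_cong: "[conj_exp m k = 1] (mod p ^ m)"
  unfolding conj_exp_def by (simp only: cong_def mod_mult_self2)

lemma degree_ge_conjugates:
  assumes m: "m \<ge> 1" and f: "\<And>k. Polynomial.coeff f k \<in> E m" "poly f (pi (m + i)) = 0" "f \<noteq> 0"
  shows "p ^ i \<le> Polynomial.degree f"
proof -
  have "card ((\<lambda>k. NN (m + i) (conj_exp m k)) ` {..<p ^ i}) = p ^ i"
    using NN_conj_inj[OF m] by (simp add: card_image)
  moreover have "card ((\<lambda>k. NN (m + i) (conj_exp m k)) ` {..<p ^ i}) \<le> card {z. poly f z = 0}"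
    using conjugate_root[OF m f(1,2) not_dvd_conj_exp[OF m] conj_exp_cong]
    by (intro card_mono poly_roots_finite[OF f(3)]) auto
  ultimately show ?thesis using card_poly_roots_bound[OF f(3)] by linarith
qed

text \<open>\<open>E_span_level\<close> expresses \<open>pi ?n ^ (p ^ i)\<close> through lower
  powers over \<open>E m\<close>, which gives a monic Q over \<open>E m\<close> of degree p^i with
  root \<open>pi ?n\<close>. The p^i distinct conjugates are roots of both Q and
  \<open>mu m i\<close>, so the two coincide.\<close>

lemma coeff_mu_E:
  assumes m: "m \<ge> 1"
  shows "mu_coeff m i k \<in> E m"
proof -
  let ?n = "m + i"
  have n: "?n \<ge> 1" using m by simp
  obtain V where "cyclotomic_level p \<zeta> V ?n" using exists_level[OF n] by auto
  then interpret cyclotomic_level p \<zeta> V ?n .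
  have "pi ?n ^ (p ^ i) \<in> E ?n"
    by (intro is_subring_power is_subring_E n pi_E) simp
  then obtain r where r: "pi ?n ^ (p ^ i) =
      (\<Sum>(j, k)\<in>{..<p ^ i} \<times> {..<p ^ (m - 1)}. of_rat (r j k) * (pi ?n ^ j * pi m ^ k))"
    using E_span_level[OF m refl] by blast
  define b where "b j = (\<Sum>k<p ^ (m - 1). of_rat (r j k) * pi m ^ k)" for j
  have bE: "b j \<in> E m" for j
    unfolding b_def using m by (intro is_subring_sum is_subring_mult is_subring_power is_subring_E E_rat pi_E) auto
  define S where "S = (\<Sum>j<p ^ i. Polynomial.monom (b j) j)"
  define Q where "Q = Polynomial.monom 1 (p ^ i) - S"
  have degS: "Polynomial.degree S < p ^ i" unfolding S_def using p3
    by (intro degree_sum_less) (auto intro: le_less_trans[OF degree_monom_le])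
  have "pi ?n ^ (p ^ i) = poly S (pi ?n)"
    unfolding r S_def b_def
    by (simp add: poly_sum poly_monom sum.cartesian_product[symmetric] sum_distrib_right sum_distrib_left mult_ac)
  then have rootQ: "poly Q (pi ?n) = 0" by (simp add: Q_def poly_monom)
  have QE: "Polynomial.coeff Q k \<in> E m" for k
  proof -
    have "Polynomial.coeff S k \<in> E m" unfolding S_def coeff_sum
      by (intro is_subring_sum[OF is_subring_E[OF m]]) (use bE is_subring_0[OF is_subring_E[OF m]] in auto)
    then show ?thesis using is_subringD[OF is_subring_E[OF m]] by (simp add: Q_def)
  qed
  have roots: "poly (mu m i - Q) (NN ?n (conj_exp m k)) = 0" if "k < p ^ i" for k
  proof -
    have "poly Q (NN ?n (conj_exp m k)) = 0"
      by (rule conjugate_root[OF m QE rootQ not_dvd_conj_exp[OF m] conj_exp_cong])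
    moreover have "poly (mu m i) (NN ?n (conj_exp m k)) = 0"
      using that by (auto simp: mu_def poly_prod)
    ultimately show ?thesis by simp
  qed
  have "mu m i - Q = 0"
  proof (rule ccontr)
    assume ne: "mu m i - Q \<noteq> 0"
    have "card ((\<lambda>k. NN ?n (conj_exp m k)) ` {..<p ^ i}) \<le> card {z. poly (mu m i - Q) z = 0}"
      using roots by (intro card_mono poly_roots_finite[OF ne]) auto
    then have "p ^ i \<le> Polynomial.degree (mu m i - Q)"
      using NN_conj_inj[OF m, of i] card_poly_roots_bound[OF ne] by (simp add: card_image)
    moreover have "Polynomial.degree (mu m i - Q) \<le> p ^ i"
      unfolding Q_def using degS by (intro degree_diff_le) (auto simp: degree_mu degree_monom_eq)
    moreover have "Polynomial.coeff (mu m i - Q) (p ^ i) = 0"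
      using degS by (simp add: Q_def coeff_mu_degree coeff_eq_0)
    ultimately show False using ne by (metis leading_coeff_0_iff antisym)
  qed
  then show ?thesis using QE by simp
qed

lemma min_poly_eq_mu:
  assumes m: "m \<ge> 1"
  shows "min_poly (E m) (pi (m + i)) = mu m i"
  by (rule min_poly_eqI[OF subfield_E[OF m] coeff_mu_E[OF m] lead_coeff_mu root_mu])
    (use degree_ge_conjugates[OF m] in \<open>simp add: degree_mu\<close>)

lemma primitive_zeta_power_mult:
  assumes "m + i \<ge> 1" "\<not> p dvd s"
  shows "primitive_root_of_unity (p ^ i) (\<zeta> (m + i) ^ (p ^ m * s))"
proof -
  have "coprime p s" using assms(2) p_prime by (rule prime_imp_coprime[rotated])
  then have cop: "coprime (p ^ i) s" by simp
  have "(\<zeta> (m + i) ^ (p ^ m * s)) ^ l = 1 \<longleftrightarrow> p ^ i dvd l" for l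
  proof -
    have "(\<zeta> (m + i) ^ (p ^ m * s)) ^ l = 1 \<longleftrightarrow> p ^ m * p ^ i dvd p ^ m * (s * l)"
      using zeta_power_eq_1_iff[OF assms(1), of "p ^ m * s * l"] by (simp add: power_mult power_add mult.assoc)
    also have "\<dots> \<longleftrightarrow> p ^ i dvd s * l" using p3 by simp
    also have "\<dots> \<longleftrightarrow> p ^ i dvd l" using coprime_dvd_mult_right_iff[OF cop] .
    finally show ?thesis .
  qed
  then show ?thesis by (auto simp: primitive_root_of_unity_def dest: dvd_imp_le)
qed

text \<open>For fixed j the factors over all k involve \<open>\<zeta> ?n ^ T ?n j\<close> times
  every p^i-th root of unity, so their product is
  \<open>(\<zeta> ?n ^ T ?n j) ^ (p ^ i) - 1\<close>, the j-th factor of \<open>pi m\<close>.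
  Oddness of p^i gives the sign.\<close>

lemma coeff_mu_0:
  assumes m: "m \<ge> 1"
  shows "mu_coeff m i 0 = - pi m"
proof -
  let ?n = "m + i"
  have n: "?n \<ge> 1" using m by simp
  have odd: "odd (p ^ i)" using p_odd by simp
  have "mu_coeff m i 0 = (\<Prod>k<p ^ i. - NN ?n (conj_exp m k))"
    by (simp add: mu_def poly_prod flip: poly_0_coeff_0)
  also have "\<dots> = - (\<Prod>k<p ^ i. NN ?n (conj_exp m k))"
    using odd prod.distrib[of "\<lambda>_. - 1" "\<lambda>k. NN ?n (conj_exp m k)" "{..<p ^ i}"] by simp
  also have "(\<Prod>k<p ^ i. NN ?n (conj_exp m k)) =
      (\<Prod>j\<in>{1..p - 1}. \<Prod>k<p ^ i. \<zeta> ?n ^ T ?n j * (\<zeta> ?n ^ (p ^ m * T ?n j)) ^ k - 1)"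
    unfolding NN_def
    by (subst prod.swap) (simp add: conj_exp_def algebra_simps power_add flip: power_mult)
  also have "\<dots> = (\<Prod>j\<in>{1..p - 1}. (\<zeta> ?n ^ T ?n j) ^ (p ^ i) - 1)"
  proof (rule prod.cong)
    fix j assume j: "j \<in> {1..p - 1}"
    have "\<not> p dvd T ?n j" by (rule teich_not_dvd[OF n T_teich[OF n not_dvd_small[OF j]]])
    from prod_times_primitive_roots[OF primitive_zeta_power_mult[OF n this] odd]
    show "(\<Prod>k<p ^ i. \<zeta> ?n ^ T ?n j * (\<zeta> ?n ^ (p ^ m * T ?n j)) ^ k - 1) =
        (\<zeta> ?n ^ T ?n j) ^ (p ^ i) - 1" .
  qed simp
  also have "\<dots> = pi m"
    unfolding pi_lower[OF m, of i] NN_def by (simp add: mult.commute flip: power_mult)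
  finally show ?thesis .
qed

lemma E_span:
  assumes m: "m \<ge> 1" and y: "y \<in> E m"
  shows "\<exists>r. y = (\<Sum>k<p ^ (m - 1). of_rat (r k) * pi m ^ k)"
proof -
  obtain V where "cyclotomic_level p \<zeta> V m" using exists_level[OF m] by auto
  then interpret cyclotomic_level p \<zeta> V m .
  have "\<exists>r. y = (\<Sum>(j, k)\<in>{..<p ^ 0} \<times> {..<p ^ (m - 1)}. of_rat (r j k) * (pi m ^ j * pi m ^ k))"
    by (rule E_span_level[OF m _ y]) simp
  then obtain r where "y = (\<Sum>(j, k)\<in>{..<p ^ 0} \<times> {..<p ^ (m - 1)}. of_rat (r j k) * (pi m ^ j * pi m ^ k))"
    by blast
  then have "y = (\<Sum>k<p ^ (m - 1). of_rat (r 0 k) * pi m ^ k)"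
    by (simp add: sum.cartesian_product[symmetric])
  then show ?thesis by (rule exI[of _ "r 0"])
qed

end

context cyclotomic_level
begin

section \<open>The ring \<open>Z_pi_ring\<close>\<close>

definition vpi :: "nat \<Rightarrow> int" where "vpi m = int ((p - 1) * p ^ (N - m))"

lemma vpi_eq: "vpi m = int (p - 1) * int (p ^ (N - m))" by (simp add: vpi_def)

lemma vpi_pos: "vpi m > 0" using p3 by (simp add: vpi_def)

lemma U_vpi: "1 \<le> m \<Longrightarrow> m \<le> N \<Longrightarrow> U (vpi m) (pi m)"
  unfolding vpi_def by (rule U_pi)

lemma phi_vpi: "1 \<le> m \<Longrightarrow> m \<le> N \<Longrightarrow> int (phi N) = int (p ^ (m - 1)) * vpi m"
proof -
  assume m: "1 \<le> m" "m \<le> N"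
  then have "N - 1 = (m - 1) + (N - m)" by simp
  then have "p ^ (N - 1) = p ^ (m - 1) * p ^ (N - m)" by (simp only: power_add)
  then show ?thesis by (simp add: phi_def vpi_def)
qed

lemma vpi_add: "m + i \<le> N \<Longrightarrow> vpi m = int (p ^ i) * vpi (m + i)"
proof -
  assume "m + i \<le> N"
  then have "N - m = i + (N - (m + i))" by simp
  then have "p ^ (N - m) = p ^ i * p ^ (N - (m + i))" by (simp only: power_add)
  then show ?thesis by (simp add: vpi_def)
qed

lemma pi_combination_inj:
  assumes m: "1 \<le> m" "m \<le> N"
  shows "inj_on (\<lambda>k. int k * vpi m mod int (phi N)) {..<p ^ (m - 1)}"
proof (rule inj_onI)
  fix k l assume kl: "k \<in> {..<p ^ (m - 1)}" "l \<in> {..<p ^ (m - 1)}"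
    "int k * vpi m mod int (phi N) = int l * vpi m mod int (phi N)"
  have "int k * vpi m mod int (phi N) = int k * vpi m" if "k < p ^ (m - 1)" for k
  proof (rule mod_pos_pos_trivial)
    show "int k * vpi m < int (phi N)"
      unfolding phi_vpi[OF m] by (rule mult_strict_right_mono[OF _ vpi_pos]) (use that in simp)
  qed (use vpi_pos[of m] in simp)
  then show "k = l" using kl vpi_pos[of m] by simp
qed

text \<open>The terms of the expansion in powers of \<open>pi m\<close> have values z
  \<open>phi N\<close> + k \<open>vpi m\<close> with k below p^(m - 1). These are distinct and
  multiples of \<open>vpi m\<close>, because \<open>phi N\<close> is p^(m - 1) times
  \<open>vpi m\<close>.\<close>

lemma E_value:
  assumes m: "1 \<le> m" "m \<le> N" and y: "y \<in> E m" "y \<noteq> 0"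
  shows "\<exists>z. U (z * vpi m) y"
proof -
  obtain r where r: "y = (\<Sum>k<p ^ (m - 1). of_rat (r k) * pi m ^ k)"
    using E_span[OF m(1) y(1)] by blast
  have "\<exists>k\<in>{..<p ^ (m - 1)}. \<exists>z. U (z * int (phi N) + int k * vpi m) (\<Sum>k<p ^ (m - 1). of_rat (r k) * pi m ^ k)"
    by (rule rat_combination_U)
      (use U_power[OF U_vpi[OF m]] pi_combination_inj[OF m] r y(2) in auto)
  then obtain k z where "U (z * int (phi N) + int k * vpi m) y" unfolding r by blast
  moreover have "z * int (phi N) + int k * vpi m = (z * int (p ^ (m - 1)) + int k) * vpi m"
    unfolding phi_vpi[OF m] by (simp add: algebra_simps)
  ultimately show ?thesis by metis
qed

text \<open>The rounding step: values on \<open>E m\<close> are multiples of \<open>vpi m\<close>,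
  so bounds that come from level m + i improve to whole powers of \<open>pi m\<close>.\<close>

lemma E_D_step:
  assumes m: "1 \<le> m" "m \<le> N" and y: "y \<in> E m" "D k y" and k: "k > (c - 1) * vpi m"
  shows "D (c * vpi m) y"
proof (cases "y = 0")
  case False
  obtain z where z: "U (z * vpi m) y" using E_value[OF m y(1) False] by blast
  have "k \<le> z * vpi m" using U_D_le[OF z y(2)] .
  then have "(c - 1) * vpi m < z * vpi m" using k by linarith
  then have "c \<le> z" using vpi_pos[of m] by simp
  then have "c * vpi m \<le> z * vpi m" using vpi_pos[of m] by simp
  then show ?thesis using U_D[OF z] D_mono by blast
qed simp

text \<open>If a sum over powers of \<open>pi m\<close> lies in \<open>V\<close>, so does each term,
  as their values are distinct. Since k \<open>vpi m\<close> is less than \<open>phi N\<close>, the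
  rational coefficient of such a term has nonnegative value itself.\<close>

lemma carrier_Z_pi_ring:
  assumes m: "1 \<le> m" "m \<le> N"
  shows "carrier (Z_pi_ring p \<zeta> m) = E m \<inter> V"
proof (intro equalityI subsetI)
  fix y assume "y \<in> carrier (Z_pi_ring p \<zeta> m)"
  then have "y \<in> ring.simple_extension ring_of_type_algebra (Z_localized p) (pi m)"
    by (simp add: Z_pi_ring_def)
  then show "y \<in> E m \<inter> V"
  proof (induction rule: ring.simple_extension.induct[OF type_ring, consumes 1, case_names zero lin])
    case zero
    show ?case using V_intros is_subring_0[OF is_subring_E[OF m(1)]] by simp
  next
    case (lin k1 k2)
    have "pi m \<in> V" using D_mono[OF U_D[OF U_vpi[OF m]], of 0] vpi_pos[of m] by (simp add: D_0_iff)
    moreover have "k2 \<in> E m"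
    proof -
      obtain a b where "k2 = of_int a / of_int b" using lin by (auto simp: Z_localized_def)
      then have "k2 = of_rat (of_int a / of_int b)" by (simp add: of_rat_divide)
      then show ?thesis using E_rat[OF m(1)] by metis
    qed
    moreover have "k2 \<in> V" using lin Z_localized_subset by blast
    ultimately show ?case using lin(3) pi_E[OF m(1) order_refl] is_subringD[OF is_subring_E[OF m(1)]]
      by (auto intro: V_intros)
  qed
next
  fix y assume y: "y \<in> E m \<inter> V"
  obtain r where r: "y = (\<Sum>k<p ^ (m - 1). of_rat (r k) * pi m ^ k)"
    using E_span[OF m(1)] y by blast
  have "(of_rat (r k) :: 'a) \<in> Z_localized p" if k: "k < p ^ (m - 1)" for k
  proof -
    have "D 0 (\<Sum>k<p ^ (m - 1). of_rat (r k) * pi m ^ k)" using y r by (simp add: D_0_iff)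
    then have D: "D 0 (of_rat (r k) * pi m ^ k)"
      by (rule rat_combination_D[OF _ _ pi_combination_inj[OF m], rotated -2])
        (use U_power[OF U_vpi[OF m]] k in auto)
    have "(of_rat (r k) :: 'a) \<in> V"
    proof (cases "r k = 0")
      case False
      obtain z where z: "U (z * int (phi N)) (of_rat (r k))" using U_rat[OF False] by blast
      have "0 \<le> z * int (phi N) + int k * vpi m"
        by (rule U_D_le[OF U_mult[OF z U_power[OF U_vpi[OF m]]] D])
      also have "\<dots> < z * int (phi N) + int (phi N)"
        unfolding phi_vpi[OF m] using k vpi_pos[of m] by (intro add_strict_left_mono mult_strict_right_mono) auto
      also have "\<dots> = (z + 1) * int (phi N)" by (simp add: algebra_simps)
      finally have "z \<ge> 0" using phi_pos[of N] by (simp add: zero_less_mult_iff)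
      then have "D 0 (of_rat (r k))" using D_mono[OF U_D[OF z], of 0] by simp
      then show ?thesis by (simp add: D_0_iff)
    qed (simp add: V_intros)
    then show ?thesis by (rule V_rat_localized)
  qed
  then show "y \<in> carrier (Z_pi_ring p \<zeta> m)"
    unfolding r Z_pi_ring_def by (simp add: simple_extension_sum)
qed

lemma divides_Z_pi_ringI:
  assumes m: "1 \<le> m" "m \<le> N" and d: "d \<in> E m" "U k d" and y: "y \<in> E m" "D k y"
  shows "d divides\<^bsub>Z_pi_ring p \<zeta> m\<^esub> y"
proof -
  have d0: "d \<noteq> 0" using U_nonzero[OF d(2)] .
  have "D (- k + k) (inverse d * y)" using d(2) y(2) by (intro D_mult) (auto simp: U_def)
  then have "inverse d * y \<in> V" by (simp add: D_0_iff)
  moreover have "inverse d * y \<in> E m"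
    using E_inverse[OF m(1) d(1)] y(1) is_subring_mult[OF is_subring_E[OF m(1)]] by blast
  ultimately have "inverse d * y \<in> carrier (Z_pi_ring p \<zeta> m)" using carrier_Z_pi_ring[OF m] by simp
  moreover have "y = d \<otimes>\<^bsub>Z_pi_ring p \<zeta> m\<^esub> (inverse d * y)" using d0 by (simp add: Z_pi_ring_def)
  ultimately show ?thesis unfolding factor_def by blast
qed

lemma divides_Z_pi_ringD:
  assumes m: "1 \<le> m" "m \<le> N" and d: "U k d" and dvd: "d divides\<^bsub>Z_pi_ring p \<zeta> m\<^esub> y"
  shows "D k y"
proof -
  obtain c where c: "c \<in> carrier (Z_pi_ring p \<zeta> m)" "y = d * c"
    using dvd by (auto simp: factor_def Z_pi_ring_def)
  then have "c \<in> V" using carrier_Z_pi_ring[OF m] by simp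
  then show ?thesis unfolding c(2) by (rule D_mult_V[OF U_D[OF d]])
qed

lemma Units_Z_pi_ringI:
  assumes m: "1 \<le> m" "m \<le> N" and y: "y \<in> E m" "U 0 y"
  shows "y \<in> Units (Z_pi_ring p \<zeta> m)"
proof -
  have "y \<in> carrier (Z_pi_ring p \<zeta> m)" "inverse y \<in> carrier (Z_pi_ring p \<zeta> m)" "y \<noteq> 0"
    using y E_inverse[OF m(1)] by (auto simp: carrier_Z_pi_ring[OF m] U_iff_unit)
  then show ?thesis unfolding Units_def by (auto simp: Z_pi_ring_def intro!: bexI[of _ "inverse y"])
qed

lemma coeff_mu_V:
  assumes m: "1 \<le> m" "m + i \<le> N"
  shows "mu_coeff m i k \<in> V"
proof -
  have "\<forall>k. Polynomial.coeff (\<Prod>k\<in>K. [:- NN (m + i) (conj_exp m k), 1:]) k \<in> V" if "finite K" for K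
    using that
  proof (induction K)
    case empty
    show ?case by (simp add: coeff_1 V_intros)
  next
    case (insert l K)
    have "NN (m + i) (conj_exp m l) \<in> V"
      using m zeta_V[of "m + i"] unfolding NN_def by (auto intro!: V_prod V_intros)
    then have "Polynomial.coeff [:- NN (m + i) (conj_exp m l), 1:] k \<in> V" for k
      by (auto simp: coeff_pCons V_intros split: nat.split)
    then have "Polynomial.coeff ([:- NN (m + i) (conj_exp m l), 1:] *
        (\<Prod>k\<in>K. [:- NN (m + i) (conj_exp m k), 1:])) k \<in> V" for k
      unfolding coeff_mult using insert by (intro V_intros) auto
    then show ?case using insert(1,2) by (simp del: mult_pCons_left)
  qed
  then show ?thesis by (simp add: mu_def)
qed

section \<open>Coefficient valuations\<close>

text \<open>In units of the value of \<open>\<zeta> (m + i) - 1\<close>, this is the excess over \<open>p ^ i\<close> of the value of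
  \<open>pi (m + i)\<close> times the different.\<close>

definition cden :: "nat \<Rightarrow> int" where "cden i = int (p - 2) * int (p ^ i) + 1"

lemma cden_pos: "cden i > 0"
  by (simp add: cden_def add_nonneg_pos)

text \<open>By \<open>U_NN_diff\<close> the derivative at a root is the product of the differences
  \<open>1 - \<eta> ^ k\<close>, which is \<open>p ^ i\<close>, up to a power of the uniformizer.\<close>

lemma U_pderiv_mu:
  assumes m: "1 \<le> m" "m + i \<le> N"
  shows "U (int i * int (phi N) + int (p ^ i - 1) * int ((p - 2) * p ^ (N - (m + i))))
    (poly (pderiv (mu m i)) (pi (m + i)))"
proof -
  let ?n = "m + i" and ?K = "{1..<p ^ i}"
  let ?R = "\<Prod>k\<in>?K. [:- NN ?n (conj_exp m k), 1:]" and ?d = "int ((p - 2) * p ^ (N - (m + i)))"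
  have n: "?n \<ge> 1" using m by simp
  have "{..<p ^ i} = insert 0 ?K" using p3 by auto
  then have "mu m i = [:- pi ?n, 1:] * ?R"
    unfolding mu_def by (simp add: conj_exp_def pi_eq_NN)
  then have "poly (pderiv (mu m i)) (pi ?n) = poly ?R (pi ?n)"
    by (simp only: pderiv_mult poly_add poly_mult) (simp add: pderiv_pCons)
  also have "\<dots> = (\<Prod>k\<in>?K. - (NN ?n (conj_exp m k) - pi ?n))"
    by (simp add: poly_prod)
  finally have prod: "poly (pderiv (mu m i)) (pi ?n) = \<dots>" .
  have ne: "\<zeta> ?n ^ (p ^ m * k) \<noteq> 1" if "k \<in> ?K" for k
    using that zeta_power_eq_1_iff[OF n, of "p ^ m * k"] p3 by (auto simp: power_add dest: dvd_imp_le)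
  \<comment> \<open>Only the sum of the values e k matters, and it is the value of p^i, the product
    of the differences.\<close>
  have "\<forall>k. \<exists>e. k \<in> ?K \<longrightarrow> U e (\<zeta> ?n ^ (p ^ m * k) - 1)"
    using U_zeta_diff_ex[OF n m(2) ne] by blast
  then obtain e where e: "\<And>k. k \<in> ?K \<Longrightarrow> U (e k) (\<zeta> ?n ^ (p ^ m * k) - 1)" by metis
  have "U (\<Sum>k\<in>?K. e k) (\<Prod>k\<in>?K. - (\<zeta> ?n ^ (p ^ m * k) - 1))"
    by (intro U_prod U_uminus e)
  also have "(\<Prod>k\<in>?K. - (\<zeta> ?n ^ (p ^ m * k) - 1)) = of_nat (p ^ i)"
    using prod_one_minus_primitive_roots[OF primitive_zeta_power[OF n refl]] p3
    by (simp add: power_mult)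
  finally have "U (\<Sum>k\<in>?K. e k) (of_nat p ^ i)" by simp
  then have sum_e: "(\<Sum>k\<in>?K. e k) = int i * int (phi N)" by (rule U_unique[OF _ U_power[OF U_p]])
  have "U (e k + ?d) (- (NN ?n (conj_exp m k) - pi ?n))" if k: "k \<in> ?K" for k
  proof -
    have eq: "p ^ m * k = p * (p ^ (m - 1) * k)" using m by (cases m) simp_all
    have "U (e k + ?d) (NN ?n (1 + p * (p ^ (m - 1) * k)) - NN ?n 1)"
      by (rule U_NN_diff[OF n m(2) not_dvd_1]) (use e[OF k] eq in simp)
    then show ?thesis unfolding conj_exp_def pi_eq_NN eq by (rule U_uminus)
  qed
  then have "U (\<Sum>k\<in>?K. e k + ?d) (poly (pderiv (mu m i)) (pi ?n))"
    unfolding prod by (rule U_prod)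
  moreover have "(\<Sum>k\<in>?K. e k + ?d) = int i * int (phi N) + int (p ^ i - 1) * ?d"
    by (simp only: sum.distrib sum_e sum_constant card_atLeastLessThan)
  ultimately show ?thesis by simp
qed

lemma U_different:
  assumes m: "1 \<le> m" "m + i \<le> N"
  shows "U (int i * int (phi N) + int (p ^ (N - (m + i))) * cden i)
    (\<Sum>j\<le>p ^ i. of_nat j * mu_coeff m i j * pi (m + i) ^ j)"
proof -
  let ?q = "int (p ^ (N - (m + i)))"
  have "U (vpi (m + i) + (int i * int (phi N) + int (p ^ i - 1) * int ((p - 2) * p ^ (N - (m + i)))))
    (\<Sum>j\<le>p ^ i. of_nat j * mu_coeff m i j * pi (m + i) ^ j)"
    unfolding degree_mu[of m i, symmetric] poly_pderiv_times[symmetric]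
    unfolding degree_mu using m by (intro U_mult U_vpi U_pderiv_mu) auto
  moreover have "vpi (m + i) + (int i * int (phi N) + int (p ^ i - 1) * int ((p - 2) * p ^ (N - (m + i)))) =
      int i * int (phi N) + ?q * cden i"
  proof -
    have "int (p ^ i - 1) = int (p ^ i) - 1" "int (p - 1) = int (p - 2) + 1"
      using p3 by (simp_all add: of_nat_diff)
    then show ?thesis by (simp only: vpi_eq cden_def of_nat_mult) (simp add: ring_distribs mult_ac)
  qed
  ultimately show ?thesis by metis
qed

lemma coeff_times_power_exact:
  assumes m: "1 \<le> m" "m + i \<le> N" and c: "c \<in> E m" "c \<noteq> 0"
  shows "\<exists>z. U ((z * int (p ^ i) + int j) * vpi (m + i)) (c * pi (m + i) ^ j)"
proof -
  obtain z where "U (z * vpi m) c" using E_value[OF m(1) _ c] m by auto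
  then have "U (z * vpi m + int j * vpi (m + i)) (c * pi (m + i) ^ j)"
    using m by (intro U_mult U_power U_vpi) auto
  then show ?thesis unfolding vpi_add[OF m(2)] by (intro exI[of _ z]) (simp add: algebra_simps)
qed

text \<open>Remainders run from 1 to M rather than from 0 to M - 1, so that the leading exponent p^i
  is covered.\<close>

lemma residue_unique:
  fixes z z' M :: int
  assumes "z * M + int j = z' * M + int j'" "1 \<le> j" "int j \<le> M" "1 \<le> j'" "int j' \<le> M"
  shows "j = j'"
proof -
  have *: False if "z < z'" "z * M + int j = z' * M + int j'" "int j \<le> M" "1 \<le> j'" "0 < M" for z z' :: int and j j'
  proof -
    have "(z + 1) * M \<le> z' * M" using that by (intro mult_right_mono) auto
    then show False using that by (simp add: algebra_simps)
  qed
  have "z = z'" using *[of z z' j j'] *[of z' z j' j] assms by (cases z z' rule: linorder_cases) auto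
  then show ?thesis using assms by simp
qed

text \<open>The values of nonzero elements of \<open>E m\<close> are multiples of \<open>p ^ i\<close> times the value of
  \<open>pi (m + i)\<close>, so exponents in \<open>[1, p ^ i]\<close> give terms of distinct values.\<close>

lemma E_poly_terms:
  assumes m: "1 \<le> m" "m + i \<le> N" and c: "\<And>j. c j \<in> E m" "c 0 = 0"
  shows E_poly_D: "D l (\<Sum>j\<le>p ^ i. c j * pi (m + i) ^ j) \<Longrightarrow> j \<le> p ^ i \<Longrightarrow> D l (c j * pi (m + i) ^ j)"
    and E_poly_U: "U l (\<Sum>j\<le>p ^ i. c j * pi (m + i) ^ j) \<Longrightarrow>
      \<exists>j\<le>p ^ i. \<exists>z. j \<ge> 1 \<and> (z * int (p ^ i) + int j) * vpi (m + i) = l \<and> U l (c j * pi (m + i) ^ j)"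
proof -
  let ?f = "\<lambda>j. c j * pi (m + i) ^ j"
  have "\<forall>j. \<exists>z. c j \<noteq> 0 \<longrightarrow> U ((z * int (p ^ i) + int j) * vpi (m + i)) (?f j)"
    using coeff_times_power_exact[OF m c(1)] by blast
  then obtain z where z: "\<And>j. c j \<noteq> 0 \<Longrightarrow> U ((z j * int (p ^ i) + int j) * vpi (m + i)) (?f j)" by metis
  let ?k = "\<lambda>j. (z j * int (p ^ i) + int j) * vpi (m + i)"
  have ex: "?f j = 0 \<or> U (?k j) (?f j)" for j using z[of j] by (cases "c j = 0") auto
  have inj: "inj_on ?k {j\<in>{..p ^ i}. ?f j \<noteq> 0}"
  proof (rule inj_onI)
    fix j j' assume j: "j \<in> {j\<in>{..p ^ i}. ?f j \<noteq> 0}" "j' \<in> {j\<in>{..p ^ i}. ?f j \<noteq> 0}" "?k j = ?k j'"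
    then have "j \<noteq> 0" "j' \<noteq> 0" using c(2) by (metis (mono_tags, lifting) mem_Collect_eq mult_zero_left)+
    moreover have "z j * int (p ^ i) + int j = z j' * int (p ^ i) + int j'"
      using j(3) vpi_pos[of "m + i"] by simp
    moreover have "int j \<le> int (p ^ i)" "int j' \<le> int (p ^ i)" using j(1,2) by (simp_all del: of_nat_power)
    ultimately show "j = j'" using residue_unique[of "z j" "int (p ^ i)" j "z j'" j'] by linarith
  qed
  show "D l (sum ?f {..p ^ i}) \<Longrightarrow> j \<le> p ^ i \<Longrightarrow> D l (?f j)"
    by (rule D_sum_distinct[OF _ ex inj]) auto
  assume "U l (sum ?f {..p ^ i})"
  from U_sum_distinct[OF _ ex inj this] obtain j where j: "j \<le> p ^ i" "?k j = l" "U l (?f j)" by auto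
  moreover have "j \<noteq> 0" using c(2) U_nonzero[OF j(3)] by (metis mult_zero_left)
  ultimately show "\<exists>j\<le>p ^ i. \<exists>z. j \<ge> 1 \<and> (z * int (p ^ i) + int j) * vpi (m + i) = l \<and> U l (?f j)"
    by (intro exI[of _ j] conjI exI[of _ "z j"]) auto
qed

lemma times_coeff_E: "1 \<le> m \<Longrightarrow> of_nat j * mu_coeff m i j \<in> E m"
  using coeff_mu_E E_rat[of m "of_nat j"] is_subring_mult[OF is_subring_E[of m]] by simp

lemma D_times_coeff_power:
  assumes m: "1 \<le> m" "m + i \<le> N" and j: "j \<le> p ^ i"
  shows "D (int i * int (phi N) + int (p ^ (N - (m + i))) * cden i)
    (of_nat j * mu_coeff m i j * pi (m + i) ^ j)"
  by (rule E_poly_D[OF m _ _ U_D[OF U_different[OF m]] j]) (use times_coeff_E[OF m(1)] in auto)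

lemma D_times_coeff:
  assumes m: "1 \<le> m" "m + i \<le> N" and j: "j \<le> p ^ i"
  shows "D (int i * int (phi N) + int (p ^ (N - (m + i))) * (cden i - int j * int (p - 1)))
    (of_nat j * mu_coeff m i j)"
proof (rule D_cancel)
  show "U (int j * vpi (m + i)) (pi (m + i) ^ j)" using m by (intro U_power U_vpi) auto
  have "int j * vpi (m + i) +
      (int i * int (phi N) + int (p ^ (N - (m + i))) * (cden i - int j * int (p - 1))) =
      int i * int (phi N) + int (p ^ (N - (m + i))) * cden i"
    unfolding vpi_eq by (simp add: right_diff_distrib mult_ac del: of_nat_diff)
  then show "D (int j * vpi (m + i) +
      (int i * int (phi N) + int (p ^ (N - (m + i))) * (cden i - int j * int (p - 1))))
      (pi (m + i) ^ j * (of_nat j * mu_coeff m i j))"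
    using D_times_coeff_power[OF m j] by (simp only: mult.commute)
qed

lemma phi_multiple: "1 \<le> m \<Longrightarrow> m \<le> N \<Longrightarrow> int k * int (phi N) = int (k * p ^ (m - 1)) * vpi m"
  by (simp add: phi_vpi)

lemma of_nat_p_power_E: "1 \<le> m \<Longrightarrow> of_nat (p ^ k) \<in> E m"
  using E_rat[of m "of_nat (p ^ k)"] unfolding of_rat_of_nat_eq .

lemma U_p_power: "U (int k * int (phi N)) (of_nat (p ^ k))"
  using U_power[OF U_p, of k] by simp

lemma vpi_split: "m + i \<le> N \<Longrightarrow> vpi m = int (p ^ (N - (m + i))) * (int (p ^ i) * int (p - 1))"
  using vpi_add[of m i] by (simp add: vpi_def[of "m + i"])

text \<open>The bound of \<open>D_times_coeff\<close> differs from i \<open>phi N\<close> by a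
  positive multiple of \<open>cden i - int j * int (p - 1)\<close>. This difference exceeds minus
  \<open>vpi m\<close> when j is at most p^i, and is positive below the threshold;
  \<open>E_D_step\<close> rounds up to i \<open>phi N\<close> or to one \<open>vpi m\<close>
  more.\<close>

lemma D_times_coeff_multiple:
  assumes m: "1 \<le> m" "m + i \<le> N" and j: "j \<le> p ^ i"
  shows "D (int i * int (phi N)) (of_nat j * mu_coeff m i j)"
    and "j * (p - 1) < p ^ i * (p - 2) \<Longrightarrow>
      D (int i * int (phi N) + vpi m) (of_nat j * mu_coeff m i j)"
proof -
  let ?q = "int (p ^ (N - (m + i)))" and ?K = "int (i * p ^ (m - 1))"
  have mN: "m \<le> N" using m by simp
  have q: "?q > 0" using p3 by simp
  note D = D_times_coeff[OF m j, unfolded phi_multiple[OF m(1) mN]]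
  have "D (?K * vpi m) (of_nat j * mu_coeff m i j)"
  proof (rule E_D_step[OF m(1) mN times_coeff_E[OF m(1)] D])
    have "int j * int (p - 1) \<le> int (p ^ i) * int (p - 1)" using j by (intro mult_right_mono) (auto simp del: of_nat_power)
    then have "- (int (p ^ i) * int (p - 1)) < cden i - int j * int (p - 1)" using cden_pos[of i] by linarith
    then have "?q * (- (int (p ^ i) * int (p - 1))) < ?q * (cden i - int j * int (p - 1))"
      by (rule mult_strict_left_mono[OF _ q])
    then have "- vpi m < ?q * (cden i - int j * int (p - 1))" unfolding vpi_split[OF m(2)] by simp
    then show "(?K - 1) * vpi m < ?K * vpi m + ?q * (cden i - int j * int (p - 1))"
      by (simp only: left_diff_distrib)
  qed
  then show "D (int i * int (phi N)) (of_nat j * mu_coeff m i j)"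
    unfolding phi_multiple[OF m(1) mN] .
  assume "j * (p - 1) < p ^ i * (p - 2)"
  then have "int (j * (p - 1)) < int (p ^ i * (p - 2))" by (simp only: of_nat_less_iff)
  then have "cden i - int j * int (p - 1) > 0" unfolding cden_def of_nat_mult mult.commute[of "int (p - 2)"] by linarith
  then have "?q * (cden i - int j * int (p - 1)) > 0" using q by (rule mult_pos_pos[rotated])
  then have "D ((?K + 1) * vpi m) (of_nat j * mu_coeff m i j)"
    by (intro E_D_step[OF m(1) mN times_coeff_E[OF m(1)] D]) simp
  then show "D (int i * int (phi N) + vpi m) (of_nat j * mu_coeff m i j)"
    unfolding phi_multiple[OF m(1) mN] by (simp add: distrib_right)
qed

text \<open>Comparing values determines the term that attains the value of the sum: its exponent
  satisfies j (p - 1) = (p - 2) p^i + 1. This j is prime to p, so the factor j may be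
  dropped.\<close>

lemma U_extremal_coeff:
  assumes m: "1 \<le> m" "m + i \<le> N" and i: "i \<ge> 1"
  shows "U (int i * int (phi N)) (mu_coeff m i (p ^ i - (p ^ i - 1) div (p - 1)))"
proof -
  let ?q = "int (p ^ (N - (m + i)))" and ?K = "int (i * p ^ (m - 1))" and ?M = "int (p ^ i)"
  let ?l = "int i * int (phi N) + ?q * cden i"
  have mN: "m \<le> N" using m by simp
  have q: "?q > 0" using p3 by simp
  obtain j z where j: "j \<le> p ^ i" "j \<ge> 1" "(z * ?M + int j) * vpi (m + i) = ?l"
    "U ?l (of_nat j * mu_coeff m i j * pi (m + i) ^ j)"
    using E_poly_U[OF m _ _ U_different[OF m]] times_coeff_E[OF m(1)] by auto
  have "?l = ?q * (?K * ?M * int (p - 1) + cden i)"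
    unfolding phi_multiple[OF m(1) mN] vpi_split[OF m(2)] by (simp add: algebra_simps)
  moreover have "(z * ?M + int j) * vpi (m + i) = ?q * ((z * ?M + int j) * int (p - 1))"
    by (simp only: vpi_eq mult_ac)
  ultimately have "?q * ((z * ?M + int j) * int (p - 1)) = ?q * (?K * ?M * int (p - 1) + cden i)"
    using j(3) by metis
  then have "(z * ?M + int j) * int (p - 1) = ?K * ?M * int (p - 1) + cden i"
    using q by (metis less_irrefl mult_cancel_left)
  then have eq: "((z - ?K) * ?M + int j) * int (p - 1) = int (p - 2) * ?M + 1"
    by (simp only: cden_def left_diff_distrib distrib_right)
  have P: "int (p - 1) = int (p - 2) + 1" "int (p - 2) \<ge> 1" using p3 by (simp_all add: of_nat_diff)
  have M1: "?M \<ge> 1" using p3 by simp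
  have jM: "1 \<le> int j" "int j \<le> ?M" using j(1,2) by (simp_all del: of_nat_power)
  \<comment> \<open>Since j lies between 1 and p^i, a negative z - K makes the left side of
    \<open>eq\<close> nonpositive, and a positive one makes it too large.\<close>
  have zK: "z - ?K = 0"
  proof (cases "z - ?K" "0 :: int" rule: linorder_cases)
    case less
    then have "(z - ?K) * ?M \<le> (-1) * ?M" using M1 by (intro mult_right_mono) auto
    then have "(z - ?K) * ?M + int j \<le> 0" using jM by linarith
    then have "((z - ?K) * ?M + int j) * int (p - 1) \<le> 0" by (rule mult_nonpos_nonneg) simp
    moreover have "0 \<le> int (p - 2) * ?M" by simp
    ultimately show ?thesis using eq by linarith
  next
    case greater
    then have "1 * ?M \<le> (z - ?K) * ?M" using M1 by (intro mult_right_mono) auto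
    then have "(?M + 1) * int (p - 1) \<le> ((z - ?K) * ?M + int j) * int (p - 1)"
      using jM by (intro mult_right_mono) auto
    moreover have "(?M + 1) * int (p - 1) = int (p - 2) * ?M + ?M + int (p - 2) + 1"
      unfolding P(1) by (simp add: algebra_simps)
    ultimately show ?thesis using eq M1 P(2) by linarith
  qed simp
  have jeq: "int j * int (p - 1) = int (p - 2) * ?M + 1" using eq by (simp only: zK mult_zero_left add_0)
  have jval: "j = p ^ i - (p ^ i - 1) div (p - 1)"
  proof -
    have "(?M - int j) * int (p - 1) = ?M - 1"
      unfolding left_diff_distrib jeq unfolding P(1) by (simp only: distrib_left mult.commute)
    moreover have "int (p ^ i - j) = ?M - int j" using j(1) by (rule of_nat_diff)
    moreover have "int (p ^ i - 1) = ?M - 1" using of_nat_diff[of 1 "p ^ i", where 'a = int] p3 by simp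
    ultimately have "int ((p ^ i - j) * (p - 1)) = int (p ^ i - 1)" by (simp only: of_nat_mult)
    then have "(p ^ i - j) * (p - 1) = p ^ i - 1" by (simp only: of_nat_eq_iff)
    then have "(p ^ i - 1) div (p - 1) = p ^ i - j" using p3
      by (metis nonzero_mult_div_cancel_right diff_is_0_eq not_less numeral_le_one_iff semiring_norm(70) le_trans)
    then show ?thesis using j(1) by simp
  qed
  have nd: "\<not> p dvd j"
  proof
    assume "p dvd j"
    then have "int p dvd int j * int (p - 1)" by simp
    moreover have "int p dvd int (p - 2) * ?M" using i by simp
    ultimately have "int p dvd 1" unfolding jeq by (simp add: dvd_add_right_iff)
    then show False using p3 by simp
  qed
  have "U (?l - int j * vpi (m + i) - 0)
      (of_nat j * mu_coeff m i j * pi (m + i) ^ j / pi (m + i) ^ j / of_nat j)"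
    using m by (intro U_divide U_power U_vpi U_of_nat[OF nd] j(4)) auto
  moreover have "pi (m + i) \<noteq> 0" using U_nonzero[OF U_vpi[of "m + i"]] m by simp
  ultimately have "U (?l - int j * vpi (m + i)) (mu_coeff m i j)"
    using j(2) by simp
  moreover have "?l - int j * vpi (m + i) = int i * int (phi N)"
  proof -
    have "int j * vpi (m + i) = ?q * (int j * int (p - 1))" by (simp add: vpi_def)
    also have "\<dots> = ?q * cden i" by (simp only: jeq cden_def)
    finally show ?thesis by simp
  qed
  ultimately show ?thesis by (simp add: jval)
qed

end

context cyclotomic_level
begin

section \<open>Consecutive levels\<close>

lemma D_1_cong:
  assumes "[a = b] (mod p)"
  shows "D 1 (of_nat a - of_nat b)"
proof -
  have "int p dvd int a - int b"
    using cong_int_iff[THEN iffD2, OF assms] unfolding cong_iff_dvd_diff .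
  then obtain c where "int a - int b = int p * c" by blast
  then have "(of_int (int a - int b) :: 'a) = of_int (int p * c)" by (simp only:)
  then have "(of_nat a - of_nat b :: 'a) = of_nat p * of_int c" by simp
  then show ?thesis using D_mult_V[OF D_1_p V_of_int] by metis
qed

text \<open>The unit by which the j-th factor of \<open>pi N\<close> differs from
  \<open>\<zeta> N - 1\<close>.\<close>

definition tw :: "nat \<Rightarrow> 'a" where "tw j = (\<zeta> N ^ T N j - 1) / (\<zeta> N - 1)"

text \<open>\<open>tw j\<close> is a sum of \<open>T N j\<close> powers of \<open>\<zeta> N\<close>,
  each congruent to 1, hence congruent to \<open>T N j\<close>; the latter is congruent to j and has
  (p - 1)-st power 1 modulo p.\<close>

lemma tw:
  assumes j: "j \<in> {1..p - 1}"
  shows U_tw: "U 0 (tw j)" and tw_cong: "D 1 (tw j - of_nat j)"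
    and tw_power: "D 1 (inverse (tw j) ^ (p - 1) - 1)"
proof -
  have te: "teich N (T N j)" by (rule T_teich[OF N not_dvd_small[OF j]])
  have nd: "\<not> p dvd T N j" by (rule teich_not_dvd[OF N te])
  have eq: "tw j = (\<Sum>k<T N j. (\<zeta> N ^ 1) ^ k)"
    using power_diff_1_eq[of "\<zeta> N" "T N j"] x0 by (simp add: tw_def)
  have c: "D 1 (tw j - of_nat (T N j))"
    unfolding eq by (rule zeta_sum_cong[OF N order_refl])
  show U: "U 0 (tw j)" using U_cong[OF U_of_nat[OF nd], of "tw j"] c by simp
  have "D 1 ((tw j - of_nat (T N j)) + (of_nat (T N j) - of_nat j))"
    by (intro D_add c D_1_cong T_cong_p)
  then show "D 1 (tw j - of_nat j)" by simp
  have V: "tw j \<in> V" using U by (simp add: U_iff_unit)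
  have "D 1 ((\<Prod>_\<in>{1..p - 1}. tw j) - (\<Prod>_\<in>{1..p - 1}. of_nat (T N j)))"
    by (intro D_prod_cong) (use V V_of_nat c in auto)
  then have "D 1 (tw j ^ (p - 1) - of_nat (T N j ^ (p - 1)))" by simp
  moreover have "D 1 (of_nat (T N j ^ (p - 1)) - of_nat 1)"
    by (rule D_1_cong) (use cong_p[OF N] te in \<open>simp add: teich_def\<close>)
  ultimately have "D 1 ((tw j ^ (p - 1) - of_nat (T N j ^ (p - 1))) + (of_nat (T N j ^ (p - 1)) - of_nat 1))"
    by (rule D_add)
  then have "D 1 (tw j ^ (p - 1) - 1)" by simp
  moreover have "U 0 (tw j ^ (p - 1))" using U_power[OF U, of "p - 1"] by simp
  ultimately show "D 1 (inverse (tw j) ^ (p - 1) - 1)"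
    using D_inverse_cong[of "tw j ^ (p - 1)" 1] U_1 by (simp add: power_inverse)
qed

lemma pi_tw: "pi N = (\<zeta> N - 1) ^ (p - 1) * (\<Prod>j\<in>{1..p - 1}. tw j)"
proof -
  have "pi N = (\<Prod>j\<in>{1..p - 1}. (\<zeta> N - 1) * tw j)"
    using x0 by (simp add: pi_eq_NN NN_def tw_def)
  then show ?thesis unfolding prod.distrib by simp
qed

text \<open>The product is congruent to (p - 1)!, which is -1 modulo p by Wilson's theorem.\<close>

lemma prod_tw_cong: "D 1 ((\<Prod>j\<in>{1..p - 1}. tw j) + 1)"
proof -
  have "D 1 ((\<Prod>j\<in>{1..p - 1}. tw j) - (\<Prod>j\<in>{1..p - 1}. of_nat j))"
    by (intro D_prod_cong) (use U_tw tw_cong V_of_nat in \<open>auto simp: U_iff_unit\<close>)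
  then have 1: "D 1 ((\<Prod>j\<in>{1..p - 1}. tw j) - fact (p - 1))"
    by (simp add: fact_prod)
  have "int p dvd fact (p - 1) + 1"
    using wilson_theorem[OF p_prime] unfolding cong_iff_dvd_diff by simp
  then obtain c where "(fact (p - 1) :: int) + 1 = int p * c" by blast
  then have "(of_int (fact (p - 1) + 1) :: 'a) = of_int (int p * c)" by (simp only:)
  then have "(fact (p - 1) + 1 :: 'a) = of_nat p * of_int c" by simp
  then have "D 1 (fact (p - 1) + 1 :: 'a)" using D_mult_V[OF D_1_p V_of_int] by metis
  from D_add[OF 1 this] show ?thesis by (simp add: algebra_simps)
qed

text \<open>The quotient of p y by y^p for y = \<open>\<zeta> N - 1\<close>: the size of the linear
  relative to the top term in (1 + y)^p - 1.\<close>

definition rho :: 'a where "rho = of_nat p / (\<zeta> N - 1) ^ (p - 1)"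

lemma U_rho: "U (int (phi N) - int (p - 1)) rho"
  using U_divide[OF U_p U_power[OF U_x, of "p - 1"]] by (simp add: rho_def)

lemma phi_ge: "N \<ge> 2 \<Longrightarrow> p * (p - 1) \<le> phi N"
  using p3 self_le_power[of p "N - 1"] by (simp add: phi_def)

lemma D_1_rho: "N \<ge> 2 \<Longrightarrow> D 1 rho"
proof (rule D_mono[OF U_D[OF U_rho]])
  assume "N \<ge> 2"
  then have "p * (p - 1) \<le> phi N" by (rule phi_ge)
  moreover have "3 * (p - 1) \<le> p * (p - 1)" using p3 by (intro mult_right_mono) auto
  ultimately have "3 * (p - 1) \<le> phi N" by linarith
  then show "1 \<le> int (phi N) - int (p - 1)" using p3 by linarith
qed

text \<open>The j-th factor of \<open>pi (N - 1)\<close> is (1 + y)^p - 1, where y is the j-th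
  factor of \<open>pi N\<close>; this equals y^p (1 + rho \<kappa>) with \<kappa> congruent to 1.
  Multiplying over j adds up p - 1 of the \<kappa>, so u is congruent to -1.\<close>

lemma pi_step:
  assumes N2: "N \<ge> 2"
  shows "\<exists>u\<in>V. D 1 (u + 1) \<and> pi (N - 1) = pi N ^ p * (1 + rho * u)"
proof -
  let ?J = "{1..p - 1}"
  define y where "y j = \<zeta> N ^ T N j - 1" for j
  have yV: "y j \<in> V" for j using zeta_V[OF N] by (auto simp: y_def intro!: V_intros)
  have "\<forall>j. \<exists>w\<in>V. (1 + y j) ^ p = 1 + y j ^ p + of_nat p * y j * (1 + y j * w)"
    using power_p_one_plus[OF yV] by blast
  then obtain w where w: "\<And>j. w j \<in> V" "\<And>j. (1 + y j) ^ p = 1 + y j ^ p + of_nat p * y j * (1 + y j * w j)"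
    by metis
  define \<kappa> where "\<kappa> j = inverse (tw j) ^ (p - 1) * (1 + y j * w j)" for j
  have ytw: "y j = (\<zeta> N - 1) * tw j" for j using x0 by (simp add: y_def tw_def)
  have iV: "inverse (tw j) ^ (p - 1) \<in> V" if "j \<in> ?J" for j
    using U_tw[OF that] by (auto simp: U_iff_unit intro: V_intros)
  have \<kappa>: "\<kappa> j \<in> V" "D 1 (\<kappa> j - 1)" if j: "j \<in> ?J" for j
  proof -
    show "\<kappa> j \<in> V" unfolding \<kappa>_def by (intro V_intros iV j yV w)
    have "D 1 (y j)" unfolding y_def by (rule D_1_zeta_diff[OF N order_refl])
    then have "D 1 (y j * (w j * inverse (tw j) ^ (p - 1)))"
      by (rule D_mult_V) (rule V_intros(4)[OF w(1) iV[OF j]])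
    from D_add[OF tw_power[OF j] this] show "D 1 (\<kappa> j - 1)"
      by (simp add: \<kappa>_def algebra_simps)
  qed
  have fact: "\<zeta> N ^ (p * T N j) - 1 = y j ^ p * (1 + rho * \<kappa> j)" if j: "j \<in> ?J" for j
  proof -
    have t0: "tw j \<noteq> 0" using U_nonzero[OF U_tw[OF j]] .
    then have y0: "y j \<noteq> 0" using ytw x0 by simp
    have "y j ^ p * (rho * \<kappa> j) = y j * y j ^ (p - 1) * (of_nat p / (\<zeta> N - 1) ^ (p - 1) * (inverse (tw j) ^ (p - 1) * (1 + y j * w j)))"
      using p3 by (simp add: rho_def \<kappa>_def flip: power_Suc)
    also have "y j ^ (p - 1) = (\<zeta> N - 1) ^ (p - 1) * tw j ^ (p - 1)"
      by (simp add: ytw power_mult_distrib)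
    also have "y j * ((\<zeta> N - 1) ^ (p - 1) * tw j ^ (p - 1)) * (of_nat p / (\<zeta> N - 1) ^ (p - 1) *
        (inverse (tw j) ^ (p - 1) * (1 + y j * w j))) = of_nat p * y j * (1 + y j * w j)"
      using t0 x0 by (simp add: power_inverse field_simps)
    finally have "y j ^ p * (rho * \<kappa> j) = of_nat p * y j * (1 + y j * w j)" .
    moreover have "\<zeta> N ^ (p * T N j) = (1 + y j) ^ p"
      by (simp add: y_def mult.commute flip: power_mult)
    ultimately show ?thesis unfolding w(2) by (simp add: algebra_simps)
  qed
  obtain s where s: "s \<in> V" "(\<Prod>j\<in>?J. 1 + rho * \<kappa> j) = 1 + rho * (\<Sum>j\<in>?J. \<kappa> j) + rho\<^sup>2 * s"
    using prod_one_plus[of ?J rho \<kappa>] D_mono[OF D_1_rho[OF N2], of 0] \<kappa>(1) by (auto simp: D_0_iff)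
  have rV: "rho \<in> V" using D_mono[OF D_1_rho[OF N2], of 0] by (simp add: D_0_iff)
  define u where "u = (\<Sum>j\<in>?J. \<kappa> j) + rho * s"
  have "pi (N - 1) = NN N p" using pi_lower[of "N - 1" 1] N2 by simp
  also have "\<dots> = (\<Prod>j\<in>?J. y j ^ p * (1 + rho * \<kappa> j))"
    unfolding NN_def by (intro prod.cong refl fact)
  also have "\<dots> = (\<Prod>j\<in>?J. y j) ^ p * (\<Prod>j\<in>?J. 1 + rho * \<kappa> j)"
    by (simp only: prod.distrib prod_power_distrib)
  also have "(\<Prod>j\<in>?J. y j) = pi N" by (simp add: y_def pi_eq_NN NN_def)
  finally have "pi (N - 1) = pi N ^ p * (1 + rho * u)"
    unfolding s(2) by (simp add: u_def algebra_simps power2_eq_square)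
  moreover have "u \<in> V" unfolding u_def by (intro V_intros \<kappa>(1) rV s(1))
  moreover have "D 1 (u + 1)"
  proof -
    have "D 1 ((\<Sum>j\<in>?J. \<kappa> j - 1) + (rho * s + of_nat p))"
      by (intro D_add D_sum \<kappa>(2) D_mult_V D_1_rho N2 s D_1_p)
    moreover have "(\<Sum>j\<in>?J. \<kappa> j - 1) + (rho * s + of_nat p) = u + 1"
      using p3 by (simp add: sum_subtractf u_def of_nat_diff)
    ultimately show ?thesis by simp
  qed
  ultimately show ?thesis by blast
qed

text \<open>This prepares the hypothesis of \<open>power_one_plus_small\<close>. In values it says
  that (p - 2) \<open>phi N\<close> is at least (p - 1)^2, which follows from \<open>phi N\<close>
  being at least p (p - 1).\<close>

lemma rho_small:
  assumes N2: "N \<ge> 2"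
  shows "rho ^ (p - 1) / of_nat p \<in> V"
proof -
  have "U (int (p - 1) * (int (phi N) - int (p - 1)) - int (phi N)) (rho ^ (p - 1) / of_nat p)"
    by (intro U_divide U_power U_rho U_p)
  moreover have "0 \<le> int (p - 1) * (int (phi N) - int (p - 1)) - int (phi N)"
  proof -
    define q where "q = int (p - 2)"
    have q: "int (p - 1) = q + 1" "int p = q + 2" "q \<ge> 1" using p3 by (simp_all add: q_def)
    have "(q + 2) * (q + 1) \<le> int (phi N)" using phi_ge[OF N2] q by (metis of_nat_le_iff of_nat_mult)
    then have "q * ((q + 2) * (q + 1)) \<le> q * int (phi N)" using q by (intro mult_left_mono) auto
    moreover have "(q + 1) * (q + 1) \<le> q * ((q + 2) * (q + 1))"
    proof -
      have "1 * (q + 1) \<le> q * (q + 2)" using q(3) by (intro mult_mono) auto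
      then have "(q + 1) * (q + 1) \<le> (q * (q + 2)) * (q + 1)" using q(3) by (intro mult_right_mono) auto
      then show ?thesis by (simp only: mult.assoc)
    qed
    ultimately show ?thesis unfolding q(1) by (simp add: algebra_simps)
  qed
  ultimately show ?thesis using D_mono[OF U_D, of _ _ 0] by (simp add: D_0_iff)
qed

lemma sum_multiples:
  fixes g :: "nat \<Rightarrow> 'a"
  shows "(\<Sum>k\<le>p ^ Suc i. g k) = (\<Sum>j\<le>p ^ i. g (p * j)) + (\<Sum>k | k \<le> p ^ Suc i \<and> \<not> p dvd k. g k)"
proof -
  have "(\<Sum>j\<le>p ^ i. g (p * j)) = (\<Sum>k\<in>(\<lambda>j. p * j) ` {..p ^ i}. g k)"
    using p3 by (subst sum.reindex) (auto simp: inj_on_def)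
  also have "(\<lambda>j. p * j) ` {..p ^ i} = {k. k \<le> p ^ Suc i \<and> p dvd k}"
    using p3 by (auto elim!: dvdE)
  finally have 1: "(\<Sum>j\<le>p ^ i. g (p * j)) = (\<Sum>k | k \<le> p ^ Suc i \<and> p dvd k. g k)" .
  have "{..p ^ Suc i} = {k. k \<le> p ^ Suc i \<and> p dvd k} \<union> {k. k \<le> p ^ Suc i \<and> \<not> p dvd k}" by auto
  then have "(\<Sum>k\<le>p ^ Suc i. g k) = sum g ({k. k \<le> p ^ Suc i \<and> p dvd k} \<union> {k. k \<le> p ^ Suc i \<and> \<not> p dvd k})"
    by simp
  also have "\<dots> = (\<Sum>k | k \<le> p ^ Suc i \<and> p dvd k. g k) + (\<Sum>k | k \<le> p ^ Suc i \<and> \<not> p dvd k. g k)"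
    by (rule sum.union_disjoint) auto
  finally show ?thesis using 1 by simp
qed

text \<open>Both minimal polynomial equations are expressed in powers of \<open>pi N ^ p\<close> and subtracted.\<close>

lemma D_coeff_diff:
  assumes m: "1 \<le> m" "N = m + Suc i" and j: "j \<le> p ^ i"
  defines "c \<equiv> \<lambda>j. mu_coeff m (Suc i) (p * j) - mu_coeff m i j"
  shows "D (int (Suc i) * int (phi N)) (c j)"
    and "j * (p - 1) < p ^ i * (p - 2) \<Longrightarrow> D (int (Suc i) * int (phi N) + vpi m) (c j)"
proof -
  let ?b = "\<lambda>j. mu_coeff m (Suc i) j" and ?a = "\<lambda>j. mu_coeff m i j"
  let ?L = "int (Suc i) * int (phi N) + cden (Suc i)"
  have N2: "N \<ge> 2" and mN: "m \<le> N" "m + i \<le> N" "m + Suc i \<le> N" using m by auto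
  have n: "N - 1 = m + i" using m by simp
  obtain u where u: "u \<in> V" "pi (m + i) = pi N ^ p * (1 + rho * u)"
    using pi_step[OF N2] n by auto
  define \<theta> where "\<theta> = rho * u"
  have D\<theta>: "D (int (phi N) - int (p - 1)) \<theta>"
    unfolding \<theta>_def by (rule D_mult_V[OF U_D[OF U_rho] u(1)])
  have rV: "rho \<in> V" using D_mono[OF D_1_rho[OF N2], of 0] by (simp add: D_0_iff)
  have \<theta>V: "\<theta> \<in> V" unfolding \<theta>_def by (intro V_intros rV u)
  have "\<theta> ^ (p - 1) / of_nat p = rho ^ (p - 1) / of_nat p * u ^ (p - 1)"
    by (simp add: \<theta>_def power_mult_distrib)
  moreover have "rho ^ (p - 1) / of_nat p * u ^ (p - 1) \<in> V"
    by (intro V_intros(4) V_intros(8) rho_small[OF N2] u(1))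
  ultimately have \<theta>s: "\<theta> ^ (p - 1) / of_nat p \<in> V" by (simp only:)
  have Ub: "D ?L (?b k * pi N ^ k)" if k: "k \<le> p ^ Suc i" "\<not> p dvd k" for k
  proof -
    have "D (int (Suc i) * int (phi N) + int (p ^ (N - (m + Suc i))) * cden (Suc i))
        (of_nat k * ?b k * pi (m + Suc i) ^ k)"
      by (rule D_times_coeff_power[OF m(1) mN(3) k(1)])
    then have "D (0 + ?L) (of_nat k * (?b k * pi N ^ k))" by (simp add: m(2) mult.assoc)
    then show ?thesis by (rule D_cancel[OF U_of_nat[OF k(2)]])
  qed
  have "(\<Sum>k\<le>p ^ Suc i. ?b k * pi N ^ k) = 0"
    using root_mu[of m "Suc i"] m(2) by (simp add: poly_altdef degree_mu)
  then have sb: "(\<Sum>j\<le>p ^ i. ?b (p * j) * pi N ^ (p * j)) =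
      - (\<Sum>k | k \<le> p ^ Suc i \<and> \<not> p dvd k. ?b k * pi N ^ k)"
    unfolding sum_multiples by (simp add: eq_neg_iff_add_eq_0)
  have Db: "D ?L (\<Sum>j\<le>p ^ i. ?b (p * j) * pi N ^ (p * j))"
    unfolding sb by (intro D_uminus D_sum Ub) auto
  have Ua: "D ?L (?a j * pi (m + i) ^ j - ?a j * pi N ^ (p * j))" if j: "j \<le> p ^ i" for j
  proof (cases "j = 0")
    case False
    obtain d where d: "d \<in> V" "(1 + \<theta>) ^ j - 1 = of_nat j * \<theta> * d"
      using power_one_plus_small[OF \<theta>V \<theta>s, of j] False by blast
    have "?a j * pi (m + i) ^ j - ?a j * pi N ^ (p * j) = ?a j * pi N ^ (p * j) * ((1 + \<theta>) ^ j - 1)"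
      unfolding u(2) \<theta>_def power_mult power_mult_distrib right_diff_distrib by (simp add: mult_ac)
    \<comment> \<open>The factor j from \<open>power_one_plus_small\<close> completes
      \<open>?a j\<close> to the product for which a bound is known.\<close>
    also have "\<dots> = of_nat j * ?a j * pi N ^ (p * j) * (\<theta> * d)" unfolding d(2) by (simp add: mult_ac)
    finally have eq: "?a j * pi (m + i) ^ j - ?a j * pi N ^ (p * j) = \<dots>" .
    have "D (int i * int (phi N) + int (p ^ (N - (m + i))) * cden i - int j * vpi (m + i)) (of_nat j * ?a j)"
    proof (rule D_cancel[OF U_power[OF U_vpi]])
      show "D (int j * vpi (m + i) + (int i * int (phi N) + int (p ^ (N - (m + i))) * cden i - int j * vpi (m + i)))
          (pi (m + i) ^ j * (of_nat j * ?a j))"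
        using D_times_coeff_power[OF m(1) mN(2) j] by (simp add: mult_ac)
    qed (use m in auto)
    moreover have "D (int (p * j) * vpi N) (pi N ^ (p * j))"
      by (intro U_D U_power U_vpi) (use N in auto)
    ultimately have "D (int i * int (phi N) + int (p ^ (N - (m + i))) * cden i - int j * vpi (m + i)
        + int (p * j) * vpi N + (int (phi N) - int (p - 1))) (of_nat j * ?a j * pi N ^ (p * j) * (\<theta> * d))"
      by (intro D_mult D_mult_V[OF D\<theta>] d)
    \<comment> \<open>Both equations have errors of the same order, because p times
      \<open>cden i\<close> minus p - 1 is \<open>cden (Suc i)\<close>.\<close>
    moreover have "int i * int (phi N) + int (p ^ (N - (m + i))) * cden i - int j * vpi (m + i)
        + int (p * j) * vpi N + (int (phi N) - int (p - 1)) = ?L"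
    proof -
      have v: "vpi (m + i) = int p * vpi N" using vpi_add[of "m + i" 1] m by simp
      have "N - (m + i) = 1" using m by simp
      then have q: "int (p ^ (N - (m + i))) = int p" by simp
      have p1: "int (p - 1) = int p - 1" using p3 by simp
      define b where "b = int (p - 2)"
      show ?thesis unfolding v q p1 cden_def b_def[symmetric] by (simp add: algebra_simps)
    qed
    ultimately show ?thesis unfolding eq by metis
  qed simp
  have "(\<Sum>j\<le>p ^ i. ?a j * pi (m + i) ^ j) = 0"
    using root_mu[of m i] by (simp add: poly_altdef degree_mu)
  then have eq: "(\<Sum>j\<le>p ^ i. c j * pi N ^ (p * j)) =
      (\<Sum>j\<le>p ^ i. ?b (p * j) * pi N ^ (p * j)) + (\<Sum>j\<le>p ^ i. ?a j * pi (m + i) ^ j - ?a j * pi N ^ (p * j))"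
    by (simp add: c_def sum.distrib sum_subtractf left_diff_distrib)
  have Dc: "D ?L (\<Sum>j\<le>p ^ i. c j * pi N ^ (p * j))"
    unfolding eq by (intro D_add Db D_sum Ua) simp
  have cE: "c j \<in> E m" for j
    unfolding c_def by (intro is_subring_diff[OF is_subring_E[OF m(1)]] coeff_mu_E m)
  have c0: "c 0 = 0" using coeff_mu_0[OF m(1)] by (simp add: c_def)
  \<comment> \<open>The coefficients are spread over the multiples of p among the exponents up to
    p^(i + 1), so that \<open>E_poly_D\<close> separates the terms.\<close>
  define e where "e k = (if p dvd k then c (k div p) else 0)" for k
  have "(\<Sum>k\<le>p ^ Suc i. e k * pi N ^ k) = (\<Sum>j\<le>p ^ i. c j * pi N ^ (p * j))"
    unfolding sum_multiples using p3 by (simp add: e_def)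
  then have De: "D ?L (\<Sum>k\<le>p ^ Suc i. e k * pi (m + Suc i) ^ k)" using Dc m(2) by simp
  have eE: "e k \<in> E m" "e 0 = 0" for k
    using cE c0 is_subring_0[OF is_subring_E[OF m(1)]] by (auto simp: e_def)
  have "D ?L (e (p * j) * pi (m + Suc i) ^ (p * j))"
    by (rule E_poly_D[OF m(1) mN(3) eE De]) (use j in simp)
  then have "D ?L (pi N ^ (p * j) * c j)" using p3 m(2) by (simp add: e_def mult.commute)
  then have "D (int (p * j) * vpi N + (?L - int (p * j) * vpi N)) (pi N ^ (p * j) * c j)" by simp
  then have "D (?L - int (p * j) * vpi N) (c j)"
    by (rule D_cancel[OF U_power[OF U_vpi], rotated -1]) (use N in auto)
  then have D: "D (int (Suc i * p ^ (m - 1)) * vpi m + (cden (Suc i) - int (p * j) * int (p - 1))) (c j)"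
    unfolding phi_multiple[OF m(1) mN(1)] by (simp add: vpi_eq algebra_simps)
  have vm: "vpi m = int (p ^ Suc i) * int (p - 1)" using vpi_split[OF mN(3)] m(2) by simp
  let ?K = "int (Suc i * p ^ (m - 1))"
  have "p * j \<le> p ^ Suc i" using j by simp
  then have "int (p * j) * int (p - 1) \<le> int (p ^ Suc i) * int (p - 1)"
    by (intro mult_right_mono) (auto simp del: of_nat_power of_nat_mult)
  then have "- vpi m < cden (Suc i) - int (p * j) * int (p - 1)"
    unfolding vm using cden_pos[of "Suc i"] by linarith
  moreover have "(K - 1) * v < K * v + d" if "- v < d" for K v d :: int
    using that by (simp add: left_diff_distrib)
  ultimately have "D (?K * vpi m) (c j)" by (intro E_D_step[OF m(1) mN(1) cE D]) blast
  then show "D (int (Suc i) * int (phi N)) (c j)"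
    unfolding phi_multiple[OF m(1) mN(1)] .
  assume "j * (p - 1) < p ^ i * (p - 2)"
  then have "p * (j * (p - 1)) < p * (p ^ i * (p - 2))" using p3 by simp
  then have "int (p * (j * (p - 1))) < int (p * (p ^ i * (p - 2)))" by (simp only: of_nat_less_iff)
  moreover have "0 < c * (a * b) + 1 - a * e * d" if "a * (e * d) < a * (b * c)" for a b c d e :: int
    using that by (simp add: mult_ac)
  ultimately have "0 < int (p - 2) * (int p * int (p ^ i)) + 1 - int p * int j * int (p - 1)"
    unfolding of_nat_mult by blast
  then have "cden (Suc i) - int (p * j) * int (p - 1) > 0"
    unfolding cden_def power_Suc of_nat_mult .
  then have "D ((?K + 1) * vpi m) (c j)"
    by (intro E_D_step[OF m(1) mN(1) cE D]) simp
  then show "D (int (Suc i) * int (phi N) + vpi m) (c j)"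
    unfolding phi_multiple[OF m(1) mN(1)] by (simp add: distrib_right)
qed

text \<open>The subleading coefficient at the bottom of the tower, from the refined congruence
  \<open>p = pi 2 ^ p + p * pi 2 ^ (p - 1)\<close>; the other low coefficients are divisible by \<open>p\<^sup>2\<close>.\<close>

lemma D_subleading:
  assumes N: "N = 2"
  shows "D (2 * int (phi N)) (mu_coeff 1 1 (p - 1) - of_nat p)"
proof -
  let ?a = "\<lambda>j. mu_coeff 1 1 j"
  let ?P = "\<Prod>j\<in>{1..p - 1}. tw j"
  have phi: "phi N = p * (p - 1)" by (simp add: phi_def N)
  have vpi1: "vpi 1 = int (phi N)" using phi_vpi[of 1] N by simp
  have "N - 2 = 0" using N by simp
  then have vpi2: "vpi 2 = int (p - 1)" using vpi_eq[of 2] by simp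
  obtain u where u: "u \<in> V" "D 1 (u + 1)" "pi 1 = pi 2 ^ p * (1 + rho * u)"
    using pi_step N by auto
  have low: "D (2 * int (phi N)) (?a j)" if j: "j \<in> {1..p - 2}" for j
  proof -
    have "j * (p - 1) < p ^ 1 * (p - 2)"
    proof -
      have "j * (p - 1) \<le> (p - 2) * (p - 1)" using j by (intro mult_right_mono) auto
      also have "\<dots> < (p - 2) * p" using p3 by (intro mult_strict_left_mono) auto
      finally show ?thesis by (simp add: mult.commute)
    qed
    then have "D (int 1 * int (phi N) + vpi 1) (of_nat j * ?a j)"
      using j by (intro D_times_coeff_multiple(2)) (auto simp: N)
    moreover have "int 1 * int (phi N) + vpi 1 = 0 + 2 * int (phi N)" unfolding vpi1 by simp
    ultimately have "D (0 + 2 * int (phi N)) (of_nat j * ?a j)" by (simp only:)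
    then show ?thesis
      by (rule D_cancel[OF U_of_nat[OF not_dvd_small], rotated]) (use j in auto)
  qed
  define S where "S = (\<Sum>j\<in>{1..p - 2}. ?a j * pi 2 ^ j)"
  have "(2 :: nat) \<le> N" using N by simp
  from U_D[OF U_vpi[OF _ this]] have "D 0 (pi 2)"
    by (rule D_mono) (use vpi_pos[of 2] in simp_all)
  then have "pi 2 \<in> V" by (simp only: D_0_iff)
  then have DS: "D (2 * int (phi N)) S"
    unfolding S_def by (intro D_sum D_mult_V low V_intros)
  have set: "{..p} = insert 0 (insert p (insert (p - 1) {1..p - 2}))" using p3 by auto
  have "(\<Sum>j\<le>p. ?a j * pi 2 ^ j) = 0"
    using root_mu[of 1 1] by (simp add: poly_altdef degree_mu numeral_2_eq_2)
  then have "?a 0 + (?a p * pi 2 ^ p + (?a (p - 1) * pi 2 ^ (p - 1) + S)) = 0"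
    unfolding set S_def using p3 by (subst (asm) sum.insert; (subst (asm) sum.insert)?; (subst (asm) sum.insert)?) auto
  moreover have "?a 0 = - pi 1" "?a p = 1" using coeff_mu_0[of 1 1] coeff_mu_degree[of 1 1] by simp_all
  ultimately have "- pi 1 + (1 * pi 2 ^ p + (?a (p - 1) * pi 2 ^ (p - 1) + S)) = 0" by (simp only:)
  moreover have "a = b - c - d" if "- b + (1 * c + (a + d)) = 0" for a b c d :: 'a
  proof -
    have "a = (- b + (1 * c + (a + d))) + (b - c - d)" by simp
    then show ?thesis unfolding that by simp
  qed
  ultimately have "?a (p - 1) * pi 2 ^ (p - 1) = pi 1 - pi 2 ^ p - S" by blast
  then have eq1: "(?a (p - 1) - of_nat p) * pi 2 ^ (p - 1) = (pi 2 ^ p * (rho * u) - of_nat p * pi 2 ^ (p - 1)) - S"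
    unfolding u(3) by (simp add: algebra_simps)
  \<comment> \<open>\<open>pi 2 ^ p * rho\<close> is \<open>of_nat p * pi 2 ^ (p - 1)\<close> times
    the unit \<open>?P\<close>. Both \<open>?P\<close> and u are congruent to -1, so
    \<open>?P * u - 1\<close> is small.\<close>
  have eq2: "pi 2 ^ p * (rho * u) - of_nat p * pi 2 ^ (p - 1) = of_nat p * pi 2 ^ (p - 1) * (?P * u - 1)"
  proof -
    have "pi 2 ^ p = pi 2 ^ (p - 1) * ((\<zeta> N - 1) ^ (p - 1) * ?P)"
      using p3 pi_tw N by (simp flip: power_Suc2)
    then have "pi 2 ^ p * (rho * u) = pi 2 ^ (p - 1) * (of_nat p * ?P * u)"
      using x0 by (simp add: rho_def)
    then show ?thesis by (simp add: algebra_simps)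
  qed
  have "D 1 (?P * u - 1)"
  proof -
    have "D 1 ((?P + 1) * u - (u + 1))" by (intro D_diff D_mult_V prod_tw_cong u)
    then show ?thesis by (simp add: algebra_simps)
  qed
  then have "D (int (phi N) + int (p - 1) * vpi 2 + 1) (of_nat p * pi 2 ^ (p - 1) * (?P * u - 1))"
    by (intro D_mult U_D[OF U_p] U_D[OF U_power[OF U_vpi]]) (auto simp: N)
  moreover have "D (int (phi N) + int (p - 1) * vpi 2 + 1) S"
  proof (rule D_mono[OF DS])
    have "int (p - 1) * int (p - 1) + 1 \<le> int p * int (p - 1)"
      using p3 by (simp add: of_nat_diff algebra_simps)
    then show "int (phi N) + int (p - 1) * vpi 2 + 1 \<le> 2 * int (phi N)"
      unfolding phi vpi2 of_nat_mult by linarith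
  qed
  ultimately have "D (int (phi N) + int (p - 1) * vpi 2 + 1) ((?a (p - 1) - of_nat p) * pi 2 ^ (p - 1))"
    unfolding eq1 eq2 by (rule D_diff)
  then have "D (int (p - 1) * vpi 2 + (int (phi N) + 1)) (pi 2 ^ (p - 1) * (?a (p - 1) - of_nat p))"
    by (simp add: algebra_simps)
  then have D: "D (int (phi N) + 1) (?a (p - 1) - of_nat p)"
    by (rule D_cancel[OF U_power[OF U_vpi], rotated -1]) (auto simp: N)
  have "?a (p - 1) - of_nat p \<in> E 1"
    using coeff_mu_E[of 1 1 "p - 1"] of_nat_p_power_E[of 1 1] is_subring_diff[OF is_subring_E[of 1]] by simp
  moreover have "1 \<le> N" using N by simp
  \<comment> \<open>Exceeding the value of p by 1 is enough: values on \<open>E 1\<close> are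
    multiples of \<open>phi N\<close>, so the next possible one is that of p^2.\<close>
  moreover have "(2 - 1) * vpi 1 < int (phi N) + 1" unfolding vpi1 by simp
  ultimately have "D (2 * vpi 1) (?a (p - 1) - of_nat p)"
    by (intro E_D_step[OF order_refl _ _ D])
  then show ?thesis unfolding vpi1 .
qed

end

section \<open>Divisibility and congruences\<close>

context cyclotomic_tower
begin

lemma a_coeff_eq: "m \<ge> 1 \<Longrightarrow> a_coeff p \<zeta> m i j = mu_coeff m i j"
  by (simp add: a_coeff_def min_poly_eq_mu)

lemma coeff_diff_E: "m \<ge> 1 \<Longrightarrow> mu_coeff m i j - mu_coeff m k l \<in> E m"
  by (intro is_subring_diff is_subring_E coeff_mu_E)

lemma p_power_pi_E: "m \<ge> 1 \<Longrightarrow> of_nat (p ^ k) * pi m \<in> E m"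
  using is_subring_mult[OF is_subring_E] E_rat[of m "of_nat (p ^ k)"] pi_E[of m m]
  unfolding of_rat_of_nat_eq by blast

text \<open>The conclusion does not depend on the level m + i + 1 at which it is proved; this allows
  steps for different i to be compared at one level.\<close>

lemma coeff_step_divides:
  assumes m: "m \<ge> 1" and j: "j \<le> p ^ i"
  defines "y \<equiv> mu_coeff m (Suc i) (p * j) - mu_coeff m i j"
  shows "of_nat (p ^ Suc i) divides\<^bsub>Z_pi_ring p \<zeta> m\<^esub> y"
    and "j * (p - 1) < p ^ i * (p - 2) \<Longrightarrow> (of_nat (p ^ Suc i) * pi m) divides\<^bsub>Z_pi_ring p \<zeta> m\<^esub> y"
proof -
  let ?N = "m + Suc i"
  have n: "?N \<ge> 1" using m by simp
  obtain V where "cyclotomic_level p \<zeta> V ?N" using exists_level[OF n] by auto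
  then interpret cyclotomic_level p \<zeta> V ?N .
  have mN: "m \<le> ?N" by simp
  note D = D_coeff_diff[OF m refl j]
  show "of_nat (p ^ Suc i) divides\<^bsub>Z_pi_ring p \<zeta> m\<^esub> y"
    unfolding y_def
    by (rule divides_Z_pi_ringI[OF m mN of_nat_p_power_E[OF m] U_p_power coeff_diff_E[OF m] D(1)])
  show "(of_nat (p ^ Suc i) * pi m) divides\<^bsub>Z_pi_ring p \<zeta> m\<^esub> y" if "j * (p - 1) < p ^ i * (p - 2)"
    unfolding y_def
    by (rule divides_Z_pi_ringI[OF m mN p_power_pi_E[OF m]
          U_mult[OF U_p_power U_vpi[OF m mN]] coeff_diff_E[OF m] D(2)[OF that]])
qed

lemma subleading_divides:
  "of_nat (p ^ 2) divides\<^bsub>Z_pi_ring p \<zeta> 1\<^esub> (mu_coeff 1 1 (p - 1) - of_nat p)"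
proof -
  obtain V where "cyclotomic_level p \<zeta> V 2" using exists_level[of 2] by auto
  then interpret cyclotomic_level p \<zeta> V 2 .
  have "mu_coeff 1 1 (p - 1) - of_nat p \<in> E 1"
    using coeff_mu_E[of 1 1 "p - 1"] of_nat_p_power_E[of 1 1] is_subring_diff[OF is_subring_E[of 1]] by simp
  moreover have "D (int 2 * int (phi 2)) (mu_coeff 1 1 (p - 1) - of_nat p)"
    using D_subleading by simp
  ultimately show ?thesis
    by (intro divides_Z_pi_ringI[OF _ _ of_nat_p_power_E U_p_power]) auto
qed

lemma E_1: "E 1 = \<rat>"
proof (intro equalityI subsetI)
  fix y assume "y \<in> E 1"
  from E_span[OF order_refl this] obtain r where "y = (\<Sum>k<p ^ (1 - 1). of_rat (r k) * pi 1 ^ k)" by blast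
  then show "y \<in> \<rat>" by simp
next
  fix y :: 'a assume "y \<in> \<rat>"
  then show "y \<in> E 1" using E_rat[of 1] by (auto simp: Rats_of_rat)
qed

text \<open>\<open>E 1\<close> consists of the rationals, which \<open>V\<close> meets in the
  localization.\<close>

lemma Z_pi_ring_1: "Z_pi_ring p \<zeta> 1 = subring_on (Z_localized p)"
proof -
  obtain V where "cyclotomic_level p \<zeta> V 1" using exists_level[of 1] by auto
  then interpret cyclotomic_level p \<zeta> V 1 .
  have "E 1 \<inter> V = Z_localized p"
  proof (intro equalityI subsetI)
    fix y assume "y \<in> E 1 \<inter> V"
    then show "y \<in> Z_localized p" using V_rat_localized unfolding E_1 by (auto simp: Rats_of_rat)
  next
    fix y :: 'a assume y: "y \<in> Z_localized p"
    then have "y \<in> \<rat>" by (auto simp: Z_localized_def)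
    then show "y \<in> E 1 \<inter> V" using y Z_localized_subset E_1 by blast
  qed
  then have "carrier (Z_pi_ring p \<zeta> 1) = Z_localized p" using carrier_Z_pi_ring[of 1] by simp
  then show ?thesis by (simp add: Z_pi_ring_def)
qed

lemma mu_sum:
  assumes m: "m \<ge> 1" and i: "i \<ge> 1"
  shows "mu m i = (\<Sum>j = 0..p ^ i. Polynomial.monom (mu_coeff m i j) j)"
    and "mu m i = Polynomial.monom 1 (p ^ i) +
      (\<Sum>j = 1..p ^ i - 1. Polynomial.monom (mu_coeff m i j) j) - [:pi m:]"
proof -
  show 1: "mu m i = (\<Sum>j = 0..p ^ i. Polynomial.monom (mu_coeff m i j) j)"
    using poly_as_sum_of_monoms'[of "mu m i" "p ^ i"] by (simp add: degree_mu atLeast0AtMost)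
  have "p ^ i > 0" using p3 by simp
  then have set: "{0..p ^ i} = insert 0 (insert (p ^ i) {1..p ^ i - 1})" by auto
  have "(\<Sum>j = 0..p ^ i. Polynomial.monom (mu_coeff m i j) j) =
      Polynomial.monom (- pi m) 0 + (Polynomial.monom 1 (p ^ i) +
      (\<Sum>j = 1..p ^ i - 1. Polynomial.monom (mu_coeff m i j) j))"
  proof -
    have "M \<notin> {1..M - 1} \<and> 0 \<notin> insert M {1..M - 1}" if "M > 0" for M :: nat
      using that by auto
    from this[OF \<open>p ^ i > 0\<close>]
    have "p ^ i \<notin> {1..p ^ i - 1}" "0 \<notin> insert (p ^ i) {1..p ^ i - 1}" by blast+
    then show ?thesis
      unfolding set by (simp add: coeff_mu_0[OF m] coeff_mu_degree del: One_nat_def)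
  qed
  moreover have "[:- pi m:] + q = q - [:pi m:]" for q by simp
  ultimately show "mu m i = Polynomial.monom 1 (p ^ i) +
      (\<Sum>j = 1..p ^ i - 1. Polynomial.monom (mu_coeff m i j) j) - [:pi m:]"
    unfolding 1[symmetric] monom_0 by (simp only:)
qed

lemma real_bound_iff:
  "real j < real (p ^ i) * (real p - 2) / (real p - 1) \<longleftrightarrow> j * (p - 1) < p ^ i * (p - 2)"
proof -
  have "real p - 1 > 0" using p3 by simp
  then have "real j < real (p ^ i) * (real p - 2) / (real p - 1) \<longleftrightarrow>
      real j * (real p - 1) < real (p ^ i) * (real p - 2)"
    by (rule pos_less_divide_eq)
  also have "\<dots> \<longleftrightarrow> real (j * (p - 1)) < real (p ^ i * (p - 2))"
    using p3 by (simp add: of_nat_diff)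
  finally show ?thesis by (simp only: of_nat_less_iff)
qed

end

section \<open>Chaining the steps, and the statements over the rings\<close>

context cyclotomic_level
begin

text \<open>Telescoping over \<beta>: later steps hold modulo higher powers of p, so the precision
  of the first one survives.\<close>

lemma D_coeff_step:
  assumes m: "1 \<le> m" "m \<le> N" and j: "j \<le> p ^ i"
  shows "D (int (Suc i) * int (phi N)) (mu_coeff m i j - mu_coeff m (i + \<beta>) (p ^ \<beta> * j))"
    and "j * (p - 1) < p ^ i * (p - 2) \<Longrightarrow> D (int (Suc i) * int (phi N) + vpi m)
      (mu_coeff m i j - mu_coeff m (i + \<beta>) (p ^ \<beta> * j))"
proof -
  let ?a = "\<lambda>i j. mu_coeff m i j"
  have jb: "p ^ \<beta> * j \<le> p ^ (i + \<beta>)" for \<beta> using j by (simp add: power_add mult.commute)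
  have mono: "int (Suc i) * int (phi N) \<le> int (Suc (i + \<beta>)) * int (phi N)" for \<beta>
    by (intro mult_right_mono) auto
  have split: "?a i j - ?a (i + Suc \<beta>) (p ^ Suc \<beta> * j) =
      (?a i j - ?a (i + \<beta>) (p ^ \<beta> * j)) - (?a (Suc (i + \<beta>)) (p * (p ^ \<beta> * j)) - ?a (i + \<beta>) (p ^ \<beta> * j))" for \<beta>
    by (simp add: mult.assoc)
  show "D (int (Suc i) * int (phi N)) (?a i j - ?a (i + \<beta>) (p ^ \<beta> * j))"
  proof (induction \<beta>)
    case (Suc \<beta>)
    have "D (int (Suc (i + \<beta>)) * int (phi N)) (?a (Suc (i + \<beta>)) (p * (p ^ \<beta> * j)) - ?a (i + \<beta>) (p ^ \<beta> * j))"
      by (rule divides_Z_pi_ringD[OF m U_p_power coeff_step_divides(1)[OF m(1) jb]])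
    from D_diff[OF Suc D_mono[OF this mono]] show ?case unfolding split .
  qed simp
  assume jl: "j * (p - 1) < p ^ i * (p - 2)"
  have jl': "p ^ \<beta> * j * (p - 1) < p ^ (i + \<beta>) * (p - 2)" for \<beta>
  proof -
    have "p ^ \<beta> * (j * (p - 1)) < p ^ \<beta> * (p ^ i * (p - 2))" using jl p3 by simp
    then show ?thesis by (simp only: power_add mult_ac)
  qed
  show "D (int (Suc i) * int (phi N) + vpi m) (?a i j - ?a (i + \<beta>) (p ^ \<beta> * j))"
  proof (induction \<beta>)
    case (Suc \<beta>)
    have "D (int (Suc (i + \<beta>)) * int (phi N) + vpi m) (?a (Suc (i + \<beta>)) (p * (p ^ \<beta> * j)) - ?a (i + \<beta>) (p ^ \<beta> * j))"
      by (rule divides_Z_pi_ringD[OF m U_mult[OF U_p_power U_vpi[OF m]] coeff_step_divides(2)[OF m(1) jb jl']])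
    from D_diff[OF Suc D_mono[OF this add_right_mono[OF mono]]] show ?case unfolding split .
  qed simp
qed

end

context cyclotomic_tower
begin

lemma coeff_carrier:
  assumes m: "m \<ge> 1"
  shows "mu_coeff m i k \<in> carrier (Z_pi_ring p \<zeta> m)"
proof -
  obtain V where "cyclotomic_level p \<zeta> V (m + i)" using exists_level[of "m + i"] m by auto
  then interpret cyclotomic_level p \<zeta> V "m + i" .
  show ?thesis using coeff_mu_V[OF m] coeff_mu_E[OF m] carrier_Z_pi_ring[OF m] by simp
qed

lemma coeff_divisibility:
  assumes m: "m \<ge> 1" and j: "j \<le> p ^ i"
  shows "of_nat (p ^ i) divides\<^bsub>Z_pi_ring p \<zeta> m\<^esub> (of_nat j * mu_coeff m i j)"
    and "j * (p - 1) < p ^ i * (p - 2) \<Longrightarrow>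
      (of_nat (p ^ i) * pi m) divides\<^bsub>Z_pi_ring p \<zeta> m\<^esub> (of_nat j * mu_coeff m i j)"
proof -
  obtain V where "cyclotomic_level p \<zeta> V (m + i)" using exists_level[of "m + i"] m by auto
  then interpret cyclotomic_level p \<zeta> V "m + i" .
  have mN: "m \<le> m + i" by simp
  note D = D_times_coeff_multiple[OF m order_refl j]
  show "of_nat (p ^ i) divides\<^bsub>Z_pi_ring p \<zeta> m\<^esub> (of_nat j * mu_coeff m i j)"
    by (rule divides_Z_pi_ringI[OF m mN of_nat_p_power_E[OF m] U_p_power times_coeff_E[OF m] D(1)])
  show "(of_nat (p ^ i) * pi m) divides\<^bsub>Z_pi_ring p \<zeta> m\<^esub> (of_nat j * mu_coeff m i j)"
    if "j * (p - 1) < p ^ i * (p - 2)"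
    by (rule divides_Z_pi_ringI[OF m mN p_power_pi_E[OF m]
          U_mult[OF U_p_power U_vpi[OF m mN]] times_coeff_E[OF m] D(2)[OF that]])
qed

lemma coeff_congruence:
  assumes m: "m \<ge> 1" and j: "j \<le> p ^ i"
  shows "cong_in (Z_pi_ring p \<zeta> m) (of_nat (p ^ (i + 1)))
      (mu_coeff m i j) (mu_coeff m (i + \<beta>) (p ^ \<beta> * j))"
    and "j * (p - 1) < p ^ i * (p - 2) \<Longrightarrow> cong_in (Z_pi_ring p \<zeta> m) (of_nat (p ^ (i + 1)) * pi m)
      (mu_coeff m i j) (mu_coeff m (i + \<beta>) (p ^ \<beta> * j))"
proof -
  obtain V where "cyclotomic_level p \<zeta> V m" using exists_level[OF m] m by auto
  then interpret cyclotomic_level p \<zeta> V m .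
  note D = D_coeff_step[OF m order_refl j, of \<beta>]
  have e: "i + 1 = Suc i" by simp
  show "cong_in (Z_pi_ring p \<zeta> m) (of_nat (p ^ (i + 1)))
      (mu_coeff m i j) (mu_coeff m (i + \<beta>) (p ^ \<beta> * j))"
    unfolding cong_in_def e
    by (intro conjI coeff_carrier m
        divides_Z_pi_ringI[OF m order_refl of_nat_p_power_E[OF m] U_p_power coeff_diff_E[OF m] D(1)])
  show "cong_in (Z_pi_ring p \<zeta> m) (of_nat (p ^ (i + 1)) * pi m)
      (mu_coeff m i j) (mu_coeff m (i + \<beta>) (p ^ \<beta> * j))"
    if "j * (p - 1) < p ^ i * (p - 2)"
    unfolding cong_in_def e
    by (intro conjI coeff_carrier m
        divides_Z_pi_ringI[OF m order_refl p_power_pi_E[OF m]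
          U_mult[OF U_p_power U_vpi[OF m order_refl]] coeff_diff_E[OF m] D(2)[OF that]])
qed

text \<open>The index is \<open>p ^ \<beta>\<close> times the extremal exponent for l = i - \<beta>.
  A congruence modulo p^(l + 1) preserves the value of p^l found in
  \<open>U_extremal_coeff\<close>.\<close>

lemma coeff_unit:
  assumes m: "m \<ge> 1" and \<beta>: "\<beta> < i"
  shows "mu_coeff m i (p ^ i - (p ^ i - p ^ \<beta>) div (p - 1)) / of_nat (p ^ (i - \<beta>))
    \<in> Units (Z_pi_ring p \<zeta> m)"
proof -
  define l where "l = i - \<beta>"
  have i: "i = l + \<beta>" and l: "l \<ge> 1" using \<beta> by (auto simp: l_def)
  obtain V where "cyclotomic_level p \<zeta> V (m + i)" using exists_level[of "m + i"] m by auto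
  then interpret cyclotomic_level p \<zeta> V "m + i" .
  have mN: "m \<le> m + i" "m + l \<le> m + i" using i by auto
  define j where "j = p ^ l - (p ^ l - 1) div (p - 1)"
  have j: "j \<le> p ^ l" by (simp add: j_def)
  have idx: "p ^ i - (p ^ i - p ^ \<beta>) div (p - 1) = p ^ \<beta> * j"
  proof -
    have "int p - 1 dvd int p ^ l - 1" using power_diff_1_eq[of "int p" l] by simp
    moreover have "int (p - 1) = int p - 1" "int (p ^ l - 1) = int p ^ l - 1"
      using p3 of_nat_diff[of 1 "p ^ l", where 'a = int] by simp_all
    ultimately have "int (p - 1) dvd int (p ^ l - 1)" by simp
    then have "p - 1 dvd p ^ l - 1" by (simp only: of_nat_dvd_iff)
    moreover have "p ^ i - p ^ \<beta> = p ^ \<beta> * (p ^ l - 1)" by (simp add: i power_add diff_mult_distrib2 mult.commute)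
    ultimately have "(p ^ i - p ^ \<beta>) div (p - 1) = p ^ \<beta> * ((p ^ l - 1) div (p - 1))"
      by (simp only: div_mult_swap)
    then show ?thesis by (simp add: j_def i power_add diff_mult_distrib2 mult.commute)
  qed
  have U: "U (int l * int (phi (m + i))) (mu_coeff m l j)"
    unfolding j_def by (rule U_extremal_coeff[OF m mN(2) l])
  have "D (int (Suc l) * int (phi (m + i)))
      (mu_coeff m l j - mu_coeff m (l + \<beta>) (p ^ \<beta> * j))"
    by (rule D_coeff_step(1)[OF m mN(1) j])
  then have "D (int l * int (phi (m + i)) + 1)
      (mu_coeff m l j - mu_coeff m (l + \<beta>) (p ^ \<beta> * j))"
    by (rule D_mono) (use phi_pos[of "m + i"] in \<open>simp add: algebra_simps\<close>)
  from D_uminus[OF this] have "D (int l * int (phi (m + i)) + 1)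
      (mu_coeff m i (p ^ \<beta> * j) - mu_coeff m l j)"
    by (simp add: i)
  from U_cong[OF U this] have "U (int l * int (phi (m + i)) - int l * int (phi (m + i)))
      (mu_coeff m i (p ^ \<beta> * j) / of_nat (p ^ l))"
    by (rule U_divide[OF _ U_p_power])
  then have "U 0 (mu_coeff m i (p ^ \<beta> * j) / of_nat (p ^ l))" by simp
  moreover have "mu_coeff m i (p ^ \<beta> * j) / of_nat (p ^ l) \<in> E m"
    unfolding divide_inverse
    by (intro is_subring_mult[OF is_subring_E[OF m]] coeff_mu_E m E_inverse of_nat_p_power_E)
  ultimately show ?thesis
    unfolding idx l_def[symmetric] by (rule Units_Z_pi_ringI[OF m mN(1), rotated])
qed

text \<open>Exponents 0 and from p^i on are exact. For an inner k not divisible by p^(i - 1),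
  divisibility of k times the coefficient by p^i suffices; the multiples of p^(i - 1) are compared
  with the case i = 1.\<close>

lemma D_coeff_base:
  assumes "cyclotomic_level p \<zeta> V (1 + i)" and i: "i \<ge> 1"
  shows "uniformized_subring.D V (\<zeta> (1 + i) - 1) (2 * int (phi (1 + i)))
    (mu_coeff 1 i k -
      Polynomial.coeff (Polynomial.monom 1 (p ^ i) + Polynomial.monom (of_nat p) ((p - 1) * p ^ (i - 1)) - [:of_nat p:]) k)"
    (is "uniformized_subring.D V _ _ (?a k - ?c k)")
proof -
  interpret cyclotomic_level p \<zeta> V "1 + i" by fact
  have e1: "(p - 1) * p ^ (i - 1) < p ^ i" and e0: "(p - 1) * p ^ (i - 1) > 0"
    using i p3 by (cases i; simp)+
  have c: "?c k = (if k = p ^ i then 1 else 0) + (if k = (p - 1) * p ^ (i - 1) then of_nat p else 0)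
      - (if k = 0 then of_nat p else 0)" for k
    by (simp add: coeff_pCons split: nat.split)
  have mN: "1 \<le> 1 + i" "1 + i \<le> 1 + i" by auto
  consider "k > p ^ i" | "k = p ^ i" | "k = 0" | "0 < k" "k < p ^ i" by linarith
  then show ?thesis
  proof cases
    case 1
    then have "?a k = 0" by (intro coeff_eq_0) (simp add: degree_mu)
    moreover have "?c k = 0" unfolding c using 1 e1 by auto
    ultimately show ?thesis by (simp only: diff_self D_0)
  next
    case 2
    then have "?c k = 1" unfolding c using e1 p3 by auto
    moreover have "?a k = 1" using 2 by (simp add: coeff_mu_degree)
    ultimately show ?thesis by (simp only: diff_self D_0)
  next
    case 3
    then have "?c k = - of_nat p" unfolding c using e0 p3 by auto
    moreover have "?a k = - of_nat p" using 3 coeff_mu_0[of 1 i] pi_1 by simp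
    ultimately show ?thesis by (simp only: diff_self D_0)
  next
    case 4
    show ?thesis
    proof (cases "p ^ (i - 1) dvd k")
      case False
      have "?c k = 0" unfolding c using 4 False by auto
      have "\<not> is_unit p" using p3 by simp
      then obtain d where d: "k = p ^ multiplicity p k * d" "\<not> p dvd d"
        using multiplicity_decompose'[of k p] 4 by auto
      let ?f = "multiplicity p k"
      \<comment> \<open>At least p^2 of the factor p^i then falls to the coefficient, since k takes
        up only p^f.\<close>
      have f: "?f + 2 \<le> i"
      proof (rule ccontr)
        assume "\<not> ?f + 2 \<le> i"
        then have "p ^ (i - 1) dvd p ^ ?f" by (intro le_imp_power_dvd) auto
        then show False using False d(1) by (metis dvd_mult2)
      qed
      have "U (int ?f * int (phi (1 + i)) + 0) (of_nat (p ^ ?f) * of_nat d)"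
        by (intro U_mult U_p_power U_of_nat d)
      then have Uk: "U (int ?f * int (phi (1 + i))) (of_nat k)"
        by (subst d(1)) simp
      have "D (int i * int (phi (1 + i))) (of_nat k * ?a k)"
        using 4 by (intro D_times_coeff_multiple(1)) auto
      moreover have "int i * int (phi (1 + i)) =
          int ?f * int (phi (1 + i)) + (int i - int ?f) * int (phi (1 + i))" by (simp add: algebra_simps)
      ultimately have "D ((int i - int ?f) * int (phi (1 + i))) (?a k)"
        using D_cancel[OF Uk] by metis
      then have "D (2 * int (phi (1 + i))) (?a k)"
        by (rule D_mono) (use f in \<open>intro mult_right_mono; simp\<close>)
      then show ?thesis using \<open>?c k = 0\<close> by simp
    next
      case True
      then obtain j where k: "k = p ^ (i - 1) * j" by blast
      have pi: "p ^ i = p ^ (i - 1) * p" using i by (cases i) auto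
      have j: "j \<in> {1..p - 1}" using 4 p3 unfolding k pi by auto
      have cj: "?c k = (if j = p - 1 then of_nat p else 0)"
        unfolding c using 4 p3 by (auto simp: k)
      have jp: "j \<le> p ^ 1" using j by auto
      have "D (int (Suc 1) * int (phi (1 + i))) (mu_coeff 1 1 j - Polynomial.coeff (mu 1 (1 + (i - 1))) (p ^ (i - 1) * j))"
        by (rule D_coeff_step(1)[OF _ _ jp]) auto
      then have s: "D (2 * int (phi (1 + i))) (mu_coeff 1 1 j - ?a k)" using i by (simp add: k)
      have b: "D (2 * int (phi (1 + i))) (mu_coeff 1 1 j - ?c k)"
      proof (cases "j = p - 1")
        case True
        have "D (int 2 * int (phi (1 + i))) (mu_coeff 1 1 (p - 1) - of_nat p)"
          by (rule divides_Z_pi_ringD[OF _ _ U_p_power subleading_divides]) auto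
        then show ?thesis using True cj by simp
      next
        case False
        have "j * (p - 1) \<le> (p - 2) * (p - 1)" using j False by (intro mult_right_mono) auto
        also have "\<dots> < (p - 2) * p" using p3 by (intro mult_strict_left_mono) auto
        finally have "j * (p - 1) < p ^ 1 * (p - 2)" by (simp add: mult.commute)
        then have "D (int 1 * int (phi (1 + i)) + vpi 1) (of_nat j * mu_coeff 1 1 j)"
          using jp i by (intro D_times_coeff_multiple(2)) auto
        moreover have "int 1 * int (phi (1 + i)) + vpi 1 = 0 + 2 * int (phi (1 + i))"
          using phi_vpi[of 1] by simp
        ultimately have "D (0 + 2 * int (phi (1 + i))) (of_nat j * mu_coeff 1 1 j)" by (simp only:)
        from D_cancel[OF U_of_nat[OF not_dvd_small[OF j]] this] show ?thesis using False cj by simp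
      qed
      have "D (2 * int (phi (1 + i))) (?a k - ?c k)" if "D (2 * int (phi (1 + i))) (x - ?c k)"
        "D (2 * int (phi (1 + i))) (x - ?a k)" for x
      proof -
        have "(x - y) - (x - z) = z - y" for y z :: 'a by simp
        then show ?thesis using D_diff[OF that] by (simp only:)
      qed
      then show ?thesis using b s by blast
    qed
  qed
qed

lemma min_poly_Rats_cong:
  assumes n: "n \<ge> 2"
  shows "cong_in (subring_on (Z_localized p)) (of_nat (p ^ 2)) (Polynomial.coeff (min_poly \<rat> (pi n)) k)
    (Polynomial.coeff (Polynomial.monom 1 (p ^ (n - 1)) + Polynomial.monom (of_nat p) ((p - 1) * p ^ (n - 2)) - [:of_nat p:]) k)"
    (is "cong_in _ _ _ (?c k)")
proof -
  define i where "i = n - 1"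
  have n': "n = 1 + i" "i \<ge> 1" "n - 2 = i - 1" using n by (auto simp: i_def)
  obtain V where level: "cyclotomic_level p \<zeta> V (1 + i)" using exists_level[of "1 + i"] by auto
  then interpret cyclotomic_level p \<zeta> V "1 + i" .
  have min: "min_poly \<rat> (pi n) = mu 1 i"
    using min_poly_eq_mu[of 1 i] unfolding E_1 n'(1) by simp
  have nat_E: "of_nat l \<in> E 1" for l using E_rat[of 1 "of_nat l"] by simp
  have sub: "is_subring (E 1)" by (rule is_subring_E) simp
  have cE: "?c k \<in> E 1" and cV: "?c k \<in> V"
    using nat_E[of p] is_subringD[OF sub] V_of_nat[of p] V_intros
    by (auto simp: coeff_pCons split: nat.split)
  have "of_nat (p ^ 2) divides\<^bsub>Z_pi_ring p \<zeta> 1\<^esub> (mu_coeff 1 i k - ?c k)"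
  proof (rule divides_Z_pi_ringI[OF _ _ of_nat_p_power_E U_p_power])
    show "D (int 2 * int (phi (1 + i))) (mu_coeff 1 i k - ?c k)"
      using D_coeff_base[OF level n'(2), of k] unfolding n'(3) i_def[symmetric] of_nat_numeral .
    show "mu_coeff 1 i k - ?c k \<in> E 1"
      by (intro is_subring_diff[OF sub] coeff_mu_E cE) simp
  qed auto
  moreover have "?c k \<in> carrier (Z_pi_ring p \<zeta> 1)" using cE cV carrier_Z_pi_ring[of 1] by simp
  ultimately show ?thesis
    unfolding cong_in_def min Z_pi_ring_1[symmetric] by (intro conjI coeff_carrier) auto
qed

end

theorem mainTheorem1:
  fixes p m i :: nat and \<zeta> :: "nat \<Rightarrow> 'a::field_char_0"
  assumes "Factorial_Ring.prime p" and "p \<ge> 3" and "m \<ge> 1" and "i \<ge> 1"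
    and "compatible_roots p \<zeta>"
  defines "A \<equiv> Z_pi_ring p \<zeta> m"
    and "a \<equiv> a_coeff p \<zeta> m"
  shows
    "((\<forall>j\<in>{0..p ^ i}. a i j \<in> carrier A) \<and>
      min_poly (E_field p \<zeta> m) (pi_elem p \<zeta> (m + i)) = (\<Sum>j = 0..p ^ i. monom (a i j) j) \<and>
      (\<Sum>j = 0..p ^ i. monom (a i j) j) =
        monom 1 (p ^ i) + (\<Sum>j = 1..p ^ i - 1. monom (a i j) j) - [:pi_elem p \<zeta> m:]) \<and>
     (\<forall>j\<in>{0..p ^ i}. of_nat (p ^ i) divides\<^bsub>A\<^esub> (of_nat j * a i j)) \<and>
     (\<forall>j\<in>{0..p ^ i}. real j < real (p ^ i) * (real p - 2) / (real p - 1) \<longrightarrow>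
        (of_nat (p ^ i) * pi_elem p \<zeta> m) divides\<^bsub>A\<^esub> (of_nat j * a i j)) \<and>
     (\<forall>j\<in>{0..p ^ i}. \<forall>\<beta>\<ge>1.
        cong_in A (of_nat (p ^ (i + 1))) (a i j) (a (i + \<beta>) (p ^ \<beta> * j))) \<and>
     (\<forall>j\<in>{0..p ^ i}. real j < real (p ^ i) * (real p - 2) / (real p - 1) \<longrightarrow>
        (\<forall>\<beta>\<ge>1. cong_in A (of_nat (p ^ (i + 1)) * pi_elem p \<zeta> m)
           (a i j) (a (i + \<beta>) (p ^ \<beta> * j)))) \<and>
     (\<forall>\<beta>\<in>{0..i - 1}.
        a i (p ^ i - (p ^ i - p ^ \<beta>) div (p - 1)) / of_nat (p ^ (i - \<beta>)) \<in> Units A) \<and>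
     (\<forall>n\<ge>2. \<forall>k.
        cong_in (subring_on (Z_localized p)) (of_nat (p ^ 2))
          (Polynomial.coeff (min_poly \<rat> (pi_elem p \<zeta> n)) k)
          (Polynomial.coeff (monom 1 (p ^ (n - 1)) + monom (of_nat p) ((p - 1) * p ^ (n - 2))
             - [:of_nat p:]) k))"
proof -
  interpret cyclotomic_tower p \<zeta> by unfold_locales fact+
  note m = \<open>m \<ge> 1\<close> and i = \<open>i \<ge> 1\<close>
  have a: "a k l = mu_coeff m k l" for k l
    using a_coeff_eq[OF m] by (simp add: a_def)
  have unit: "a i (p ^ i - (p ^ i - p ^ \<beta>) div (p - 1)) / of_nat (p ^ (i - \<beta>)) \<in> Units A"
    if "\<beta> \<in> {0..i - 1}" for \<beta>
    unfolding a A_def by (rule coeff_unit[OF m]) (use that i in auto)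
  have rat: "cong_in (subring_on (Z_localized p)) (of_nat (p ^ 2))
      (Polynomial.coeff (min_poly \<rat> (pi_elem p \<zeta> n)) k)
      (Polynomial.coeff (Polynomial.monom 1 (p ^ (n - 1)) + Polynomial.monom (of_nat p) ((p - 1) * p ^ (n - 2))
        - [:of_nat p:]) k)" if "n \<ge> 2" for n k
    by (rule min_poly_Rats_cong[OF that])
  show ?thesis
    unfolding real_bound_iff
    by (intro conjI ballI allI impI unit rat; (unfold a A_def)?)
      (use mu_sum[OF m i] min_poly_eq_mu[OF m, of i] coeff_carrier[OF m] coeff_divisibility[OF m]
        coeff_congruence[OF m] in auto)
qed

end
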